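(* Let $G$ be a 3-connected 1-tough graph with $n$ vertices and minimum degree $\delta$. If $\delta \geq \frac{1}{3}(n-2)$, then each longest cycle in $G$ is a dominating cycle.
   Context: All graphs are finite and undirected, without loops or multiple edges. For a graph $G$ let $s(G)$ be its number of connected components. $G$ is 1-tough if $|S| \geq s(G\setminus S)$ for every $S \subseteq V(G)$ with $s(G\setminus S) > 1$, where $G\setminus S$ is the subgraph induced by $V(G)\setminus S$. A cycle $C$ in $G$ is dominating if $G\setminus V(C)$ has no edges. *)

theory Defs
  imports Complex_Main "Graph_Theory.Graph_Theory"
begin

text \<open>
  Finite simple undirected graphs are taken from the AFP entry Graph\_Theory: the locale
  \<^locale>\<open>graph\<close> describes finite, loop-free, symmetric digraphs without parallel arcs, so an edge
  \<open>uv\<close> is represented by the two arcs from \<open>u\<close> to \<open>v\<close> and from \<open>v\<close> to \<open>u\<close>.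
\<close>

definition remove_verts :: "('a, 'b) pre_digraph \<Rightarrow> 'a set \<Rightarrow> ('a, 'b) pre_digraph" where
  "remove_verts G S = G \<restriction> (verts G - S)"

text \<open>
  In a symmetric digraph the strongly connected components are the connected components.
  The graph without vertices has none.
\<close>

definition num_components :: "('a, 'b) pre_digraph \<Rightarrow> nat" where
  "num_components G = card (pre_digraph.sccs G)"

text \<open>The name is qualified because Complex\_Main provides topological connectedness.\<close>

definition k_connected :: "nat \<Rightarrow> ('a, 'b) pre_digraph \<Rightarrow> bool" where
  "k_connected k G \<longleftrightarrow>
     k < card (verts G) \<and>
     (\<forall>S \<subseteq> verts G. card S < k \<longrightarrow> Digraph_Component.connected (remove_verts G S))"

definition one_tough :: "('a, 'b) pre_digraph \<Rightarrow> bool" where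
  "one_tough G \<longleftrightarrow>
     (\<forall>S \<subseteq> verts G. num_components (remove_verts G S) > 1 \<longrightarrow>
        card S \<ge> num_components (remove_verts G S))"

text \<open>In a graph in the above sense, the out-degree of a vertex is its number of neighbours.\<close>

definition min_degree :: "('a, 'b) pre_digraph \<Rightarrow> nat" where
  "min_degree G = Min (out_degree G ` verts G)"

text \<open>
  A cycle is given by its list of arcs, traversed once. The bound on the length rules out
  \<open>u, v, u\<close>, which is a cycle in the sense of digraphs but not of undirected graphs.
\<close>

definition graph_cycle :: "('a, 'b) pre_digraph \<Rightarrow> 'b awalk \<Rightarrow> bool" where
  "graph_cycle G C \<longleftrightarrow> pre_digraph.cycle G C \<and> 3 \<le> length C"

definition cycle_verts :: "('a, 'b) pre_digraph \<Rightarrow> 'b awalk \<Rightarrow> 'a set" where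
  "cycle_verts G C = set (pre_digraph.awalk_verts G (tail G (hd C)) C)"

definition longest_cycle :: "('a, 'b) pre_digraph \<Rightarrow> 'b awalk \<Rightarrow> bool" where
  "longest_cycle G C \<longleftrightarrow>
     graph_cycle G C \<and> (\<forall>D. graph_cycle G D \<longrightarrow> length D \<le> length C)"

definition dominating_cycle :: "('a, 'b) pre_digraph \<Rightarrow> 'b awalk \<Rightarrow> bool" where
  "dominating_cycle G C \<longleftrightarrow>
     graph_cycle G C \<and> arcs (remove_verts G (cycle_verts G C)) = {}"

end

theory Submission
  imports Defs
begin

text \<open>
  Let \<open>C\<close> be a longest cycle and suppose that some edge avoids it. Take a longest path \<open>P\<close> that avoids
  \<open>C\<close>, with \<open>k \<ge> 2\<close> vertices. Three disjoint paths from a cycle outside \<open>C\<close> to \<open>C\<close> (Menger) show that such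
  cycles are short, so both ends of \<open>P\<close> have at least three neighbours on \<open>C\<close> if \<open>k \<ge> 3\<close>. Since \<open>P\<close> cannot
  be inserted into \<open>C\<close>, distinct neighbours of different ends of \<open>P\<close> have at least \<open>k\<close> vertices of \<open>C\<close>
  between them; counting with \<open>n \<le> 3\<delta> + 2\<close> forces all vertices of \<open>P\<close> to have the same set \<open>X\<close> of neighbours
  on \<open>C\<close>, with \<open>card X = \<delta> - k + 1\<close>. The set \<open>X\<close> divides \<open>C\<close> into segments with at least \<open>k\<close> inner vertices
  each. By toughness, removing \<open>X\<close> cannot leave all segments in different components, so two segments are
  joined by an edge. Re-routing \<open>C\<close> through \<open>P\<close> and this edge shows that they have at least \<open>2k + 2\<close>
  inner vertices together, and then \<open>k = 2\<close> or \<open>k = card X = 3\<close>. The second case is settled by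
  exhibiting longer cycles. If \<open>k = 2\<close>, then all but at most three inner vertices of segments can be
  accounted for by two per segment. A segment with exactly two inner vertices can be exchanged with \<open>P\<close>, so
  these two vertices also have the same neighbours. This leaves few possible edges between segments, and
  removing \<open>X\<close> together with one or two further vertices contradicts toughness.
\<close>

section \<open>Cycles and paths as lists of vertices\<close>

text \<open>Let s be the size of \<open>X\<close>, so \<delta> = s + k - 1. The path
  \<open>P\<close>, the set \<open>X\<close> and k inner vertices of every segment make k + s(k + 1)
  vertices, and a link between two segments requires two more. With n <= 3\<delta> + 2 this becomes
  (s - 2)(k - 2) <= 1. Since s >= 3, either k = 2 or k = s = 3; for k = 2 no bound on s results.

  What is left over is a small budget of spare vertices: two for k = s = 3, three for k = 2, where n
  <= 3s + 5. Every inner vertex of a segment beyond the k-th and every vertex off \<open>C\<close>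
  and \<open>P\<close> uses up one. A link with inner vertices \<open>L\<close> costs 3 * length L +
  2, so links turn out to be single edges.

  The obstacle for k = 2 is that the budget permits several edges between segments that do not
  directly lead to a longer cycle. They lead to other longest cycles, which leave other edges
  outside. The ends of each such edge have the same neighbours, and these new adjacencies yield the
  longer cycle.\<close>

locale sgraph =
  fixes V :: "'a set" and adj :: "'a \<Rightarrow> 'a \<Rightarrow> bool"
  assumes finV: "finite V"
    and adj_sym: "adj u v \<Longrightarrow> adj v u"
    and adj_irrefl: "\<not> adj u u"
    and adj_V: "adj u v \<Longrightarrow> u \<in> V"
begin

lemma adj_V2: "adj u v \<Longrightarrow> v \<in> V"
  using adj_V adj_sym by blast

lemma adj_commute: "adj u v \<longleftrightarrow> adj v u"
  using adj_sym by blast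

definition chain :: "'a list \<Rightarrow> bool" where
  "chain xs \<longleftrightarrow> successively adj xs"

lemma chain_Nil [simp]: "chain []"
  and chain_Cons: "chain (x # xs) \<longleftrightarrow> xs = [] \<or> adj x (hd xs) \<and> chain xs"
  and chain_append: "chain (xs @ ys) \<longleftrightarrow>
    chain xs \<and> chain ys \<and> (xs = [] \<or> ys = [] \<or> adj (last xs) (hd ys))"
  by (simp_all add: chain_def successively_Cons successively_append_iff)

lemma chain_rev [simp]: "chain (rev xs) \<longleftrightarrow> chain xs"
proof -
  have "(\<lambda>x y. adj y x) = adj" using adj_commute by blast
  then show ?thesis by (simp only: chain_def successively_rev)
qed

definition cyc :: "'a list \<Rightarrow> bool" where
  "cyc xs \<longleftrightarrow> distinct xs \<and> set xs \<subseteq> V \<and> 3 \<le> length xs \<and> chain xs \<and> adj (last xs) (hd xs)"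

definition longest :: "'a list \<Rightarrow> bool" where
  "longest xs \<longleftrightarrow> cyc xs \<and> (\<forall>ys. cyc ys \<longrightarrow> length ys \<le> length xs)"

definition opath :: "'a list \<Rightarrow> 'a list \<Rightarrow> bool" where
  "opath C P \<longleftrightarrow> P \<noteq> [] \<and> distinct P \<and> set P \<subseteq> V \<and> set P \<inter> set C = {} \<and> chain P"

text \<open>\<open>P\<close> has no preferred direction: either end may be the one next to
  \<open>p\<close>. The constructions below insert \<open>P\<close> or its reverse.\<close>

definition joins :: "'a list \<Rightarrow> 'a \<Rightarrow> 'a \<Rightarrow> bool" where
  "joins P p q \<longleftrightarrow> adj p (hd P) \<and> adj (last P) q \<or> adj q (hd P) \<and> adj (last P) p"

lemma joins_commute: "joins P p q \<longleftrightarrow> joins P q p"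
  by (auto simp: joins_def)

lemma joins_oriented:
  assumes "joins P p q" "opath C P"
  obtains P' where "opath C P'" "set P' = set P" "length P' = length P"
    "adj p (hd P')" "adj (last P') q"
proof (cases "adj p (hd P) \<and> adj (last P) q")
  case True
  then show ?thesis using that assms by blast
next
  case False
  then have "adj q (hd P)" "adj (last P) p" using assms by (auto simp: joins_def)
  then show ?thesis using that[of "rev P"] assms adj_sym
    by (auto simp: opath_def hd_rev last_rev)
qed

lemma cyc_rotate: "cyc (xs @ ys) \<longleftrightarrow> cyc (ys @ xs)"
  by (cases "xs = []"; cases "ys = []") (auto simp: cyc_def chain_append)

lemma cyc_rev [simp]: "cyc (rev xs) \<longleftrightarrow> cyc xs"
  by (cases "xs = []") (auto simp: cyc_def hd_rev last_rev adj_commute)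

lemma longest_rotate: "longest (xs @ ys) \<longleftrightarrow> longest (ys @ xs)"
  unfolding longest_def using cyc_rotate[of xs ys] by (simp add: add.commute)

lemma longest_rev [simp]: "longest (rev xs) \<longleftrightarrow> longest xs"
  by (simp add: longest_def)

lemma longest_same_length: "longest C \<Longrightarrow> cyc D \<Longrightarrow> length D = length C \<Longrightarrow> longest D"
  by (auto simp: longest_def)

lemma longestD: "longest C \<Longrightarrow> cyc C" "longest C \<Longrightarrow> cyc D \<Longrightarrow> length D \<le> length C"
  by (auto simp: longest_def)

text \<open>Exchanging \<open>s\<close> for \<open>P\<close> gives another cycle, which must not be
  longer.\<close>

lemma gap:
  assumes "longest (x # s @ y # r)" "opath (x # s @ y # r) P" "joins P x y"
  shows "length P \<le> length s"
proof -
  obtain P' where P': "opath (x # s @ y # r) P'" "length P' = length P"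
    "adj x (hd P')" "adj (last P') y"
    using joins_oriented assms by metis
  have "cyc (x # s @ y # r)" using assms by (simp add: longest_def)
  then have "cyc (x # P' @ y # r)"
    using P' by (cases P') (auto simp: cyc_def opath_def chain_Cons chain_append hd_append)
  then show ?thesis using longestD(2)[OF assms(1)] P'(2) by fastforce
qed

text \<open>The common shape of the reroutings: two paths \<open>A\<close> and \<open>B\<close>
  joined by \<open>P\<close>, and a way \<open>W\<close> back from \<open>B\<close> to
  \<open>A\<close>. \<open>Q\<close> is \<open>P\<close> in the direction that fits.\<close>

lemma cyc_concat:
  assumes P: "opath C P" "joins P (last A) (hd B)" and AB: "A \<noteq> []" "B \<noteq> []" "chain A" "chain B"
    and W: "W \<noteq> []" "chain W" "adj (last B) (hd W)" "adj (last W) (hd A)"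
    and D: "distinct (A @ B @ W)" "set (A @ B @ W) \<subseteq> V - set P"
  shows "\<exists>Q. set Q = set P \<and> length Q = length P \<and> cyc (A @ Q @ B @ W)"
proof -
  obtain Q where Q: "opath C Q" "set Q = set P" "length Q = length P" "adj (last A) (hd Q)" "adj (last Q) (hd B)"
    using joins_oriented[OF P(2,1)] by metis
  then have ne: "Q \<noteq> []" "chain Q" "distinct Q" "set Q \<subseteq> V" by (auto simp: opath_def)
  have "cyc (A @ Q @ B @ W)"
    unfolding cyc_def
  proof (intro conjI)
    show "distinct (A @ Q @ B @ W)" "set (A @ Q @ B @ W) \<subseteq> V" using D ne(3,4) Q(2) by auto
    show "3 \<le> length (A @ Q @ B @ W)" using AB(1,2) ne(1) by (cases A; cases B; cases Q) auto
    have "chain (B @ W)" unfolding chain_append using AB(4) W(2,3) by simp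
    then show "chain (A @ Q @ B @ W)"
      unfolding chain_append[of A] chain_append[of Q] using AB ne Q(4,5) by simp
    show "adj (last (A @ Q @ B @ W)) (hd (A @ Q @ B @ W))" using AB(1) W(1,4) by simp
  qed
  then show ?thesis using Q(2,3) by blast
qed

text \<open>The reversed cycle, rotated into the same format: \<open>R1\<close> and
  \<open>R2\<close> change places and the segments are read backwards. Statements on front parts of
  segments thus carry over to rear parts.\<close>

lemma longest_mirror:
  "longest (R1 @ b @ R2 @ a) \<longleftrightarrow> longest (rev R2 @ rev b @ rev R1 @ rev a)"
proof -
  have "longest (R1 @ b @ R2 @ a) \<longleftrightarrow> longest (rev a @ rev R2 @ rev b @ rev R1)"
    using longest_rev[of "R1 @ b @ R2 @ a"] by simp
  also have "\<dots> \<longleftrightarrow> longest (rev R2 @ rev b @ rev R1 @ rev a)"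
    using longest_rotate[of "rev a" "rev R2 @ rev b @ rev R1"] by simp
  finally show ?thesis .
qed

end

section \<open>Menger's theorem\<close>

text \<open>Arcs instead of edges, since the induction in \<open>menger\<close> deletes a single arc
  and a symmetric relation would not stay symmetric.\<close>

definition dpath :: "('v \<times> 'v) set \<Rightarrow> 'v list \<Rightarrow> bool" where
  "dpath E p \<longleftrightarrow> p \<noteq> [] \<and> distinct p \<and> successively (\<lambda>x y. (x, y) \<in> E) p"

definition separates :: "('v \<times> 'v) set \<Rightarrow> 'v set \<Rightarrow> 'v set \<Rightarrow> 'v set \<Rightarrow> bool" where
  "separates E A B S \<longleftrightarrow>
     (\<forall>p. dpath E p \<longrightarrow> hd p \<in> A \<longrightarrow> last p \<in> B \<longrightarrow> set p \<inter> S \<noteq> {})"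

definition disjoint_paths :: "('v \<times> 'v) set \<Rightarrow> 'v set \<Rightarrow> 'v set \<Rightarrow> 'v list set \<Rightarrow> bool" where
  "disjoint_paths E A B \<P> \<longleftrightarrow> (\<forall>p\<in>\<P>. dpath E p \<and> hd p \<in> A \<and> last p \<in> B) \<and>
     (\<forall>p\<in>\<P>. \<forall>q\<in>\<P>. p \<noteq> q \<longrightarrow> set p \<inter> set q = {})"

lemma shorten_walk:
  assumes "p \<noteq> []" "successively R p"
  shows "\<exists>q. q \<noteq> [] \<and> distinct q \<and> successively R q \<and> hd q = hd p \<and> last q = last p \<and> set q \<subseteq> set p"
  using assms
proof (induction "length p" arbitrary: p rule: less_induct)
  case less
  show ?case
  proof (cases "distinct p")
    case True
    then show ?thesis using less.prems by blast
  next
    case False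
    then obtain a b c v where p: "p = a @ [v] @ b @ [v] @ c" using not_distinct_decomp by blast
    let ?p = "a @ [v] @ c"
    have "length ?p < length p" "?p \<noteq> []" by (auto simp: p)
    moreover have "successively R ?p" using less.prems(2)
      by (auto simp: p successively_append_iff successively_Cons)
    ultimately obtain q where "q \<noteq> []" "distinct q" "successively R q" "hd q = hd ?p"
      "last q = last ?p" "set q \<subseteq> set ?p" using less.hyps by blast
    moreover have "hd ?p = hd p" "last ?p = last p" "set ?p \<subseteq> set p" by (auto simp: p hd_append)
    ultimately show ?thesis by (metis order_trans)
  qed
qed

lemma separates_walk:
  assumes "separates E A B S" "p \<noteq> []" "successively (\<lambda>x y. (x, y) \<in> E) p" "hd p \<in> A" "last p \<in> B"
  shows "set p \<inter> S \<noteq> {}"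
proof -
  obtain q where "dpath E q" "hd q = hd p" "last q = last p" "set q \<subseteq> set p"
    using shorten_walk[OF assms(2,3)] by (auto simp: dpath_def)
  then show ?thesis using assms unfolding separates_def by fastforce
qed

lemma dpath_mono: "dpath F p \<Longrightarrow> F \<subseteq> E \<Longrightarrow> dpath E p"
  unfolding dpath_def by (auto elim!: successively_mono)

text \<open>Disjoint paths have different ends, so with as many paths as vertices in
  \<open>T\<close> every vertex of \<open>T\<close> is an end. No path meets \<open>T\<close> a
  second time, because that vertex already belongs to another path.\<close>

lemma disjoint_paths_last:
  assumes "disjoint_paths E A T \<P>" "finite T" "card \<P> = card T" "finite \<P>"
  shows "\<exists>f. (\<forall>t\<in>T. f t \<in> \<P> \<and> set (f t) \<inter> T = {t} \<and> last (f t) = t) \<and>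
    (\<forall>s\<in>T. \<forall>t\<in>T. s \<noteq> t \<longrightarrow> set (f s) \<inter> set (f t) = {})"
proof -
  have P: "p \<noteq> []" "last p \<in> T" "last p \<in> set p" if "p \<in> \<P>" for p
    using assms(1) that by (auto simp: disjoint_paths_def dpath_def)
  have dj: "set p \<inter> set q = {}" if "p \<in> \<P>" "q \<in> \<P>" "p \<noteq> q" for p q
    using assms(1) that by (auto simp: disjoint_paths_def)
  have inj: "inj_on last \<P>" using P(3) dj by (intro inj_onI) (metis disjoint_iff)
  have "last ` \<P> \<subseteq> T" using P by auto
  then have img: "last ` \<P> = T" using inj assms by (metis card_image card_subset_eq)
  let ?f = "inv_into \<P> last"
  have f: "?f t \<in> \<P>" "last (?f t) = t" if "t \<in> T" for t
    using that img by (metis inv_into_into, metis f_inv_into_f)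
  have "set (?f t) \<inter> T = {t}" if t: "t \<in> T" for t
  proof -
    have "s = t" if "s \<in> set (?f t)" "s \<in> T" for s
      using f[OF that(2)] f[OF t] that P(3)[OF f(1)[OF that(2)]] dj[of "?f s" "?f t"]
      by (metis IntI empty_iff)
    moreover have "t \<in> set (?f t)" using f[OF t] P(3) by metis
    ultimately show ?thesis using t by auto
  qed
  moreover have "set (?f s) \<inter> set (?f t) = {}" if "s \<in> T" "t \<in> T" "s \<noteq> t" for s t
    using f that dj by metis
  ultimately show ?thesis using f by (intro exI[of _ ?f]) blast
qed

lemma separates_rev: "separates (E\<inverse>) B A S \<longleftrightarrow> separates E A B S"
proof -
  have "separates (E\<inverse>) B A S" if "separates E A B S" for E A B
    unfolding separates_def
  proof (intro allI impI)
    fix p assume "dpath (E\<inverse>) p" "hd p \<in> B" "last p \<in> A"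
    then have "dpath E (rev p)" "hd (rev p) \<in> A" "last (rev p) \<in> B"
      by (auto simp: dpath_def hd_rev last_rev)
    then show "set p \<inter> S \<noteq> {}" using that by (metis separates_def set_rev)
  qed
  from this[of E A B] this[of "E\<inverse>" B A] show ?thesis by auto
qed

lemma disjoint_paths_rev:
  assumes "disjoint_paths E A B \<P>" shows "disjoint_paths (E\<inverse>) B A (rev ` \<P>)"
  using assms unfolding disjoint_paths_def dpath_def by (auto simp: hd_rev last_rev)

text \<open>A path through the arc \<open>(x, y)\<close> contains \<open>x\<close>.\<close>

lemma separates_insert_source:
  assumes "separates F A B S"
  shows "separates (insert (x, y) F) A B (insert x S)"
  unfolding separates_def
proof (intro allI impI notI)
  fix p assume p: "dpath (insert (x, y) F) p" "hd p \<in> A" "last p \<in> B" "set p \<inter> insert x S = {}"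
  have "successively (\<lambda>u v. (u, v) \<in> F) p"
    by (rule successively_mono[of "\<lambda>u v. (u, v) \<in> insert (x, y) F"]) (use p in \<open>auto simp: dpath_def\<close>)
  then show False using p assms by (auto simp: dpath_def separates_def)
qed

text \<open>Up to its first vertex in \<open>insert x S\<close> a path does not leave
  \<open>x\<close>, so this part uses only arcs of \<open>F\<close> and is met by
  \<open>T\<close>.\<close>

lemma separates_trans_source:
  assumes S: "separates (insert (x, y) F) A B (insert x S)" and T: "separates F A (insert x S) T"
  shows "separates (insert (x, y) F) A B T"
  unfolding separates_def
proof (intro allI impI)
  fix p assume p: "dpath (insert (x, y) F) p" "hd p \<in> A" "last p \<in> B"
  then have "\<exists>z\<in>set p. z \<in> insert x S" using S unfolding separates_def by blast
  then obtain p1 z p2 where z: "p = p1 @ z # p2" "z \<in> insert x S" "\<forall>v\<in>set p1. v \<notin> insert x S"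
    using split_list_first_prop[of p "\<lambda>v. v \<in> insert x S"] by blast
  have sp: "successively (\<lambda>u v. (u, v) \<in> insert (x, y) F) p1"
    "p1 \<noteq> [] \<Longrightarrow> (last p1, z) \<in> insert (x, y) F"
    using p(1) by (auto simp: z(1) dpath_def successively_append_iff)
  have "successively (\<lambda>u v. (u, v) \<in> F) p1"
    by (rule successively_mono[OF sp(1)]) (use z(3) in auto)
  moreover have "(last p1, z) \<in> F" if "p1 \<noteq> []" using sp(2) z(3) that by auto
  ultimately have "successively (\<lambda>u v. (u, v) \<in> F) (p1 @ [z])" by (auto simp: successively_append_iff)
  moreover have "hd (p1 @ [z]) \<in> A" using p(2) by (auto simp: z(1) hd_append split: if_splits)
  ultimately have "set (p1 @ [z]) \<inter> T \<noteq> {}" using separates_walk[OF T, of "p1 @ [z]"] z(2) by auto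
  then show "set p \<inter> T \<noteq> {}" by (auto simp: z(1))
qed

text \<open>Goering's proof: if deleting the arc \<open>(x, y)\<close> creates a separator \<open>S\<close> with fewer than \<open>k\<close>
  vertices, then \<open>S \<union> {x}\<close> and \<open>S \<union> {y}\<close> have \<open>k\<close> vertices, and disjoint paths from \<open>A\<close> to \<open>S \<union> {x}\<close> and
  from \<open>S \<union> {y}\<close> to \<open>B\<close> meet only in \<open>S\<close>, where they are glued together.\<close>

theorem menger:
  fixes E :: "('v \<times> 'v) set"
  assumes "finite E" "finite A" "finite B"
    and "\<And>S. finite S \<Longrightarrow> separates E A B S \<Longrightarrow> k \<le> card S"
  shows "\<exists>\<P>. finite \<P> \<and> card \<P> = k \<and> disjoint_paths E A B \<P>"
  using assms
proof (induction E arbitrary: A B rule: finite_induct)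
  case empty
  \<comment> \<open>Without arcs a path is a single vertex.\<close>
  have "separates {} A B (A \<inter> B)"
    unfolding separates_def
  proof (intro allI impI)
    fix p :: "'v list" assume p: "dpath {} p" "hd p \<in> A" "last p \<in> B"
    have "successively (\<lambda>x y. (x, y) \<in> {}) p \<Longrightarrow> length p \<le> 1" for p :: "'v list"
      by (cases p; cases "tl p") auto
    then have "length p \<le> 1" "p \<noteq> []" using p by (auto simp: dpath_def)
    then obtain v where "p = [v]" by (cases p) auto
    then show "set p \<inter> (A \<inter> B) \<noteq> {}" using p by auto
  qed
  then have "k \<le> card (A \<inter> B)" using empty by blast
  then obtain U where U: "U \<subseteq> A \<inter> B" "card U = k" "finite U"
    using obtain_subset_with_card_n by blast
  have "card ((\<lambda>v. [v]) ` U) = k" using U by (subst card_image) (auto simp: inj_on_def)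
  moreover have "disjoint_paths {} A B ((\<lambda>v. [v]) ` U)"
    using U by (auto simp: disjoint_paths_def dpath_def)
  ultimately show ?case using U(3) by blast
next
  case (insert e F)
  obtain x y where e: "e = (x, y)" by (cases e)
  let ?E = "insert (x, y) F"
  show ?case
  proof (cases "\<forall>S. finite S \<longrightarrow> separates F A B S \<longrightarrow> k \<le> card S")
    case True
    have "\<exists>\<P>. finite \<P> \<and> card \<P> = k \<and> disjoint_paths F A B \<P>"
      by (rule insert.IH) (use insert.prems True in auto)
    then obtain \<P> where "finite \<P>" "card \<P> = k" "disjoint_paths F A B \<P>" by blast
    moreover have "disjoint_paths (insert e F) A B \<P>"
      using calculation(3) dpath_mono[of F _ "insert e F"] by (auto simp: disjoint_paths_def)
    ultimately show ?thesis by blast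
  next
    case False
    then obtain S where S: "finite S" "separates F A B S" "card S < k" by force
    have large: "k \<le> card T" if "finite T" "separates ?E A B T" for T
      using insert.prems(3) that e by blast
    have E': "(insert (y, x) (F\<inverse>))\<inverse> = ?E" by auto
    have sx: "separates ?E A B (insert x S)" by (rule separates_insert_source[OF S(2)])
    \<comment> \<open>The statement for \<open>insert y S\<close> is the one for
      \<open>insert x S\<close> in the reversed digraph.\<close>
    have sy': "separates (insert (y, x) (F\<inverse>)) B A (insert y S)"
      using separates_insert_source[of "F\<inverse>" B A S y x] S(2) by (simp add: separates_rev)
    then have sy: "separates ?E A B (insert y S)" using separates_rev E' by metis
    have cx: "x \<notin> S" "card (insert x S) = k"
      using large[OF _ sx] S by (auto simp: card_insert_if split: if_splits)
    have cy: "y \<notin> S" "card (insert y S) = k"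
      using large[OF _ sy] S by (auto simp: card_insert_if split: if_splits)
    have "\<exists>\<P>. finite \<P> \<and> card \<P> = k \<and> disjoint_paths F A (insert x S) \<P>"
      by (rule insert.IH) (use insert.prems S large separates_trans_source[OF sx] in auto)
    then obtain \<P> where \<P>: "finite \<P>" "card \<P> = k" "disjoint_paths F A (insert x S) \<P>" by blast
    have "k \<le> card T" if T: "finite T" "separates F (insert y S) B T" for T
    proof -
      have "separates (F\<inverse>) B (insert y S) T" using T(2) by (simp add: separates_rev)
      then have "separates (insert (y, x) (F\<inverse>)) B A T" by (rule separates_trans_source[OF sy'])
      then show ?thesis using large[OF T(1)] separates_rev E' by metis
    qed
    then have "\<exists>\<Q>. finite \<Q> \<and> card \<Q> = k \<and> disjoint_paths F (insert y S) B \<Q>"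
      by (intro insert.IH) (use insert.prems S in auto)
    then obtain \<Q> where \<Q>: "finite \<Q>" "card \<Q> = k" "disjoint_paths F (insert y S) B \<Q>" by blast
    have "\<exists>f. (\<forall>t\<in>insert x S. f t \<in> \<P> \<and> set (f t) \<inter> insert x S = {t} \<and> last (f t) = t) \<and>
        (\<forall>s\<in>insert x S. \<forall>t\<in>insert x S. s \<noteq> t \<longrightarrow> set (f s) \<inter> set (f t) = {})"
      by (rule disjoint_paths_last[OF \<P>(3)]) (use \<P> cx S(1) in auto)
    then obtain P where P: "\<And>t. t \<in> insert x S \<Longrightarrow> P t \<in> \<P> \<and> set (P t) \<inter> insert x S = {t} \<and> last (P t) = t"
      "\<And>s t. s \<in> insert x S \<Longrightarrow> t \<in> insert x S \<Longrightarrow> s \<noteq> t \<Longrightarrow> set (P s) \<inter> set (P t) = {}"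
      by blast
    have "card (rev ` \<Q>) = k" using \<Q>(2) by (simp add: card_image)
    then have "\<exists>f. (\<forall>t\<in>insert y S. f t \<in> rev ` \<Q> \<and> set (f t) \<inter> insert y S = {t} \<and> last (f t) = t) \<and>
        (\<forall>s\<in>insert y S. \<forall>t\<in>insert y S. s \<noteq> t \<longrightarrow> set (f s) \<inter> set (f t) = {})"
      by (intro disjoint_paths_last[OF disjoint_paths_rev[OF \<Q>(3)]]) (use \<Q> cy S(1) in auto)
    then obtain Q' where Q': "\<And>t. t \<in> insert y S \<Longrightarrow>
        Q' t \<in> rev ` \<Q> \<and> set (Q' t) \<inter> insert y S = {t} \<and> last (Q' t) = t"
      "\<And>s t. s \<in> insert y S \<Longrightarrow> t \<in> insert y S \<Longrightarrow> s \<noteq> t \<Longrightarrow> set (Q' s) \<inter> set (Q' t) = {}"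
      by blast
    define Q where "Q t = rev (Q' t)" for t
    have Q: "Q t \<in> \<Q>" "set (Q t) \<inter> insert y S = {t}" "hd (Q t) = t" if "t \<in> insert y S" for t
      using Q'(1)[OF that] by (auto simp: Q_def hd_rev)
    have Q2: "set (Q s) \<inter> set (Q t) = {}" if "s \<in> insert y S" "t \<in> insert y S" "s \<noteq> t" for s t
      using Q'(2)[OF that] by (simp add: Q_def)
    have Pp: "dpath F (P t)" "hd (P t) \<in> A" if "t \<in> insert x S" for t
      using P(1)[OF that] \<P>(3) by (auto simp: disjoint_paths_def)
    have Qp: "dpath F (Q t)" "last (Q t) \<in> B" if "t \<in> insert y S" for t
      using Q(1)[OF that] \<Q>(3) by (auto simp: disjoint_paths_def)
    \<comment> \<open>Gluing \<open>P s\<close> and \<open>Q t\<close> at a common vertex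
      \<open>v\<close> outside \<open>S\<close> gives a walk from \<open>A\<close> to
      \<open>B\<close> in \<open>F\<close>, which must meet \<open>S\<close>. But \<open>P s\<close>
      meets \<open>S\<close> at most in its last vertex and \<open>Q t\<close> at most in its first
      one, and the walk uses \<open>P s\<close> only up to \<open>v\<close> and \<open>Q t\<close>
      only from \<open>v\<close> on.\<close>
    have cross: "v \<in> S \<and> v = s \<and> v = t"
      if s: "s \<in> insert x S" and t: "t \<in> insert y S" and v: "v \<in> set (P s)" "v \<in> set (Q t)" for s t v
    proof -
      obtain p1 p2 where p: "P s = p1 @ v # p2" using v(1) by (meson split_list)
      obtain q1 q2 where q: "Q t = q1 @ v # q2" using v(2) by (meson split_list)
      have vS: "v \<in> S"
      proof (rule ccontr)
        assume "v \<notin> S"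
        have "successively (\<lambda>x y. (x, y) \<in> F) (p1 @ v # q2)"
          using Pp(1)[OF s] Qp(1)[OF t] by (auto simp: p q dpath_def successively_append_iff)
        moreover have "hd (p1 @ v # q2) \<in> A" using Pp(2)[OF s] by (auto simp: p hd_append)
        moreover have "last (p1 @ v # q2) \<in> B" using Qp(2)[OF t] by (auto simp: q)
        ultimately have "set (p1 @ v # q2) \<inter> S \<noteq> {}"
          by (intro separates_walk[OF S(2)]) auto
        then obtain w where w: "w \<in> S" "w \<in> set p1 \<or> w \<in> set q2" using \<open>v \<notin> S\<close> by auto
        have "w \<notin> set p1"
        proof
          assume "w \<in> set p1"
          then have "w = s" using P(1)[OF s] w(1) p by auto
          then have "w = last (v # p2)" using P(1)[OF s] p by simp
          then have "w \<in> set (v # p2)" by (metis last_in_set list.distinct(1))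
          then show False using \<open>w \<in> set p1\<close> Pp(1)[OF s] by (auto simp: p dpath_def)
        qed
        moreover have "w \<notin> set q2"
        proof
          assume "w \<in> set q2"
          then have "w = t" using Q(2)[OF t] w(1) q by auto
          then have "w = hd (q1 @ [v])" using Q(3)[OF t] q by (auto simp: hd_append)
          then have "w \<in> set (q1 @ [v])" by (metis list.set_sel(1) snoc_eq_iff_butlast)
          then show False using \<open>w \<in> set q2\<close> Qp(1)[OF t] by (auto simp: q dpath_def)
        qed
        ultimately show False using w(2) by blast
      qed
      then show ?thesis using P(1)[OF s] Q(2)[OF t] v by auto
    qed
    \<comment> \<open>The path that ends in \<open>x\<close> continues through the restored arc to
      \<open>y\<close>. At a vertex of \<open>S\<close> both paths contain that vertex, and
      \<open>tl\<close> drops the second copy.\<close>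
    define R where "R t = (if t = x then P x @ Q y else P t @ tl (Q t))" for t
    have PR: "P t \<noteq> []" if "t \<in> insert x S" for t using Pp[OF that] by (simp add: dpath_def)
    have QR: "Q t \<noteq> []" if "t \<in> insert y S" for t using Qp[OF that] by (simp add: dpath_def)
    have R: "dpath ?E (R t) \<and> hd (R t) \<in> A \<and> last (R t) \<in> B" if t: "t \<in> insert x S" for t
    proof (cases "t = x")
      case True
      have d: "dpath ?E (P x)" "dpath ?E (Q y)"
        using dpath_mono[of F _ ?E] Pp[of x] Qp[of y] by auto
      have "set (P x) \<inter> set (Q y) = {}" using cross[of x y] cy by auto
      then show ?thesis using d True P(1)[of x] Q(3)[of y] Pp(2)[of x] Qp(2)[of y] QR[of y] PR[of x]
        by (auto simp: R_def dpath_def successively_append_iff hd_append)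
    next
      case False
      then have tS: "t \<in> S" using t by auto
      have d: "dpath ?E (P t)" "dpath ?E (Q t)"
        using dpath_mono[of F _ ?E] Pp[of t] Qp[of t] tS by auto
      obtain q where q: "Q t = t # q" using QR[of t] Q(3)[of t] tS by (cases "Q t") auto
      have "set (P t) \<inter> set q = {}"
        using cross[of t t] tS d(2) by (auto simp: q dpath_def)
      then show ?thesis
        using d P(1)[of t] Pp(2)[of t] Qp(2)[of t] tS PR[of t] False
        by (auto simp: R_def q dpath_def successively_append_iff successively_Cons hd_append last_append)
    qed
    have tl: "set (tl q) \<subseteq> set q" for q :: "'v list" by (cases q) auto
    have Rset: "\<exists>r\<in>insert y S. (r = t \<or> t = x \<and> r = y) \<and> set (R t) \<subseteq> set (P t) \<union> set (Q r)"
      if "t \<in> insert x S" for t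
      using that tl by (cases "t = x") (fastforce simp: R_def)+
    have Rdj: "set (R s) \<inter> set (R t) = {}" if st: "s \<in> insert x S" "t \<in> insert x S" "s \<noteq> t" for s t
    proof -
      obtain r where r: "r \<in> insert y S" "r = s \<or> s = x \<and> r = y" "set (R s) \<subseteq> set (P s) \<union> set (Q r)"
        using Rset st by blast
      obtain r' where r': "r' \<in> insert y S" "r' = t \<or> t = x \<and> r' = y"
        "set (R t) \<subseteq> set (P t) \<union> set (Q r')" using Rset st by blast
      have "r \<noteq> r'" using r r' st cx cy by auto
      then have "set (P s) \<inter> set (P t) = {}" "set (Q r) \<inter> set (Q r') = {}"
        using P(2) Q2 st r r' by auto
      moreover have "set (P s) \<inter> set (Q r') = {}"
        using cross[OF st(1) r'(1)] r' st cx cy by auto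
      moreover have "set (P t) \<inter> set (Q r) = {}"
        using cross[OF st(2) r(1)] r st cx cy by auto
      ultimately show ?thesis using r(3) r'(3) by blast
    qed
    have ne: "R t \<noteq> []" if "t \<in> insert x S" for t using R[OF that] by (simp add: dpath_def)
    have "inj_on R (insert x S)" using Rdj ne by (intro inj_onI) (metis Int_absorb set_empty)
    then have "card (R ` insert x S) = k" using cx(2) by (simp only: card_image)
    moreover have "disjoint_paths ?E A B (R ` insert x S)"
      unfolding disjoint_paths_def using R Rdj by blast
    ultimately show ?thesis using e S(1) by (metis finite_imageI finite_insert)
  qed
qed

section \<open>Disjoint paths to a longest cycle\<close>

context sgraph begin

text \<open>The end \<open>z\<close> on the cycle is kept apart from \<open>Q\<close>, so that
  \<open>Q\<close> avoids \<open>C\<close> and can be prolonged inside \<open>Z\<close> to a path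
  that avoids \<open>C\<close>.\<close>

definition ear :: "'a list \<Rightarrow> 'a set \<Rightarrow> 'a list \<Rightarrow> 'a \<Rightarrow> bool" where
  "ear C Z Q z \<longleftrightarrow> opath C Q \<and> hd Q \<in> Z \<and> set (tl Q) \<inter> Z = {} \<and> z \<in> set C \<and> adj (last Q) z"

text \<open>Cut at the first vertex on \<open>C\<close> and start at the last vertex of
  \<open>Z\<close> before it.\<close>

lemma ear_of_path:
  assumes p: "p \<noteq> []" "distinct p" "chain p" "hd p \<in> Z" "last p \<in> set C" "set p \<subseteq> V"
    and ZC: "Z \<inter> set C = {}"
  shows "\<exists>Q z. ear C Z Q z \<and> set Q \<subseteq> set p \<and> z \<in> set p"
proof -
  obtain p1 z p2 where z: "p = p1 @ z # p2" "z \<in> set C" "\<forall>v\<in>set p1. v \<notin> set C"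
    using split_list_first_prop[of p "\<lambda>v. v \<in> set C"] p by (metis last_in_set)
  have "p1 \<noteq> []" using z p ZC by (auto simp: disjoint_iff)
  then have "hd p1 \<in> Z" using p(4) z by simp
  then obtain s q t where q: "p1 = s @ q # t" "q \<in> Z" "\<forall>v\<in>set t. v \<notin> Z"
    using split_list_last_prop[of p1 "\<lambda>v. v \<in> Z"] \<open>p1 \<noteq> []\<close> by (metis hd_in_set)
  have "ear C Z (q # t) z"
    unfolding ear_def opath_def using p z q by (auto simp: chain_append chain_Cons)
  moreover have "set (q # t) \<subseteq> set p" "z \<in> set p" using z q by auto
  ultimately show ?thesis by blast
qed

lemma ear_joins:
  assumes e: "ear C Z Q1 z1" "ear C Z Q2 z2" "set Q1 \<inter> set Q2 = {}"
    and W: "W \<noteq> []" "distinct W" "chain W" "hd W = hd Q1" "last W = hd Q2" "set W \<subseteq> Z"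
      "set W \<subseteq> V" "set W \<inter> set C = {}"
  shows "\<exists>P. opath C P \<and> joins P z1 z2 \<and> length W \<le> length P"
proof -
  obtain q1 t1 where Q1: "Q1 = q1 # t1" using e by (cases Q1) (auto simp: ear_def opath_def)
  obtain q2 t2 where Q2: "Q2 = q2 # t2" using e by (cases Q2) (auto simp: ear_def opath_def)
  let ?P = "rev t1 @ W @ t2"
  have t: "set t1 \<inter> Z = {}" "set t2 \<inter> Z = {}" "distinct t1" "distinct t2" "set t1 \<inter> set t2 = {}"
    "chain t1" "chain t2" "t1 \<noteq> [] \<Longrightarrow> adj q1 (hd t1)" "t2 \<noteq> [] \<Longrightarrow> adj q2 (hd t2)"
    "set t1 \<union> set t2 \<subseteq> V" "(set t1 \<union> set t2) \<inter> set C = {}"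
    using e unfolding ear_def opath_def Q1 Q2 by (auto simp: chain_Cons)
  have Wq: "hd W = q1" "last W = q2" using W by (simp_all add: Q1 Q2)
  have "opath C ?P"
    unfolding opath_def
  proof (intro conjI)
    show "distinct ?P" using t W(2,6) by auto
    show "set ?P \<subseteq> V" "set ?P \<inter> set C = {}" using t W(7,8) by auto
    show "chain ?P" using t W(1,3) Wq by (auto simp: chain_append last_rev adj_sym)
  qed (use W(1) in simp)
  moreover have "hd ?P = last Q1" "last ?P = last Q2"
    using W(1) Wq by (auto simp: Q1 Q2 hd_append hd_rev last_append)
  then have "joins ?P z1 z2"
    using e adj_sym by (auto simp: ear_def joins_def)
  ultimately show ?thesis by (intro exI[of _ ?P]) auto
qed

text \<open>The three vertices divide \<open>C\<close> into three arcs, and by \<open>gap\<close>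
  each arc has at least as many inner vertices as the path joining its ends. The vertices may occur
  in two cyclic orders.\<close>

lemma three_gaps:
  assumes lon: "longest C" and z: "z1 \<in> set C" "z2 \<in> set C" "z3 \<in> set C" "z1 \<noteq> z2" "z2 \<noteq> z3" "z3 \<noteq> z1"
    and P: "opath C P12" "joins P12 z1 z2" "opath C P23" "joins P23 z2 z3" "opath C P31" "joins P31 z3 z1"
  shows "length P12 + length P23 + length P31 + 3 \<le> length C"
proof -
  have ordered: "length P12 + length P23 + length P31 + 3 \<le> length D"
    if D: "longest D" "D = z1 # s @ z2 # t @ z3 # u" "set D = set C"
      and P: "opath C P12" "joins P12 z1 z2" "opath C P23" "joins P23 z2 z3" "opath C P31" "joins P31 z3 z1"
    for z1 z2 z3 s t u P12 P23 P31 D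
  proof -
    have P': "opath E Q" if "opath C Q" "set E = set D" for Q E using that D(3) by (simp add: opath_def)
    have "length P12 \<le> length s" using gap[of z1 s z2 "t @ z3 # u" P12] D P P' by simp
    moreover have "length P23 \<le> length t"
      using gap[of z2 t z3 "u @ z1 # s" P23] longest_rotate[of "z1 # s" "z2 # t @ z3 # u"] D P
        P'[of P23 "z2 # t @ z3 # u @ z1 # s"] by auto
    moreover have "length P31 \<le> length u"
      using gap[of z3 u z1 "s @ z2 # t" P31] longest_rotate[of "z1 # s @ z2 # t" "z3 # u"] D P
        P'[of P31 "z3 # u @ z1 # s @ z2 # t"] by auto
    ultimately show ?thesis using D by simp
  qed
  obtain c1 c2 where C: "C = c1 @ z1 # c2" using z(1) by (meson split_list)
  have r: "longest (z1 # c2 @ c1)" using lon longest_rotate[of c1 "z1 # c2"] by (simp add: C)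
  have "z2 \<in> set (c2 @ c1)" using z C by auto
  then obtain s1 s2 where s: "c2 @ c1 = s1 @ z2 # s2" by (meson split_list)
  have "z3 \<in> set (c2 @ c1)" using z C by auto
  then consider "z3 \<in> set s1" | "z3 \<in> set s2" using s z by auto
  then show ?thesis
  proof cases
    case 1
    then obtain s t where "s1 = s @ z3 # t" by (meson split_list)
    then have D: "z1 # c2 @ c1 = z1 # s @ z3 # t @ z2 # s2" using s by simp
    have "length P31 + length P23 + length P12 + 3 \<le> length (z1 # c2 @ c1)"
      by (rule ordered[OF r D]) (use P joins_commute C in auto)
    then show ?thesis by (simp add: C)
  next
    case 2
    then obtain t u where "s2 = t @ z3 # u" by (meson split_list)
    then have D: "z1 # c2 @ c1 = z1 # s1 @ z2 # t @ z3 # u" using s by simp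
    have "length P12 + length P23 + length P31 + 3 \<le> length (z1 # c2 @ c1)"
      by (rule ordered[OF r D]) (use P C in auto)
    then show ?thesis by (simp add: C)
  qed
qed

definition path_in :: "'a set \<Rightarrow> 'a \<Rightarrow> 'a \<Rightarrow> 'a list \<Rightarrow> bool" where
  "path_in Z u v W \<longleftrightarrow> W \<noteq> [] \<and> distinct W \<and> chain W \<and> hd W = u \<and> last W = v \<and> set W \<subseteq> Z"

lemma path_in_rev: "path_in Z u v W \<Longrightarrow> path_in Z v u (rev W)"
  by (auto simp: path_in_def hd_rev last_rev)

text \<open>Between any two of three vertices of a cycle take the path through the third one.\<close>

lemma cycle_long_ways:
  assumes cyc: "cyc Z" and q: "q1 \<in> set Z" "q2 \<in> set Z" "q3 \<in> set Z" "q1 \<noteq> q2" "q2 \<noteq> q3" "q3 \<noteq> q1"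
  shows "\<exists>W12 W23 W31. path_in (set Z) q1 q2 W12 \<and> path_in (set Z) q2 q3 W23 \<and>
    path_in (set Z) q3 q1 W31 \<and> length W12 + length W23 + length W31 = 2 * length Z + 3"
proof -
  have one: "path_in (set D) q1 q2 (q1 # rev u @ q3 # rev t @ [q2])"
    if "cyc D" "D = q1 # s @ q2 # t @ q3 # u" for q1 q2 q3 s t u D
    using that unfolding path_in_def cyc_def
    by (auto simp: chain_append chain_Cons last_rev hd_append hd_rev last_append adj_commute split: if_splits)
  have ordered: "\<exists>W12 W23 W31. path_in (set D) q1 q2 W12 \<and> path_in (set D) q2 q3 W23 \<and>
      path_in (set D) q3 q1 W31 \<and> length W12 + length W23 + length W31 = 2 * length D + 3"
    if D: "cyc D" "D = q1 # s @ q2 # t @ q3 # u" for q1 q2 q3 s t u D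
  proof -
    have "path_in (set D) q1 q2 (q1 # rev u @ q3 # rev t @ [q2])" by (rule one[OF D])
    moreover have "cyc (q2 # t @ q3 # u @ q1 # s)"
      using D cyc_rotate[of "q1 # s" "q2 # t @ q3 # u"] by simp
    then have "path_in (set D) q2 q3 (q2 # rev s @ q1 # rev u @ [q3])"
      using one[OF _ refl, of q2 t q3 u q1 s] D by (auto simp: path_in_def)
    moreover have "cyc (q3 # u @ q1 # s @ q2 # t)"
      using D cyc_rotate[of "q1 # s @ q2 # t" "q3 # u"] by simp
    then have "path_in (set D) q3 q1 (q3 # rev t @ q2 # rev s @ [q1])"
      using one[OF _ refl, of q3 u q1 s q2 t] D by (auto simp: path_in_def)
    \<comment> \<open>Each arc is avoided by one of the three paths only, so its inner vertices
      count twice, while \<open>q1\<close>, \<open>q2\<close>, \<open>q3\<close> count three times: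
      2 * (length D - 3) + 9.\<close>
    moreover have "length (q1 # rev u @ q3 # rev t @ [q2]) + length (q2 # rev s @ q1 # rev u @ [q3]) +
        length (q3 # rev t @ q2 # rev s @ [q1]) = 2 * length D + 3" using D by simp
    ultimately show ?thesis by blast
  qed
  obtain c1 c2 where Z: "Z = c1 @ q1 # c2" using q(1) by (meson split_list)
  have r: "cyc (q1 # c2 @ c1)" using cyc cyc_rotate[of c1 "q1 # c2"] by (simp add: Z)
  have eq: "set (q1 # c2 @ c1) = set Z" "length (q1 # c2 @ c1) = length Z" by (auto simp: Z)
  have "q2 \<in> set (c2 @ c1)" using q Z by auto
  then obtain s1 s2 where s: "c2 @ c1 = s1 @ q2 # s2" by (meson split_list)
  have "q3 \<in> set (c2 @ c1)" using q Z by auto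
  then consider "q3 \<in> set s1" | "q3 \<in> set s2" using s q by auto
  then show ?thesis
  proof cases
    case 1
    then obtain s t where "s1 = s @ q3 # t" by (meson split_list)
    then have D: "q1 # c2 @ c1 = q1 # s @ q3 # t @ q2 # s2" using s by simp
    obtain W13 W32 W21 where W: "path_in (set Z) q1 q3 W13" "path_in (set Z) q3 q2 W32"
      "path_in (set Z) q2 q1 W21" "length W13 + length W32 + length W21 = 2 * length Z + 3"
      using ordered[OF r D] unfolding eq by blast
    then show ?thesis
      by (intro exI[of _ "rev W21"] exI[of _ "rev W32"] exI[of _ "rev W13"]) (auto intro: path_in_rev)
  next
    case 2
    then obtain t u where "s2 = t @ q3 # u" by (meson split_list)
    then have D: "q1 # c2 @ c1 = q1 # s1 @ q2 # t @ q3 # u" using s by simp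
    show ?thesis using ordered[OF r D] unfolding eq .
  qed
qed

end

text \<open>In \<open>conn3\<close>, \<open>U\<close> is a union of components of the graph without \<open>S\<close>; in \<open>tough\<close>, \<open>f\<close> is
  constant on these components, so that its values bound their number from below.\<close>

locale tough_graph = sgraph +
  fixes \<delta> :: nat
  assumes deg: "v \<in> V \<Longrightarrow> \<delta> \<le> card {u. adj v u}"
    and conn3: "\<lbrakk>S \<subseteq> V; card S < 3; U \<subseteq> V - S; U \<noteq> {};
      \<And>u v. u \<in> U \<Longrightarrow> adj u v \<Longrightarrow> v \<in> U \<union> S\<rbrakk> \<Longrightarrow> U \<union> S = V"
    and tough: "\<And>f :: 'a \<Rightarrow> 'a option. \<lbrakk>S \<subseteq> V; \<And>u v. u \<in> V - S \<Longrightarrow> v \<in> V - S \<Longrightarrow> adj u v \<Longrightarrow> f u = f v;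
      1 < card (f ` (V - S))\<rbrakk> \<Longrightarrow> card (f ` (V - S)) \<le> card S"
    and order: "card V \<le> 3 * \<delta> + 2"
begin

text \<open>Menger's theorem for three paths between \<open>Z\<close> and \<open>C\<close>. Both
  sets have at least three vertices, so fewer than three vertices cannot separate them.\<close>

lemma ears:
  assumes cyc: "cyc C" and Z: "Z \<subseteq> V" "Z \<inter> set C = {}" "3 \<le> card Z"
  shows "\<exists>Q1 z1 Q2 z2 Q3 z3. ear C Z Q1 z1 \<and> ear C Z Q2 z2 \<and> ear C Z Q3 z3 \<and>
    set Q1 \<inter> set Q2 = {} \<and> set Q2 \<inter> set Q3 = {} \<and> set Q3 \<inter> set Q1 = {} \<and>
    z1 \<noteq> z2 \<and> z2 \<noteq> z3 \<and> z3 \<noteq> z1"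
proof -
  let ?E = "{(u, v). adj u v}"
  have "?E \<subseteq> V \<times> V" using adj_V adj_V2 by auto
  then have finE: "finite ?E" using finV finite_subset by fastforce
  have C: "set C \<subseteq> V" "3 \<le> card (set C)" using cyc by (auto simp: cyc_def distinct_card)
  have walkV: "set p \<subseteq> V" if "p \<noteq> []" "chain p" "hd p \<in> V" for p
    using that
  proof (induction p)
    case (Cons a p)
    then show ?case by (cases "p = []") (auto simp: chain_Cons dest: adj_V2)
  qed simp
  have sep3: "3 \<le> card S" if S: "finite S" "separates ?E Z (set C) S" for S
  proof (rule ccontr)
    assume "\<not> 3 \<le> card S"
    let ?S = "S \<inter> V"
    \<comment> \<open>The vertices reachable from \<open>Z\<close> without \<open>?S\<close>, a
      union of components as required by \<open>conn3\<close>.\<close>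
    define U where "U = {v. \<exists>p. p \<noteq> [] \<and> chain p \<and> hd p \<in> Z \<and> last p = v \<and> set p \<inter> ?S = {}}"
    have "card ?S \<le> card S" using S by (auto intro: card_mono)
    then have S3: "card ?S < 3" using \<open>\<not> 3 \<le> card S\<close> by simp
    have pick: "\<exists>x\<in>X. x \<notin> ?S" if "3 \<le> card X" for X
      using card_mono[of ?S X] S S3 that by (auto simp: subset_iff)
    have "U \<union> ?S = V"
    proof (rule conn3[OF _ S3])
      show "U \<subseteq> V - ?S"
      proof
        fix v assume "v \<in> U"
        then obtain p where p: "p \<noteq> []" "chain p" "hd p \<in> Z" "last p = v" "set p \<inter> ?S = {}"
          by (auto simp: U_def)
        then have "v \<in> set p" "set p \<subseteq> V" using walkV[of p] Z(1) by auto
        then show "v \<in> V - ?S" using p(5) by blast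
      qed
      obtain z where "z \<in> Z" "z \<notin> ?S" using pick[OF Z(3)] by blast
      then have "z \<in> U" unfolding U_def by (auto intro!: exI[of _ "[z]"] simp: chain_Cons)
      then show "U \<noteq> {}" by blast
      fix u v assume u: "u \<in> U" "adj u v"
      then obtain p where p: "p \<noteq> []" "chain p" "hd p \<in> Z" "last p = u" "set p \<inter> ?S = {}"
        by (auto simp: U_def)
      have "v \<in> U" if "v \<notin> ?S"
        unfolding U_def mem_Collect_eq
        by (rule exI[of _ "p @ [v]"]) (use p u that in \<open>auto simp: chain_append chain_Cons\<close>)
      then show "v \<in> U \<union> ?S" by blast
    qed simp
    obtain c where c: "c \<in> set C" "c \<notin> ?S" using pick[OF C(2)] by blast
    then have "c \<in> U" using \<open>U \<union> ?S = V\<close> C by auto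
    then obtain p where p: "p \<noteq> []" "chain p" "hd p \<in> Z" "last p = c" "set p \<inter> ?S = {}"
      by (auto simp: U_def)
    have "set p \<inter> S \<noteq> {}"
      using separates_walk[OF S(2), of p] p c by (simp add: chain_def)
    then show False using walkV[of p] p Z(1) by auto
  qed
  have "\<exists>\<P>. finite \<P> \<and> card \<P> = 3 \<and> disjoint_paths ?E Z (set C) \<P>"
    by (rule menger) (use finE sep3 Z(1) finV finite_subset in auto)
  then obtain \<P> where P: "card \<P> = 3" "disjoint_paths ?E Z (set C) \<P>" by blast
  have "\<exists>Q z. ear C Z Q z \<and> set Q \<subseteq> set p \<and> z \<in> set p" if "p \<in> \<P>" for p
  proof (rule ear_of_path)
    have "dpath ?E p" "hd p \<in> Z" "last p \<in> set C" using P(2) that by (auto simp: disjoint_paths_def)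
    then show "p \<noteq> []" "distinct p" "chain p" "hd p \<in> Z" "last p \<in> set C"
      by (auto simp: dpath_def chain_def)
    then show "set p \<subseteq> V" using walkV Z(1) by blast
    show "Z \<inter> set C = {}" by (rule Z(2))
  qed
  then obtain Q z where Qz: "\<And>p. p \<in> \<P> \<Longrightarrow> ear C Z (Q p) (z p) \<and> set (Q p) \<subseteq> set p \<and> z p \<in> set p"
    by metis
  obtain p1 p2 p3 where p: "\<P> = {p1, p2, p3}" "p1 \<noteq> p2" "p2 \<noteq> p3" "p1 \<noteq> p3"
    using P(1) by (auto simp: card_3_iff)
  then have dj: "set p1 \<inter> set p2 = {}" "set p2 \<inter> set p3 = {}" "set p3 \<inter> set p1 = {}"
    using P(2) by (auto simp: disjoint_paths_def)
  have Q: "ear C Z (Q p) (z p)" "set (Q p) \<subseteq> set p" "z p \<in> set p" if "p \<in> {p1, p2, p3}" for p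
    using Qz that p by blast+
  have *: "set (Q p) \<inter> set (Q q) = {} \<and> z p \<noteq> z q"
    if "p \<in> {p1, p2, p3}" "q \<in> {p1, p2, p3}" "set p \<inter> set q = {}" for p q
    using Q(2,3)[OF that(1)] Q(2,3)[OF that(2)] that(3) by (metis disjoint_iff subset_iff)
  have "ear C Z (Q p1) (z p1) \<and> ear C Z (Q p2) (z p2) \<and> ear C Z (Q p3) (z p3) \<and>
    set (Q p1) \<inter> set (Q p2) = {} \<and> set (Q p2) \<inter> set (Q p3) = {} \<and> set (Q p3) \<inter> set (Q p1) = {} \<and>
    z p1 \<noteq> z p2 \<and> z p2 \<noteq> z p3 \<and> z p3 \<noteq> z p1"
    using Q(1) *[OF _ _ dj(1)] *[OF _ _ dj(2)] *[OF _ _ dj(3)] by simp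
  then show ?thesis by blast
qed

text \<open>Three ears, joined in pairs along the long ways round \<open>Z\<close>, give paths with
  at least 2 * length Z + 3 vertices in all; the three vertices of attachment on \<open>C\<close>
  come on top.\<close>

lemma cycle_outside:
  assumes lon: "longest C" and Z: "cyc Z" "set Z \<inter> set C = {}"
  shows "2 * length Z + 6 \<le> length C"
proof -
  have ZV: "set Z \<subseteq> V" "3 \<le> card (set Z)" using Z by (auto simp: cyc_def distinct_card)
  obtain Q1 z1 Q2 z2 Q3 z3 where e: "ear C (set Z) Q1 z1" "ear C (set Z) Q2 z2" "ear C (set Z) Q3 z3"
    and dj: "set Q1 \<inter> set Q2 = {}" "set Q2 \<inter> set Q3 = {}" "set Q3 \<inter> set Q1 = {}"
    and z: "z1 \<noteq> z2" "z2 \<noteq> z3" "z3 \<noteq> z1"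
    using ears[OF longestD(1)[OF lon] ZV(1) Z(2) ZV(2)] by blast
  have h: "hd Q1 \<in> set Z" "hd Q2 \<in> set Z" "hd Q3 \<in> set Z" "hd Q1 \<in> set Q1" "hd Q2 \<in> set Q2" "hd Q3 \<in> set Q3"
    "z1 \<in> set C" "z2 \<in> set C" "z3 \<in> set C"
    using e by (auto simp: ear_def opath_def)
  then obtain W12 W23 W31 where W: "path_in (set Z) (hd Q1) (hd Q2) W12"
    "path_in (set Z) (hd Q2) (hd Q3) W23" "path_in (set Z) (hd Q3) (hd Q1) W31"
    "length W12 + length W23 + length W31 = 2 * length Z + 3"
    using cycle_long_ways[OF Z(1), of "hd Q1" "hd Q2" "hd Q3"] dj by (metis disjoint_iff)
  have ext: "\<exists>P. opath C P \<and> joins P z z' \<and> length W \<le> length P"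
    if "ear C (set Z) Q z" "ear C (set Z) Q' z'" "set Q \<inter> set Q' = {}" "path_in (set Z) (hd Q) (hd Q') W"
    for Q z Q' z' W
    using ear_joins[OF that(1-3), of W] that(4) Z ZV by (auto simp: path_in_def)
  obtain P12 where P12: "opath C P12" "joins P12 z1 z2" "length W12 \<le> length P12"
    using ext[OF e(1,2) dj(1) W(1)] by blast
  obtain P23 where P23: "opath C P23" "joins P23 z2 z3" "length W23 \<le> length P23"
    using ext[OF e(2,3) dj(2) W(2)] by blast
  obtain P31 where P31: "opath C P31" "joins P31 z3 z1" "length W31 \<le> length P31"
    using ext[OF e(3,1) dj(3) W(3)] by blast
  show ?thesis
    using three_gaps[OF lon h(7-9) z P12(1,2) P23(1,2) P31(1,2)] P12 P23 P31 W(4) by linarith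
qed

text \<open>The three ears start in all three vertices. The pair \<open>x\<close>, \<open>w\<close>
  is connected by a path on three vertices, the other two pairs by two: 3 + 2 + 2 = 7, and three
  vertices of attachment on \<open>C\<close> make 10.\<close>

lemma path3_outside:
  assumes lon: "longest C" and P: "opath C [x, y, w]"
  shows "10 \<le> length C"
proof -
  let ?Z = "{x, y, w}"
  have d: "x \<noteq> y" "y \<noteq> w" "x \<noteq> w" "adj x y" "adj y w" "?Z \<subseteq> V" "?Z \<inter> set C = {}"
    using P by (auto simp: opath_def chain_Cons)
  then have c3: "3 \<le> card ?Z" by simp
  obtain Q1 z1 Q2 z2 Q3 z3 where e: "ear C ?Z Q1 z1" "ear C ?Z Q2 z2" "ear C ?Z Q3 z3"
    and dj: "set Q1 \<inter> set Q2 = {}" "set Q2 \<inter> set Q3 = {}" "set Q3 \<inter> set Q1 = {}"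
    and z: "z1 \<noteq> z2" "z2 \<noteq> z3" "z3 \<noteq> z1"
    using ears[OF longestD(1)[OF lon] d(6,7) c3] by blast
  have h: "hd Q1 \<in> ?Z" "hd Q2 \<in> ?Z" "hd Q3 \<in> ?Z" "hd Q1 \<in> set Q1" "hd Q2 \<in> set Q2" "hd Q3 \<in> set Q3"
    "z1 \<in> set C" "z2 \<in> set C" "z3 \<in> set C"
    using e by (auto simp: ear_def opath_def)
  define l where "l u v = (if u \<noteq> y \<and> v \<noteq> y then 3 else 2 :: nat)" for u v
  have exW: "\<exists>W. path_in ?Z u v W \<and> length W = l u v" if "u \<in> ?Z" "v \<in> ?Z" "u \<noteq> v" for u v
  proof (cases "u \<noteq> y \<and> v \<noteq> y")
    case True
    then have "path_in ?Z u v [u, y, v]"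
      using that d by (auto simp: path_in_def chain_Cons adj_commute)
    then show ?thesis using True by (intro exI[of _ "[u, y, v]"]) (simp add: l_def)
  next
    case False
    then have "path_in ?Z u v [u, v]"
      using that d by (auto simp: path_in_def chain_Cons adj_commute)
    then show ?thesis using False by (intro exI[of _ "[u, v]"]) (simp add: l_def)
  qed
  have hd: "hd Q1 \<noteq> hd Q2" "hd Q2 \<noteq> hd Q3" "hd Q3 \<noteq> hd Q1"
    using h dj by (metis disjoint_iff)+
  obtain W12 where W12: "path_in ?Z (hd Q1) (hd Q2) W12" "length W12 = l (hd Q1) (hd Q2)"
    using exW[OF h(1,2) hd(1)] by blast
  obtain W23 where W23: "path_in ?Z (hd Q2) (hd Q3) W23" "length W23 = l (hd Q2) (hd Q3)"
    using exW[OF h(2,3) hd(2)] by blast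
  obtain W31 where W31: "path_in ?Z (hd Q3) (hd Q1) W31" "length W31 = l (hd Q3) (hd Q1)"
    using exW[OF h(3,1) hd(3)] by blast
  have ext: "\<exists>P. opath C P \<and> joins P z z' \<and> length W \<le> length P"
    if "ear C ?Z Q z" "ear C ?Z Q' z'" "set Q \<inter> set Q' = {}" "path_in ?Z (hd Q) (hd Q') W"
    for Q z Q' z' W
  proof (rule ear_joins[OF that(1-3)])
    show "set W \<subseteq> V" "set W \<inter> set C = {}" using that(4) d by (auto simp: path_in_def)
  qed (use that(4) in \<open>auto simp: path_in_def\<close>)
  obtain P12 where P12: "opath C P12" "joins P12 z1 z2" "length W12 \<le> length P12"
    using ext[OF e(1,2) dj(1) W12(1)] by blast
  obtain P23 where P23: "opath C P23" "joins P23 z2 z3" "length W23 \<le> length P23"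
    using ext[OF e(2,3) dj(2) W23(1)] by blast
  obtain P31 where P31: "opath C P31" "joins P31 z3 z1" "length W31 \<le> length P31"
    using ext[OF e(3,1) dj(3) W31(1)] by blast
  have "7 \<le> l (hd Q1) (hd Q2) + l (hd Q2) (hd Q3) + l (hd Q3) (hd Q1)"
    using h(1-3) hd by (auto simp: l_def)
  then show ?thesis
    using three_gaps[OF lon h(7-9) z P12(1,2) P23(1,2) P31(1,2)] P12 P23 P31 W12 W23 W31 by linarith
qed

end

section \<open>Segments of a cycle\<close>

text \<open>A cycle is cut at the vertices of a set \<open>X\<close>: a pair \<open>(x, s)\<close> stands for a vertex \<open>x\<close> of \<open>X\<close> and the
  list \<open>s\<close> of the vertices between \<open>x\<close> and the next vertex of \<open>X\<close>.\<close>

definition flat :: "('a \<times> 'a list) list \<Rightarrow> 'a list" where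
  "flat ss = concat (map (\<lambda>(x, s). x # s) ss)"

lemma flat_simps [simp]: "flat [] = []" "flat ((x, s) # ss) = x # s @ flat ss"
  "flat (ss @ tt) = flat ss @ flat tt"
  by (simp_all add: flat_def)

definition segs :: "'a set \<Rightarrow> ('a \<times> 'a list) list \<Rightarrow> bool" where
  "segs X ss \<longleftrightarrow> (\<forall>t\<in>set ss. fst t \<in> X \<and> set (snd t) \<inter> X = {})"

lemma segs_simps [simp]: "segs X []" "segs X (t # ss) \<longleftrightarrow> fst t \<in> X \<and> set (snd t) \<inter> X = {} \<and> segs X ss"
  "segs X (ss @ tt) \<longleftrightarrow> segs X ss \<and> segs X tt"
  by (auto simp: segs_def)

lemma segs_exist:
  assumes "xs = [] \<or> hd xs \<in> X"
  shows "\<exists>ss. flat ss = xs \<and> segs X ss"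
  using assms
proof (induction "length xs" arbitrary: xs rule: less_induct)
  case less
  show ?case
  proof (cases xs)
    case Nil
    then show ?thesis by (intro exI[of _ "[]"]) simp
  next
    case (Cons x r)
    let ?s = "takeWhile (\<lambda>v. v \<notin> X) r" and ?r = "dropWhile (\<lambda>v. v \<notin> X) r"
    have "length ?r < length xs" using Cons by (simp add: le_imp_less_Suc length_dropWhile_le)
    moreover have "?r = [] \<or> hd ?r \<in> X" using hd_dropWhile[of "\<lambda>v. v \<notin> X" r] by auto
    ultimately obtain ss where "flat ss = ?r" "segs X ss" using less.hyps by blast
    then have "flat ((x, ?s) # ss) = xs \<and> segs X ((x, ?s) # ss)"
      using less.prems Cons by (auto dest: set_takeWhileD)
    then show ?thesis by blast
  qed
qed

lemma set_flat: "set (flat ss) = (\<Union>t\<in>set ss. insert (fst t) (set (snd t)))"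
proof (induction ss)
  case (Cons t ss)
  then show ?case by (cases t) (simp add: Un_ac)
qed simp

lemma in_seg:
  assumes "segs X ss" "v \<in> set (flat ss) - X"
  shows "\<exists>t\<in>set ss. v \<in> set (snd t)"
proof -
  obtain t where t: "t \<in> set ss" "v \<in> insert (fst t) (set (snd t))" using assms(2) by (auto simp: set_flat)
  moreover have "fst t \<in> X" using assms(1) t(1) by (simp add: segs_def)
  ultimately show ?thesis using assms(2) by auto
qed

lemma flat_eq_Nil [simp]: "flat ss = [] \<longleftrightarrow> ss = []"
  by (cases ss) auto

lemma fst_segs: "segs X ss \<Longrightarrow> X \<subseteq> set (flat ss) \<Longrightarrow> fst ` set ss = X"
  by (force simp: segs_def set_flat disjoint_iff)

lemma distinct_flatD: "distinct (flat ss) \<Longrightarrow> distinct (map fst ss)"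
  by (induction ss) (auto simp: set_flat, metis fst_conv)

lemma length_flat:
  assumes "distinct (flat ss)"
  shows "length (flat ss) = card (set ss) + (\<Sum>t\<in>set ss. length (snd t))"
proof -
  have "distinct ss" using distinct_flatD[OF assms] by (simp add: distinct_map)
  then show ?thesis using assms by (induction ss) (auto simp: distinct_card)
qed

lemma card_segs:
  assumes "distinct (flat ss)" "segs X ss" "X \<subseteq> set (flat ss)"
  shows "card (set ss) = card X"
  using distinct_flatD[OF assms(1)] fst_segs[OF assms(2,3)] card_image[of fst "set ss"]
  by (simp add: distinct_map)

lemma seg_unique:
  assumes "distinct (flat ss)" "t \<in> set ss" "t' \<in> set ss" "v \<in> set (snd t)" "v \<in> set (snd t')"
  shows "t = t'"
proof (rule ccontr)
  assume "t \<noteq> t'"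
  obtain s1 s2 where s: "ss = s1 @ t # s2" using assms(2) by (meson split_list)
  then have "t' \<in> set s1 \<union> set s2" using \<open>t \<noteq> t'\<close> assms(3) by auto
  then have "v \<in> set (flat s1) \<union> set (flat s2)" using assms(5) by (auto simp: set_flat)
  moreover have "flat ss = flat s1 @ fst t # snd t @ flat s2" using s by (cases t) auto
  ultimately show False using assms(1,4) by auto
qed

text \<open>A segment is named by the vertex of \<open>X\<close> in front of it, which makes
  \<open>X\<close> itself the set of labels in the applications of toughness.\<close>

definition lab :: "('a \<times> 'a list) list \<Rightarrow> 'a \<Rightarrow> 'a" where
  "lab ss v = fst (THE t. t \<in> set ss \<and> v \<in> set (snd t))"

lemma lab_eq: "distinct (flat ss) \<Longrightarrow> t \<in> set ss \<Longrightarrow> v \<in> set (snd t) \<Longrightarrow> lab ss v = fst t"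
  unfolding lab_def by (rule arg_cong[where f = fst]) (auto intro: the_equality dest: seg_unique)

context sgraph begin

text \<open>Stated up to rotation, so that the last segment of the list, whose successor is the
  first vertex, needs no separate treatment.\<close>

definition nxt :: "'a list \<Rightarrow> 'a \<Rightarrow> 'a list \<Rightarrow> 'a \<Rightarrow> bool" where
  "nxt C x s y \<longleftrightarrow> (\<exists>r. longest (x # s @ y # r) \<and> set (x # s @ y # r) = set C)"

lemma gap_nxt: "nxt C x s y \<Longrightarrow> opath C P \<Longrightarrow> joins P x y \<Longrightarrow> length P \<le> length s"
  unfolding nxt_def using gap by (metis opath_def)

lemma nxt_flat:
  assumes "longest (flat (s1 @ (x, s) # s2))" "flat (s2 @ s1) = y # r"
  shows "nxt (flat (s1 @ (x, s) # s2)) x s y"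
proof -
  have "longest (x # s @ flat s2 @ flat s1)"
    using assms(1) longest_rotate[of "flat s1" "x # s @ flat s2"] by simp
  moreover have "set (flat s2) \<union> set (flat s1) = insert y (set r)"
    using arg_cong[OF assms(2), of set] by simp
  ultimately show ?thesis using assms(2) unfolding nxt_def by (intro exI[of _ r]) auto
qed

lemma hd_flat: "segs X ss \<Longrightarrow> ss \<noteq> [] \<Longrightarrow> \<exists>y r. flat ss = y # r \<and> y \<in> X"
  by (cases ss) auto

lemma nxt_exists:
  assumes "longest C" "C = flat ss" "segs X ss" "X \<subseteq> set C" "2 \<le> card X" "t \<in> set ss"
  shows "\<exists>y\<in>X. y \<noteq> fst t \<and> nxt C (fst t) (snd t) y"
proof -
  obtain s1 s2 where s: "ss = s1 @ t # s2" using assms(6) by (meson split_list)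
  have d: "distinct (flat ss)" using assms by (auto simp: longest_def cyc_def)
  then have "2 \<le> card (set ss)" using card_segs[OF d assms(3)] assms by simp
  then have "2 \<le> length ss" using card_length le_trans by blast
  then have "s2 @ s1 \<noteq> []" using s by auto
  then obtain y r where y: "flat (s2 @ s1) = y # r" "y \<in> X"
    using hd_flat[of X "s2 @ s1"] assms(3) s by auto
  have "nxt C (fst t) (snd t) y"
    using nxt_flat[of s1 "fst t" "snd t" s2 y r] assms s y by simp
  moreover from this have "y \<noteq> fst t" by (auto simp: nxt_def longest_def cyc_def)
  ultimately show ?thesis using y by blast
qed

text \<open>On the way round the cycle the property \<open>Q\<close> is lost between some
  consecutive vertices of \<open>X\<close>.\<close>

lemma nxt_exit:
  assumes "longest C" "C = flat ss" "segs X ss" "X \<subseteq> set C" "x \<in> X" "Q x" "y \<in> X" "\<not> Q y"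
  shows "\<exists>t\<in>set ss. Q (fst t) \<and> (\<exists>z\<in>X. \<not> Q z \<and> nxt C (fst t) (snd t) z)"
proof -
  have f: "fst ` set ss = X" using fst_segs assms by metis
  then obtain t0 where "t0 \<in> set ss" "fst t0 = y" using assms(7) by blast
  then obtain s1 s2 where s: "ss = s1 @ t0 # s2" by (meson split_list)
  \<comment> \<open>The list starts at a vertex without \<open>Q\<close> and is cut after its last
    segment with \<open>Q\<close>. If nothing follows that segment, its successor is
    \<open>t0\<close> again.\<close>
  let ?ss = "t0 # s2 @ s1"
  have "\<exists>t\<in>set ?ss. Q (fst t)" using f assms(5,6) s by auto
  then obtain u1 t u2 where u: "?ss = u1 @ t # u2" "Q (fst t)" "\<forall>r\<in>set u2. \<not> Q (fst r)"
    using split_list_last_prop[of ?ss "\<lambda>t. Q (fst t)"] by blast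
  have u1: "u1 \<noteq> []" using u \<open>fst t0 = y\<close> assms(8) by (cases u1) auto
  then have "hd u1 = t0" using u by (cases u1) auto
  have lon: "longest (flat ?ss)"
    using assms(1,2) longest_rotate[of "flat s1" "flat (t0 # s2)"] s by (cases t0) auto
  have sg: "segs X ?ss" using assms(3) s by simp
  have st: "set (flat ?ss) = set C" using assms(2) s by (auto simp: set_flat)
  have ne: "u2 @ u1 \<noteq> []" using u1 by simp
  have hdn: "\<not> Q (fst (hd (u2 @ u1)))"
  proof (cases "u2 = []")
    case True
    then show ?thesis using \<open>hd u1 = t0\<close> \<open>fst t0 = y\<close> assms(8) by simp
  next
    case False
    then show ?thesis using u(3) hd_in_set[OF False] False by (simp add: hd_append)
  qed
  obtain z q w where w: "u2 @ u1 = (z, q) # w" using ne by (cases "u2 @ u1") auto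
  have "segs X (u2 @ u1)" using sg[unfolded u(1)] by simp
  then have "z \<in> X" unfolding w by simp
  moreover have "\<not> Q z" using hdn w by simp
  moreover have "nxt (flat (u1 @ (fst t, snd t) # u2)) (fst t) (snd t) z"
    by (rule nxt_flat[of _ _ _ _ _ "q @ flat w"]) (use lon u(1) w in simp_all)
  then have "nxt C (fst t) (snd t) z" using st u(1) by (simp add: nxt_def)
  moreover have "t \<in> set ?ss" by (simp only: u(1)) simp
  then have "t \<in> set ss" using s by auto
  ultimately show ?thesis using u(2) by blast
qed

lemma rotate_to:
  assumes "longest C" "x \<in> set C"
  obtains r where "longest (x # r)" "set (x # r) = set C" "length (x # r) = length C"
proof -
  obtain c1 c2 where C: "C = c1 @ x # c2" using assms(2) by (meson split_list)
  then have "longest (x # c2 @ c1)" using assms(1) longest_rotate[of c1 "x # c2"] by simp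
  then show thesis by (rule that) (auto simp: C)
qed

text \<open>Cut \<open>C\<close> at \<open>A \<union> B\<close>. No segment is empty, since an end
  of \<open>P\<close> or all of \<open>P\<close> could be inserted, and a segment between neighbours
  of different ends has at least \<open>length P\<close> vertices. Such long segments start at every
  vertex of \<open>A \<inter> B\<close>, and at some vertex of \<open>A - B\<close> and of
  \<open>B - A\<close> if these are not empty.\<close>

lemma two_ends_count:
  assumes lon: "longest C" and P: "opath C P" "2 \<le> length P"
    and AB: "A = {w \<in> set C. adj (hd P) w}" "B = {w \<in> set C. adj (last P) w}" "A \<noteq> {}" "B \<noteq> {}"
    and c2: "2 \<le> card (A \<union> B)"
  shows "2 * card (A \<union> B) + (length P - 1) *
    (card (A \<inter> B) + (if A - B = {} then 0 else 1) + (if B - A = {} then 0 else 1)) \<le> length C"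
proof -
  let ?X = "A \<union> B" and ?k = "length P"
  obtain x where x: "x \<in> A" using AB by blast
  then obtain r where r: "longest (x # r)" "set (x # r) = set C" "length (x # r) = length C"
    using rotate_to[OF lon] AB by blast
  obtain ss where ss: "flat ss = x # r" "segs ?X ss" using segs_exist[of "x # r" ?X] x by auto
  let ?C = "x # r"
  have XC: "?X \<subseteq> set ?C" unfolding r(2) using AB by auto
  have d: "distinct (flat ss)" using r(1) ss by (auto simp: longest_def cyc_def)
  have f: "fst ` set ss = ?X" using fst_segs[OF ss(2)] XC ss(1) by simp
  have "hd P \<notin> set C" "last P \<notin> set C" "hd P \<in> V" "last P \<in> V"
    using P(1) unfolding opath_def by (meson disjoint_iff hd_in_set last_in_set subsetD)+
  then have PC: "opath ?C P" "opath ?C [hd P]" "opath ?C [last P]"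
    unfolding opath_def r(2) using P(1) by (auto simp: opath_def chain_Cons)
  have mixed: "?k \<le> length s" if "nxt ?C a s b" "a \<in> A \<and> b \<in> B \<or> a \<in> B \<and> b \<in> A" for a b s
    using gap_nxt[OF that(1) PC(1)] that(2) AB adj_sym by (auto simp: joins_def)
  have pure: "1 \<le> length s" if "nxt ?C a s b" "a \<in> ?X" "b \<in> ?X" for a b s
  proof (cases "a \<in> A \<and> b \<in> B \<or> a \<in> B \<and> b \<in> A")
    case True
    then show ?thesis using mixed[OF that(1)] P(2) by linarith
  next
    case False
    then have "a \<in> A \<and> b \<in> A \<or> a \<in> B \<and> b \<in> B" using that by auto
    then show ?thesis
      using gap_nxt[OF that(1) PC(2)] gap_nxt[OF that(1) PC(3)] AB adj_sym
      by (auto simp: joins_def)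
  qed
  define M where "M = {t \<in> set ss. ?k \<le> length (snd t)}"
  have t1: "1 \<le> length (snd t)" if "t \<in> set ss" for t
    using nxt_exists[OF r(1) ss(1)[symmetric] ss(2) XC c2 that] pure f that by blast
  have AB_M: "A \<inter> B \<subseteq> fst ` M"
  proof
    fix a assume a: "a \<in> A \<inter> B"
    then have "a \<in> fst ` set ss" using f by simp
    then obtain t where t: "t \<in> set ss" "fst t = a" by blast
    then obtain y where "y \<in> ?X" "nxt ?C (fst t) (snd t) y"
      using nxt_exists[OF r(1) ss(1)[symmetric] ss(2) XC c2 t(1)] by blast
    then have "?k \<le> length (snd t)" using mixed a t by blast
    then show "a \<in> fst ` M" using t by (force simp: M_def)
  qed
  \<comment> \<open>A segment that leaves \<open>A' - B'\<close> ends in \<open>B'\<close>, hence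
    joins neighbours of different ends of \<open>P\<close>.\<close>
  have ex: "\<exists>a \<in> A' - B'. a \<in> fst ` M" if "A' - B' \<noteq> {}" "B' \<noteq> {}" "A' = A \<and> B' = B \<or> A' = B \<and> B' = A" for A' B'
  proof -
    from that obtain p q where pq: "p \<in> A' - B'" "q \<in> B'" by blast
    have "\<exists>t\<in>set ss. fst t \<in> A' - B' \<and> (\<exists>z\<in>?X. z \<notin> A' - B' \<and> nxt ?C (fst t) (snd t) z)"
      by (rule nxt_exit[OF r(1) ss(1)[symmetric] ss(2) XC, of p "\<lambda>v. v \<in> A' - B'" q]) (use pq that in auto)
    then obtain t z where t: "t \<in> set ss" "fst t \<in> A' - B'" "z \<in> ?X" "z \<notin> A' - B'" "nxt ?C (fst t) (snd t) z"
      by blast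
    then have "?k \<le> length (snd t)" using mixed that(3) by blast
    then show ?thesis using t by (force simp: M_def)
  qed
  have fin: "finite ?X" "finite M" using AB by (auto simp: M_def)
  have pick: "\<exists>Y \<subseteq> D. Y \<subseteq> F \<and> card Y = (if D = {} then 0 else 1)"
    if D: "D = {} \<or> (\<exists>a\<in>D. a \<in> F)" for D F :: "'a set"
  proof (cases "D = {}")
    case True
    then show ?thesis by simp
  next
    case False
    then obtain a where "a \<in> D" "a \<in> F" using D by blast
    then have "{a} \<subseteq> D \<and> {a} \<subseteq> F \<and> card {a} = 1" by simp
    then show ?thesis unfolding if_not_P[OF False] by blast
  qed
  obtain Y1 where Y1: "Y1 \<subseteq> A - B" "Y1 \<subseteq> fst ` M" "card Y1 = (if A - B = {} then 0 else 1)"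
    using pick[of "A - B" "fst ` M"] ex[of A B] AB(4) by meson
  obtain Y2 where Y2: "Y2 \<subseteq> B - A" "Y2 \<subseteq> fst ` M" "card Y2 = (if B - A = {} then 0 else 1)"
    using pick[of "B - A" "fst ` M"] ex[of B A] AB(3) by meson
  let ?m = "card (A \<inter> B) + (if A - B = {} then 0 else 1) + (if B - A = {} then 0 else 1)"
  have finY: "finite (A \<inter> B)" "finite Y1" "finite Y2"
    using fin(1) Y1(1) Y2(1) by (auto intro: finite_subset)
  have c1: "card (A \<inter> B \<union> Y1) = card (A \<inter> B) + card Y1"
    by (rule card_Un_disjoint) (use finY Y1(1) in auto)
  have c3: "card (A \<inter> B \<union> Y1 \<union> Y2) = card (A \<inter> B \<union> Y1) + card Y2"
    by (rule card_Un_disjoint) (use finY Y1(1) Y2(1) in auto)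
  have "card (A \<inter> B \<union> Y1 \<union> Y2) \<le> card (fst ` M)"
    by (rule card_mono) (use fin AB_M Y1 Y2 in auto)
  also have "\<dots> \<le> card M" by (rule card_image_le[OF fin(2)])
  finally have mM: "?m \<le> card M" using c1 c3 Y1(3) Y2(3) by simp
  have "card (set ss) + (?k - 1) * card M = (\<Sum>t\<in>set ss. 1 + (if t \<in> M then ?k - 1 else 0))"
  proof -
    have "(\<Sum>t\<in>set ss. if t \<in> M then ?k - 1 else 0) = (\<Sum>t\<in>M. ?k - 1)"
      by (rule sum.mono_neutral_cong_right) (auto simp: M_def)
    then show ?thesis unfolding sum.distrib by (simp add: mult.commute)
  qed
  also have "\<dots> \<le> (\<Sum>t\<in>set ss. length (snd t))"
    by (rule sum_mono) (use t1 P(2) in \<open>auto simp: M_def Suc_le_eq\<close>)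
  finally have "card (set ss) + (?k - 1) * card M \<le> (\<Sum>t\<in>set ss. length (snd t))" .
  moreover have "(?k - 1) * ?m \<le> (?k - 1) * card M" using mM by simp
  moreover have "card (set ss) = card ?X" using card_segs[OF d ss(2)] XC ss(1) by simp
  moreover have "length (flat ss) = length C" using ss(1) r(3) by simp
  ultimately show ?thesis using length_flat[OF d] by linarith
qed

section \<open>Links between segments and toughness\<close>

definition link :: "'a list \<Rightarrow> 'a list \<Rightarrow> 'a \<Rightarrow> 'a list \<Rightarrow> 'a \<Rightarrow> bool" where
  "link C P u L v \<longleftrightarrow> chain (u # L @ [v]) \<and> distinct L \<and> set L \<subseteq> V \<and> set L \<inter> (set C \<union> set P) = {}"

lemma link_rev: "link C P u L v \<Longrightarrow> link C P v (rev L) u"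
proof -
  assume "link C P u L v"
  moreover have "chain (v # rev L @ [u]) \<longleftrightarrow> chain (u # L @ [v])"
    using chain_rev[of "u # L @ [v]"] by simp
  ultimately show ?thesis by (auto simp: link_def)
qed

lemma link_cong: "set C = set C' \<Longrightarrow> link C P u L v \<longleftrightarrow> link C' P u L v"
  by (simp add: link_def)

lemma link_Nil: "link C P u [] v \<longleftrightarrow> adj u v"
  by (simp add: link_def chain_Cons)

text \<open>\<open>X\<close> contains all neighbours of \<open>P\<close> outside \<open>P\<close>,
  and \<open>P\<close> can be inserted between any two vertices of \<open>X\<close>. The latter is
  weaker than adjacency of both ends to all of \<open>X\<close>: for a single edge it is available
  before the two ends are known to have the same neighbours.\<close>

definition config :: "'a list \<Rightarrow> 'a list \<Rightarrow> 'a set \<Rightarrow> bool" where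
  "config C P X \<longleftrightarrow> longest C \<and> opath C P \<and> X \<subseteq> set C \<and> 2 \<le> card X \<and>
     (\<forall>x\<in>set P. \<forall>w. adj x w \<longrightarrow> w \<in> set P \<union> X) \<and> (\<forall>p\<in>X. \<forall>q\<in>X. p \<noteq> q \<longrightarrow> joins P p q)"

lemma configD:
  assumes "config C P X"
  shows "longest C" "opath C P" "X \<subseteq> set C" "2 \<le> card X" "distinct C" "set C \<subseteq> V" "finite X"
    "\<And>x w. x \<in> set P \<Longrightarrow> adj x w \<Longrightarrow> w \<in> set P \<union> X"
    "\<And>p q. p \<in> X \<Longrightarrow> q \<in> X \<Longrightarrow> p \<noteq> q \<Longrightarrow> joins P p q"
  using assms finite_subset[of X "set C"] by (auto simp: config_def longest_def cyc_def)

lemma config_cong: "config C P X \<Longrightarrow> longest C' \<Longrightarrow> set C' = set C \<Longrightarrow> config C' P X"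
  by (auto simp: config_def opath_def)

text \<open>\<open>a\<close> and \<open>b\<close> are two of the segments into which \<open>X\<close> divides the cycle \<open>R1 @ b @ R2 @ a\<close>.\<close>

definition pair :: "'a list \<Rightarrow> 'a set \<Rightarrow> 'a list \<Rightarrow> 'a list \<Rightarrow> 'a list \<Rightarrow> 'a list \<Rightarrow> bool" where
  "pair P X R1 b R2 a \<longleftrightarrow> config (R1 @ b @ R2 @ a) P X \<and> R1 \<noteq> [] \<and> R2 \<noteq> [] \<and>
     hd R1 \<in> X \<and> last R1 \<in> X \<and> hd R2 \<in> X \<and> last R2 \<in> X \<and> set a \<inter> X = {} \<and> set b \<inter> X = {}"

section \<open>Rerouting the cycle at a pair of segments\<close>

lemma pair_swap: "pair P X R1 b R2 a \<Longrightarrow> pair P X R2 a R1 b"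
  unfolding pair_def
  by (auto intro: config_cong simp: longest_rotate[of "R2 @ a" "R1 @ b", simplified] configD(1))

lemma pair_mirror: "pair P X R1 b R2 a \<Longrightarrow> pair P X (rev R2) (rev b) (rev R1) (rev a)"
  unfolding pair_def
  by (auto intro: config_cong simp: longest_mirror[of R1 b R2 a, symmetric] configD(1) hd_rev last_rev)

lemma pair_ends:
  assumes "pair P X R1 b R2 a"
  shows "distinct (R1 @ b @ R2 @ a)" "hd R1 \<noteq> hd R2" "last R1 \<noteq> last R2" "last R1 \<noteq> hd R2" "last R2 \<noteq> hd R1"
proof -
  show d: "distinct (R1 @ b @ R2 @ a)" using assms configD(5) unfolding pair_def by blast
  have "R1 \<noteq> []" "R2 \<noteq> []" using assms by (auto simp: pair_def)
  then have "hd R1 \<in> set R1" "last R1 \<in> set R1" "hd R2 \<in> set R2" "last R2 \<in> set R2" by auto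
  then show "hd R1 \<noteq> hd R2" "last R1 \<noteq> last R2" "last R1 \<noteq> hd R2" "last R2 \<noteq> hd R1"
    using d by (auto simp: disjoint_iff)
qed

lemma pair_chains:
  assumes "pair P X R1 b R2 a"
  shows "chain R1" "chain R2" "chain a" "chain b" "a \<noteq> [] \<Longrightarrow> adj (last R2) (hd a)" "a \<noteq> [] \<Longrightarrow> adj (last a) (hd R1)"
    "b \<noteq> [] \<Longrightarrow> adj (last R1) (hd b)" "b \<noteq> [] \<Longrightarrow> adj (last b) (hd R2)"
    "set (R1 @ b @ R2 @ a) \<subseteq> V - set P" "P \<noteq> []" "R1 \<noteq> []" "R2 \<noteq> []"
proof -
  have c: "config (R1 @ b @ R2 @ a) P X" and ne: "R1 \<noteq> []" "R2 \<noteq> []" using assms by (auto simp: pair_def)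
  then have "cyc (R1 @ b @ R2 @ a)" using configD(1) longestD(1) by blast
  then show "chain R1" "chain R2" "chain a" "chain b" "a \<noteq> [] \<Longrightarrow> adj (last R2) (hd a)" "a \<noteq> [] \<Longrightarrow> adj (last a) (hd R1)"
    "b \<noteq> [] \<Longrightarrow> adj (last R1) (hd b)" "b \<noteq> [] \<Longrightarrow> adj (last b) (hd R2)"
    using ne by (auto simp: cyc_def chain_append)
  show "set (R1 @ b @ R2 @ a) \<subseteq> V - set P" "P \<noteq> []" using configD(2,6)[OF c] by (auto simp: opath_def)
qed (use assms in \<open>auto simp: pair_def\<close>)

text \<open>\<open>P\<close> takes the place of \<open>b\<close>, and \<open>W\<close>, which may
  use the vertices of both segments, takes the place of \<open>a\<close>.\<close>

lemma pair_reroute: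
  assumes p: "pair P X R1 b R2 a" and W: "W \<noteq> []" "chain W" "distinct W" "set W \<subseteq> V - set R1 - set R2 - set P"
    and adj: "adj (last R2) (hd W)" "adj (last W) (hd R1)"
  shows "\<exists>Q. set Q = set P \<and> length Q = length P \<and> cyc (R1 @ Q @ R2 @ W)"
proof (rule cyc_concat[of "R1 @ b @ R2 @ a"])
  have c: "config (R1 @ b @ R2 @ a) P X" using p by (simp add: pair_def)
  show "opath (R1 @ b @ R2 @ a) P" by (rule configD(2)[OF c])
  show "joins P (last R1) (hd R2)" using p configD(9)[OF c] pair_ends[OF p] by (auto simp: pair_def)
  show "distinct (R1 @ R2 @ W)" "set (R1 @ R2 @ W) \<subseteq> V - set P"
    using pair_ends(1)[OF p] pair_chains(9)[OF p] W(3,4) by auto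
qed (use pair_chains[OF p] W adj in auto)

text \<open>\<open>P\<close> joins the rear ends of \<open>R2\<close> and \<open>R1\<close>, so
  \<open>R1\<close> is traversed backwards and \<open>W\<close> joins the front ends.\<close>

lemma pair_reroute_cross:
  assumes p: "pair P X R1 b R2 a" and W: "W \<noteq> []" "chain W" "distinct W" "set W \<subseteq> V - set R1 - set R2 - set P"
    and adj: "adj (hd R1) (hd W)" "adj (last W) (hd R2)"
  shows "\<exists>Q. set Q = set P \<and> length Q = length P \<and> cyc (R2 @ Q @ rev R1 @ W)"
proof (rule cyc_concat[of "R1 @ b @ R2 @ a"])
  have c: "config (R1 @ b @ R2 @ a) P X" using p by (simp add: pair_def)
  show "opath (R1 @ b @ R2 @ a) P" by (rule configD(2)[OF c])
  show "joins P (last R2) (hd (rev R1))"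
    using p configD(9)[OF c] pair_ends[OF p] by (auto simp: pair_def hd_rev)
  show "distinct (R2 @ rev R1 @ W)" "set (R2 @ rev R1 @ W) \<subseteq> V - set P"
    using pair_ends(1)[OF p] pair_chains(9)[OF p] W(3,4) by auto
  show "adj (last (rev R1)) (hd W)" using adj(1) pair_chains(11)[OF p] by (simp add: last_rev)
qed (use pair_chains[OF p] W adj in auto)

text \<open>The way back runs from the end of \<open>a\<close> backwards to \<open>u\<close>, along
  the link to \<open>v\<close> and on to the end of \<open>b\<close>. The cycle loses
  \<open>a1\<close> and \<open>b1\<close> and gains \<open>P\<close> and \<open>L\<close>.\<close>

lemma pair_link_half:
  assumes p: "pair P X R1 (b1 @ v # b2) R2 (a1 @ u # a2)"
    and L: "link (R1 @ (b1 @ v # b2) @ R2 @ (a1 @ u # a2)) P u L v"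
  shows "length P + length L \<le> length a1 + length b1"
proof -
  let ?C = "R1 @ (b1 @ v # b2) @ R2 @ (a1 @ u # a2)" and ?W = "rev (u # a2) @ L @ v # b2"
  note ch = pair_chains[OF p]
  have LL: "chain (u # L @ [v])" "distinct L" "set L \<subseteq> V" "set L \<inter> (set ?C \<union> set P) = {}"
    using L by (auto simp: link_def)
  have ab: "chain (u # a2)" "chain (v # b2)" "adj (last (u # a2)) (hd R1)" "adj (last (v # b2)) (hd R2)"
    using ch(3,4,6,8) by (auto simp: chain_append)
  have hdL: "hd (L @ [v]) = hd (L @ v # b2)" by (cases L) simp_all
  have "chain (L @ v # b2)" "adj u (hd (L @ v # b2))"
    using LL(1) ab(2) unfolding hdL[symmetric] by (auto simp: chain_Cons chain_append)
  then have W: "chain ?W" unfolding chain_append[of "rev (u # a2)"] chain_rev using ab(1) by simp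
  have hdW: "hd ?W = last (u # a2)" by (cases a2 rule: rev_cases) simp_all
  have "\<exists>Q. set Q = set P \<and> length Q = length P \<and> cyc (R2 @ Q @ rev R1 @ ?W)"
  proof (rule pair_reroute_cross[OF p _ W])
    show "distinct ?W" using pair_ends(1)[OF p] LL(2,4) by auto
    show "set ?W \<subseteq> V - set R1 - set R2 - set P" using pair_ends(1)[OF p] ch(9) LL(3,4) by auto
    show "adj (hd R1) (hd ?W)" unfolding hdW by (rule adj_sym[OF ab(3)])
    show "adj (last ?W) (hd R2)" using ab(4) by simp
  qed simp
  then obtain Q where Q: "length Q = length P" "cyc (R2 @ Q @ rev R1 @ ?W)" by blast
  have "longest ?C" using p configD(1) unfolding pair_def by blast
  from longestD(2)[OF this Q(2)] show ?thesis using Q(1) by simp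
qed

lemma pair_link:
  assumes p: "pair P X R1 (b1 @ v # b2) R2 (a1 @ u # a2)"
    and L: "link (R1 @ (b1 @ v # b2) @ R2 @ (a1 @ u # a2)) P u L v"
  shows "length P + length L \<le> length a1 + length b1" "length P + length L \<le> length a2 + length b2"
proof -
  show "length P + length L \<le> length a1 + length b1" by (rule pair_link_half[OF p L])
  have "pair P X (rev R2) (rev b2 @ v # rev b1) (rev R1) (rev a2 @ u # rev a1)"
    using pair_mirror[OF p] by simp
  moreover have "link (rev R2 @ (rev b2 @ v # rev b1) @ rev R1 @ (rev a2 @ u # rev a1)) P u L v"
    using L by (rule link_cong[THEN iffD1, rotated]) auto
  ultimately show "length P + length L \<le> length a2 + length b2" using pair_link_half by fastforce
qed

lemma pair_gap:
  assumes p: "pair P X R1 b R2 a" shows "length P \<le> length b"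
proof -
  let ?C = "R1 @ b @ R2 @ a"
  have c: "config ?C P X" using p by (simp add: pair_def)
  obtain r1 x where R1: "R1 = r1 @ [x]" using p unfolding pair_def by (metis append_butlast_last_id)
  obtain y r2 where R2: "R2 = y # r2" using p unfolding pair_def by (metis list.exhaust)
  have "longest (x # b @ y # (r2 @ a @ r1))"
    using configD(1)[OF c] longest_rotate[of r1 "x # b @ R2 @ a"] by (simp add: R1 R2)
  then have "nxt ?C x b y" unfolding nxt_def by (intro exI[of _ "r2 @ a @ r1"]) (auto simp: R1 R2)
  moreover have "joins P x y"
    using p configD(9)[OF c] pair_ends[OF p] by (auto simp: pair_def R1 R2)
  ultimately show ?thesis using gap_nxt configD(2)[OF c] by blast
qed

text \<open>The way back from a pair to a full list of segments, as needed for counting, with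
  \<open>a\<close> and \<open>b\<close> visible in it.\<close>

lemma pair_segs:
  assumes p: "pair P X R1 b R2 a"
  shows "\<exists>s2 s3. R1 = flat s2 @ [last R1] \<and> R2 = flat s3 @ [last R2] \<and>
    segs X ((last R2, a) # s2 @ (last R1, b) # s3) \<and>
    config (flat ((last R2, a) # s2 @ (last R1, b) # s3)) P X"
proof -
  have R: "R1 = butlast R1 @ [last R1]" "R2 = butlast R2 @ [last R2]" using p by (auto simp: pair_def)
  have hd: "butlast R = [] \<or> hd (butlast R) \<in> X" if "hd R \<in> X" for R :: "'a list"
    using that by (cases R) auto
  obtain s2 where s2: "flat s2 = butlast R1" "segs X s2"
    using segs_exist[of "butlast R1" X] hd[of R1] p by (auto simp: pair_def)
  obtain s3 where s3: "flat s3 = butlast R2" "segs X s3"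
    using segs_exist[of "butlast R2" X] hd[of R2] p by (auto simp: pair_def)
  let ?ss = "(last R2, a) # s2 @ (last R1, b) # s3"
  have c: "config (R1 @ b @ R2 @ a) P X" using p by (simp add: pair_def)
  have fl: "flat ?ss = [last R2] @ a @ R1 @ b @ butlast R2" by (subst (2) R(1)) (simp add: s2 s3)
  have "longest ((R1 @ b @ butlast R2) @ ([last R2] @ a))"
    using configD(1)[OF c] by (subst (asm) R(2)) simp
  then have "longest (flat ?ss)" unfolding fl using longest_rotate[of "R1 @ b @ butlast R2" "[last R2] @ a"] by simp
  moreover have "set R2 = insert (last R2) (set (butlast R2))" by (subst R(2)) simp
  then have "set (flat ?ss) = set (R1 @ b @ R2 @ a)" unfolding fl by auto
  ultimately have "config (flat ?ss) P X" using config_cong[OF c] by blast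
  moreover have "segs X ?ss" using s2 s3 p by (auto simp: pair_def)
  ultimately show ?thesis using R s2 s3 by metis
qed

lemma segs_pair:
  assumes c: "config (flat ss) P X" and sg: "segs X ss" and t: "t \<in> set ss" "t' \<in> set ss" "t \<noteq> t'"
  shows "\<exists>R1 R2. pair P X R1 (snd t') R2 (snd t) \<and> last R2 = fst t \<and> last R1 = fst t' \<and>
    set (R1 @ snd t' @ R2 @ snd t) = set (flat ss)"
proof -
  obtain s1 s' where s: "ss = s1 @ t # s'" using t(1) by (meson split_list)
  then have "t' \<in> set (s' @ s1)" using t by auto
  then obtain s2 s3 where s23: "s' @ s1 = s2 @ t' # s3" by (meson split_list)
  obtain x a where ta: "t = (x, a)" by (cases t)
  obtain y b where tb: "t' = (y, b)" by (cases t')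
  let ?R1 = "flat s2 @ [y]" and ?R2 = "flat s3 @ [x]"
  have sgs: "segs X s2" "segs X s3" "x \<in> X" "y \<in> X" "set a \<inter> X = {}" "set b \<inter> X = {}"
  proof -
    have "segs X (s' @ s1)" using sg s by simp
    then show "segs X s2" "segs X s3" "x \<in> X" "y \<in> X" "set a \<inter> X = {}" "set b \<inter> X = {}"
      using sg s unfolding s23 by (auto simp: ta tb)
  qed
  have f: "flat s' @ flat s1 = flat s2 @ y # b @ flat s3"
    using arg_cong[OF s23, of flat] by (simp add: tb)
  have "longest (x # a @ flat s' @ flat s1)"
    using configD(1)[OF c] longest_rotate[of "flat s1" "x # a @ flat s'"] by (simp add: s ta)
  then have "longest ((x # a) @ flat s2 @ y # b @ flat s3)" using f by simp
  then have l: "longest (?R1 @ b @ ?R2 @ a)"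
    using longest_rotate[of "x # a" "flat s2 @ y # b @ flat s3"]
    by simp
  have "set (flat ss) = insert x (set a) \<union> set (flat s' @ flat s1)" by (auto simp: s ta)
  then have st: "set (?R1 @ b @ ?R2 @ a) = set (flat ss)" unfolding f by auto
  have hdX: "hd (flat s @ [z]) \<in> X" if "segs X s" "z \<in> X" for s z
    using hd_flat[OF that(1)] that(2) by (cases "s = []") auto
  have "pair P X ?R1 b ?R2 a"
    unfolding pair_def using config_cong[OF c l st] sgs hdX by auto
  then show ?thesis using st by (intro exI[of _ ?R1] exI[of _ ?R2]) (simp add: ta tb)
qed

lemma segs_length:
  assumes c: "config (flat ss) P X" and sg: "segs X ss" and t: "t \<in> set ss"
  shows "length P \<le> length (snd t)"
proof -
  have "\<exists>y\<in>X. y \<noteq> fst t \<and> nxt (flat ss) (fst t) (snd t) y"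
    by (rule nxt_exists[OF _ refl sg _ _ t]) (use configD[OF c] in auto)
  then obtain y where "y \<in> X" "y \<noteq> fst t" "nxt (flat ss) (fst t) (snd t) y" by blast
  moreover have "fst t \<in> X" using sg t by (auto simp: segs_def)
  ultimately show ?thesis using gap_nxt configD(2,9)[OF c] by metis
qed

text \<open>The bookkeeping of spare vertices: besides \<open>P\<close>, \<open>X\<close> and
  \<open>length P\<close> inner vertices per segment there are the surplus of the segments and the
  vertices off \<open>C\<close> and \<open>P\<close>. \<open>T\<close> selects the segments whose
  surplus matters.\<close>

lemma excess:
  assumes c: "config (flat ss) P X" and sg: "segs X ss" and T: "T \<subseteq> set ss"
  shows "length P + card X * (length P + 1) + (\<Sum>t\<in>T. length (snd t) - length P) +
    card (V - set (flat ss) - set P) \<le> card V"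
proof -
  let ?k = "length P"
  have d: "distinct (flat ss)" "set (flat ss) \<subseteq> V" "X \<subseteq> set (flat ss)" using configD[OF c] by auto
  have P: "distinct P" "set P \<subseteq> V" "set P \<inter> set (flat ss) = {}"
    using configD(2)[OF c] by (auto simp: opath_def)
  have "(\<Sum>t\<in>set ss. length (snd t)) = (\<Sum>t\<in>set ss. ?k + (length (snd t) - ?k))"
    by (rule sum.cong) (use segs_length[OF c sg] in auto)
  also have "\<dots> = card (set ss) * ?k + (\<Sum>t\<in>set ss. length (snd t) - ?k)" by (simp add: sum.distrib)
  finally have len: "length (flat ss) = card X * (?k + 1) + (\<Sum>t\<in>set ss. length (snd t) - ?k)"
    using length_flat[OF d(1)] card_segs[OF d(1) sg d(3)] by simp
  have "(\<Sum>t\<in>T. length (snd t) - ?k) \<le> (\<Sum>t\<in>set ss. length (snd t) - ?k)"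
    by (rule sum_mono2) (use T in auto)
  moreover have "card V = card (set (flat ss)) + card (set P) + card (V - set (flat ss) - set P)"
  proof -
    have "card V = card (set (flat ss)) + card (V - set (flat ss))"
      using d(2) finV by (metis card_Diff_subset card_mono finite_set le_add_diff_inverse)
    moreover have "card (V - set (flat ss)) = card (set P) + card (V - set (flat ss) - set P)"
      using P finV by (intro card_Un_disjoint[of "set P" "V - set (flat ss) - set P", THEN trans[rotated]] arg_cong[of _ _ card]) auto
    ultimately show ?thesis by simp
  qed
  ultimately show ?thesis using len d(1) P(1) by (simp add: distinct_card)
qed

lemma card_link_le:
  assumes "link C P u L v" shows "length L \<le> card (V - set C - set P)"
  using assms finV card_mono[of "V - set C - set P" "set L"] distinct_card[of L]
  by (auto simp: link_def)

text \<open>The first bound adds \<open>u\<close> and \<open>v\<close> to the two inequalities of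
  \<open>pair_link\<close>. In the second the inner vertices of the link count once more, as
  vertices off the cycle.\<close>

lemma link_excess:
  assumes c: "config (flat ss) P X" and sg: "segs X ss"
    and t: "t \<in> set ss" "t' \<in> set ss" "t \<noteq> t'" "u \<in> set (snd t)" "v \<in> set (snd t')"
    and L: "link (flat ss) P u L v"
  shows "2 * length P + 2 * length L + 2 \<le> length (snd t) + length (snd t')"
    "length P + card X * (length P + 1) + 3 * length L + 2 \<le> card V"
proof -
  obtain R1 R2 where R: "pair P X R1 (snd t') R2 (snd t)" "set (R1 @ snd t' @ R2 @ snd t) = set (flat ss)"
    using segs_pair[OF c sg t(1-3)] by blast
  obtain a1 a2 where a: "snd t = a1 @ u # a2" using t(4) by (meson split_list)
  obtain b1 b2 where b: "snd t' = b1 @ v # b2" using t(5) by (meson split_list)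
  have "link (R1 @ (b1 @ v # b2) @ R2 @ (a1 @ u # a2)) P u L v"
    using L link_cong[OF R(2)] by (simp add: a b)
  then show *: "2 * length P + 2 * length L + 2 \<le> length (snd t) + length (snd t')"
    using pair_link[of P X R1 b1 v b2 R2 a1 u a2 L] R(1) by (simp add: a b)
  have "length P + card X * (length P + 1) + (\<Sum>r\<in>{t, t'}. length (snd r) - length P) +
      card (V - set (flat ss) - set P) \<le> card V"
    by (rule excess[OF c sg]) (use t in auto)
  then show "length P + card X * (length P + 1) + 3 * length L + 2 \<le> card V"
    using * card_link_le[OF L] segs_length[OF c sg t(1)] segs_length[OF c sg t(2)] t(3) by simp
qed

end

section \<open>Toughness and the existence of links\<close>

context tough_graph begin

text \<open>A labelling that is constant along links extends from the cycle to the whole graph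
  without \<open>S\<close>. The \<open>+ 1\<close> is \<open>P\<close>: its neighbours outside
  \<open>P\<close> lie in \<open>X\<close>, hence in \<open>S\<close>, so it is cut off and gets the
  additional label \<open>None\<close>.\<close>

lemma toughness:
  assumes c: "config C P X" and S: "X \<subseteq> S" "S \<subseteq> set C" "set C - S \<noteq> {}"
    and f: "\<And>u v L. u \<in> set C - S \<Longrightarrow> v \<in> set C - S \<Longrightarrow> link C P u L v \<Longrightarrow> f u = (f v :: 'a)"
  shows "card (f ` (set C - S)) + 1 \<le> card S"
proof -
  let ?U = "set C - S" and ?O = "V - set C - set P"
  have P: "P \<noteq> []" "set P \<subseteq> V" "set P \<inter> set C = {}" using configD(2)[OF c] by (auto simp: opath_def)
  have walk: "f u = f v" if u: "u \<in> ?U" "v \<in> ?U" and M: "chain (u # M @ [v])" "set M \<subseteq> ?O" for u v M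
  proof (cases "M = []")
    case True
    then show ?thesis using f[of u v "[]"] u M by (simp add: link_def)
  next
    case False
    have "successively adj M" using M(1) by (simp add: chain_def successively_Cons successively_append_iff)
    from shorten_walk[OF False this] obtain q where q: "q \<noteq> []" "distinct q" "successively adj q"
      "hd q = hd M" "last q = last M" "set q \<subseteq> set M" by blast
    have "link C P u q v"
      unfolding link_def using q M False by (auto simp: chain_def successively_Cons successively_append_iff)
    then show ?thesis using f u by blast
  qed
  \<comment> \<open>\<open>wl u z\<close>: from \<open>u\<close> on the cycle, \<open>z\<close> can
    be reached through vertices off \<open>C\<close> and \<open>P\<close>.\<close>
  define wl where "wl u z \<longleftrightarrow> u \<in> ?U \<and> (\<exists>L. chain (u # L) \<and> L \<noteq> [] \<and> last L = z \<and> set L \<subseteq> ?O)" for u z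
  have wl_unique: "f u = f u'" if wu: "wl u z" "wl u' z" for u u' z
  proof -
    obtain L where L: "chain (u # L)" "L \<noteq> []" "last L = z" "set L \<subseteq> ?O" using wu(1) by (auto simp: wl_def)
    obtain L' where L': "chain (u' # L')" "L' \<noteq> []" "last L' = z" "set L' \<subseteq> ?O" using wu(2) by (auto simp: wl_def)
    obtain l where l: "L' = l @ [z]" using L' by (metis append_butlast_last_id)
    have "chain (rev (u' # L'))" using L'(1) by (simp only: chain_rev)
    then have ch: "chain (z # rev l @ [u'])" by (simp add: l)
    have "chain (u # L @ rev l @ [u'])"
      using L(1-3) ch by (auto simp: chain_Cons chain_append hd_append)
    then show ?thesis using walk[of u u' "L @ rev l"] wu L(4) L'(4) by (simp add: wl_def l)
  qed
  \<comment> \<open>A vertex off the cycle takes the label of any cycle vertex that reaches it; by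
    \<open>wl_unique\<close> the choice does not matter. Vertices that are not reached share
    \<open>None\<close> with \<open>P\<close>, which can only lower the count.\<close>
  define g where "g z = (if z \<in> set P then None else if z \<in> set C then Some (f z)
    else if \<exists>u. wl u z then Some (f (SOME u. wl u z)) else None)" for z
  have gO: "g z = Some (f u)" if "wl u z" "z \<in> ?O" for u z
  proof -
    have "wl (SOME u. wl u z) z" using that(1) by (rule someI)
    then have "f (SOME u. wl u z) = f u" using wl_unique that(1) by blast
    then show ?thesis using that unfolding g_def by auto
  qed
  have half: "g x = g y" if xy: "x \<in> V - S" "y \<in> V - S" "adj x y"
    "x \<in> set P \<or> x \<in> set C \<and> y \<notin> set P \<or> x \<in> ?O \<and> y \<in> ?O" for x y
    using xy(4)
  proof (elim disjE conjE)
    assume "x \<in> set P"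
    then have "y \<in> set P" using configD(8)[OF c _ xy(3)] xy(2) S(1) by blast
    then show ?thesis using \<open>x \<in> set P\<close> by (simp add: g_def)
  next
    assume x: "x \<in> set C" "y \<notin> set P"
    then have gx: "g x = Some (f x)" using P(3) by (auto simp: g_def)
    show ?thesis
    proof (cases "y \<in> set C")
      case True
      then have "f x = f y" using walk[of x y "[]"] xy x by (auto simp: chain_Cons)
      then show ?thesis using gx True x by (simp add: g_def)
    next
      case False
      then have "wl x y" unfolding wl_def using xy x
        by (auto intro!: exI[of _ "[y]"] simp: chain_Cons)
      then show ?thesis using gO[of x y] gx False xy x by auto
    qed
  next
    assume O: "x \<in> ?O" "y \<in> ?O"
    have step: "wl u y'" if w: "wl u x'" "adj x' y'" "y' \<in> ?O" for u x' y'
    proof -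
      obtain L where "chain (u # L)" "L \<noteq> []" "last L = x'" "set L \<subseteq> ?O" using w(1) by (auto simp: wl_def)
      then show ?thesis using w unfolding wl_def
        by (auto intro!: exI[of _ "L @ [y']"] simp: chain_Cons chain_append)
    qed
    show ?thesis
    proof (cases "\<exists>u. wl u x")
      case True
      then obtain u where u: "wl u x" by blast
      then show ?thesis using gO[OF u] gO[OF step[OF u xy(3)]] O by simp
    next
      case False
      then have "\<nexists>u. wl u y" using step[of _ y x] adj_sym[OF xy(3)] O by blast
      then show ?thesis using False O by (auto simp: g_def)
    qed
  qed
  have g_adj: "g x = g y" if "x \<in> V - S" "y \<in> V - S" "adj x y" for x y
    using half[OF that] half[OF that(2,1) adj_sym[OF that(3)]] that by (metis DiffD1 DiffI)
  have SV: "S \<subseteq> V" using S configD(6)[OF c] by blast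
  have "hd P \<in> V - S" using hd_in_set[OF P(1)] P(2,3) S(2) by blast
  moreover have "g (hd P) = None" using P(1) by (simp add: g_def)
  moreover have "g ` ?U = Some ` f ` ?U"
    using P(3) by (auto simp: g_def image_iff disjoint_iff)
  moreover have "?U \<subseteq> V - S" using configD(6)[OF c] by blast
  ultimately have sub: "insert None (Some ` f ` ?U) \<subseteq> g ` (V - S)" by (metis image_mono image_eqI insert_subset)
  have "card (insert None (Some ` f ` ?U)) = card (f ` ?U) + 1" by (simp add: card_insert_if card_image)
  moreover have "card (insert None (Some ` f ` ?U)) \<le> card (g ` (V - S))"
    by (rule card_mono[OF _ sub]) (simp add: finV)
  moreover have "0 < card (f ` ?U)" using S(3) by (simp add: card_gt_0_iff)
  ultimately have *: "card (f ` ?U) + 1 \<le> card (g ` (V - S))" "1 < card (g ` (V - S))" by linarith+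
  have "card (g ` (V - S)) \<le> card S" by (rule tough[OF SV g_adj *(2)])
  then show ?thesis using * by linarith
qed

text \<open>Otherwise \<open>lab\<close> would be constant along links, and its
  \<open>card X\<close> values together with \<open>P\<close> would give more components than
  \<open>X\<close> has vertices.\<close>

lemma link_exists:
  assumes c: "config (flat ss) P X" and sg: "segs X ss"
  shows "\<exists>t\<in>set ss. \<exists>t'\<in>set ss. \<exists>u\<in>set (snd t). \<exists>v\<in>set (snd t'). \<exists>L. t \<noteq> t' \<and> link (flat ss) P u L v"
proof (rule ccontr)
  assume no: "\<not> ?thesis"
  let ?C = "flat ss"
  have d: "distinct ?C" "X \<subseteq> set ?C" using configD[OF c] by auto
  have P0: "0 < length P" using configD(2)[OF c] by (simp add: opath_def)
  have f: "fst ` set ss = X" using fst_segs[OF sg d(2)] .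
  have img: "lab ss ` (set ?C - X) = X"
  proof
    show "lab ss ` (set ?C - X) \<subseteq> X"
    proof
      fix l assume "l \<in> lab ss ` (set ?C - X)"
      then obtain v t where "l = lab ss v" "t \<in> set ss" "v \<in> insert (fst t) (set (snd t))" "v \<notin> X"
        by (auto simp: set_flat)
      then have "l = fst t" using f lab_eq[OF d(1), of t v] by blast
      then show "l \<in> X" using f \<open>t \<in> set ss\<close> by blast
    qed
    show "X \<subseteq> lab ss ` (set ?C - X)"
    proof
      fix x assume "x \<in> X"
      then obtain t where t: "t \<in> set ss" "fst t = x" using f by blast
      then have "snd t \<noteq> []" using segs_length[OF c sg t(1)] P0 by auto
      then obtain v where v: "v \<in> set (snd t)" by (meson hd_in_set)
      then have "v \<in> set ?C - X" using t sg by (force simp: set_flat segs_def)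
      then show "x \<in> lab ss ` (set ?C - X)" using lab_eq[OF d(1) t(1) v] t(2) by (metis image_eqI)
    qed
  qed
  have "X \<noteq> {}" using configD(4)[OF c] by auto
  then have ne: "set ?C - X \<noteq> {}" using img by (metis image_empty)
  have "card (lab ss ` (set ?C - X)) + 1 \<le> card X"
  proof (rule toughness[OF c order_refl d(2) ne])
    fix u v L assume uv: "u \<in> set ?C - X" "v \<in> set ?C - X" "link ?C P u L v"
    obtain t where t: "t \<in> set ss" "u \<in> set (snd t)" using in_seg[OF sg] uv(1) by blast
    obtain t' where t': "t' \<in> set ss" "v \<in> set (snd t')" using in_seg[OF sg] uv(2) by blast
    have "t = t'" using no t t' uv(3) by blast
    then show "lab ss u = lab ss v" using t t' lab_eq[OF d(1)] by metis
  qed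
  then show False using img by simp
qed

end

section \<open>Longest paths outside a longest cycle\<close>

lemma card_Diff_Int_split: "finite A \<Longrightarrow> card A = card (A - B) + card (A \<inter> B)"
  using card_Un_disjoint[of "A - B" "A \<inter> B"] by (simp add: Un_Diff_Int Diff_Int_distrib2 inf_commute)

context sgraph begin

definition maxpath :: "'a list \<Rightarrow> 'a list \<Rightarrow> bool" where
  "maxpath C P \<longleftrightarrow> longest C \<and> opath C P \<and> (\<forall>Q. opath C Q \<longrightarrow> length Q \<le> length P)"

lemma maxpath_rev: "maxpath C P \<Longrightarrow> maxpath C (rev P)"
  by (auto simp: maxpath_def opath_def)

lemma maxpath_exists:
  assumes "longest C" "opath C P"
  shows "\<exists>Q. maxpath C Q \<and> length P \<le> length Q"
proof -
  have "length Q \<le> card V" if "opath C Q" for Q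
    using that finV card_mono by (metis opath_def distinct_card)
  then have bd: "\<forall>Q. opath C Q \<longrightarrow> length Q < Suc (card V)" by (simp add: less_Suc_eq_le)
  obtain Q where "opath C Q" "\<forall>R. opath C R \<longrightarrow> length R \<le> length Q"
    using ex_has_greatest_nat[OF assms(2) bd] by blast
  then show ?thesis using assms unfolding maxpath_def by blast
qed

lemma maxpath_hd_nbr:
  assumes "maxpath C P" "adj (hd P) w" shows "w \<in> set P \<union> set C"
proof (rule ccontr)
  assume "w \<notin> set P \<union> set C"
  then have "opath C (w # P)"
    using assms adj_V2 adj_sym unfolding maxpath_def opath_def by (auto simp: chain_Cons)
  then have "length (w # P) \<le> length P" using assms(1) unfolding maxpath_def by blast
  then show False by simp
qed

lemma config_segs:
  assumes "config C P X"
  shows "\<exists>ss. config (flat ss) P X \<and> segs X ss \<and> set (flat ss) = set C"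
proof -
  have "X \<noteq> {}" using configD(4)[OF assms] by auto
  then obtain x where x: "x \<in> X" "x \<in> set C" using configD(3)[OF assms] by blast
  obtain r where r: "longest (x # r)" "set (x # r) = set C"
    using rotate_to[OF configD(1)[OF assms] x(2)] by metis
  obtain ss where "flat ss = x # r" "segs X ss" using segs_exist[of "x # r" X] x by auto
  then show ?thesis using config_cong[OF assms r] r by metis
qed

definition cnbrs :: "'a list \<Rightarrow> 'a \<Rightarrow> 'a set" where
  "cnbrs C x = {w \<in> set C. adj x w}"

lemma finite_cnbrs [simp]: "finite (cnbrs C x)"
  by (simp add: cnbrs_def)

end

context tough_graph begin

lemma three_neighbours:
  assumes "v \<in> V" "4 \<le> card V" shows "3 \<le> card {u. adj v u}"
proof (rule ccontr)
  let ?S = "{u. adj v u}"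
  assume "\<not> 3 \<le> card ?S"
  then have S3: "card ?S < 3" by simp
  have SV: "?S \<subseteq> V" using adj_V2 by blast
  have "{v} \<union> ?S = V"
    by (rule conn3[OF SV S3]) (use assms adj_irrefl in auto)
  then have "card V \<le> Suc (card ?S)" by (metis card_insert_le_m1 card_insert_if finite_subset[OF SV finV] insert_is_Un le_refl le_SucI)
  then show False using S3 assms(2) by simp
qed

lemma cycle_path_order:
  assumes "longest C" "opath C P" shows "length C + length P \<le> 3 * \<delta> + 2"
proof -
  have "distinct (C @ P)" "set (C @ P) \<subseteq> V"
    using assms by (auto simp: longest_def cyc_def opath_def)
  then have "length (C @ P) \<le> card V" using card_mono[OF finV] by (metis distinct_card)
  then show ?thesis using order by simp
qed

lemma end_degree:
  assumes m: "maxpath C P"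
  shows "card {u. adj (hd P) u} = card (cnbrs C (hd P)) + card {w \<in> set P. adj (hd P) w}"
    "card {w \<in> set P. adj (hd P) w} + 1 \<le> length P" "\<delta> + 1 \<le> card (cnbrs C (hd P)) + length P"
proof -
  have P: "opath C P" using m by (simp add: maxpath_def)
  have "{u. adj (hd P) u} = cnbrs C (hd P) \<union> {w \<in> set P. adj (hd P) w}"
    using maxpath_hd_nbr[OF m] by (auto simp: cnbrs_def)
  moreover have "cnbrs C (hd P) \<inter> {w \<in> set P. adj (hd P) w} = {}"
    using P by (auto simp: cnbrs_def opath_def)
  ultimately show 1: "card {u. adj (hd P) u} = card (cnbrs C (hd P)) + card {w \<in> set P. adj (hd P) w}"
    using card_Un_disjoint[of "cnbrs C (hd P)" "{w \<in> set P. adj (hd P) w}"] by simp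
  have "{w \<in> set P. adj (hd P) w} \<subseteq> set P - {hd P}" using adj_irrefl by auto
  then have "card {w \<in> set P. adj (hd P) w} \<le> card (set P - {hd P})" by (intro card_mono) auto
  moreover have "card (set P) = length P" "hd P \<in> set P" "P \<noteq> []" using P by (auto simp: opath_def distinct_card)
  moreover have "card (set P - {hd P}) = card (set P) - 1" using \<open>hd P \<in> set P\<close> by simp
  moreover have "0 < length P" using \<open>P \<noteq> []\<close> by simp
  ultimately show 2: "card {w \<in> set P. adj (hd P) w} + 1 \<le> length P" by linarith
  have "hd P \<in> V" using P hd_in_set by (auto simp: opath_def)
  then show "\<delta> + 1 \<le> card (cnbrs C (hd P)) + length P" using deg[of "hd P"] 1 2 by linarith
qed

text \<open>If the end has at most one neighbour on \<open>P\<close>, then \<open>C\<close> has at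
  least 10 vertices, which forces \<delta> >= 4. Otherwise the last neighbour on \<open>P\<close>
  closes a cycle \<open>?Z\<close> with more vertices than the end has neighbours on
  \<open>P\<close>, and \<open>cycle_outside\<close> makes \<open>C\<close> so long that \<delta>
  exceeds that number of neighbours by more than two.\<close>

lemma end_three:
  assumes m: "maxpath C P" and k: "3 \<le> length P"
  shows "3 \<le> card (cnbrs C (hd P))"
proof -
  have lon: "longest C" and P: "opath C P" using m by (auto simp: maxpath_def)
  have ord: "length C + length P \<le> 3 * \<delta> + 2" by (rule cycle_path_order[OF lon P])
  let ?N = "{w \<in> set P. adj (hd P) w}"
  have "P \<noteq> []" "hd P \<in> V" using P hd_in_set by (auto simp: opath_def)
  then have dg: "\<delta> \<le> card (cnbrs C (hd P)) + card ?N" using deg end_degree(1)[OF m] by metis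
  show ?thesis
  proof (cases "2 \<le> card ?N")
    case False
    obtain x y w r where "P = x # y # w # r" using k by (auto simp: numeral_3_eq_3 Suc_le_length_iff)
    then have "opath C [x, y, w]" using P by (auto simp: opath_def chain_Cons)
    then have "10 \<le> length C" by (rule path3_outside[OF lon])
    then show ?thesis using ord k dg False by linarith
  next
    case True
    then have "?N \<noteq> {}" by (metis card.empty not_numeral_le_zero)
    then have "\<exists>w\<in>set P. adj (hd P) w" by blast
    then obtain p1 w p2 where w: "P = p1 @ w # p2" "adj (hd P) w" "\<forall>v\<in>set p2. \<not> adj (hd P) v"
      using split_list_last_prop[of P "adj (hd P)"] by blast
    let ?Z = "p1 @ [w]"
    have p1: "p1 \<noteq> []" using w adj_irrefl by (cases p1) auto
    then have hdZ: "hd ?Z = hd P" "hd p1 = hd P" using w by auto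
    have "?N \<subseteq> set ?Z - {hd P}" using w adj_irrefl by auto
    then have "card ?N \<le> card (set ?Z - {hd P})" by (intro card_mono) auto
    also have "\<dots> = card (set ?Z) - 1"
      using hdZ p1 by (intro card_Diff_singleton) (metis hd_in_set Un_iff set_append)
    finally have N: "card ?N \<le> card (set ?Z) - 1" .
    have dZ: "distinct ?Z" using P w(1) by (auto simp: opath_def)
    then have cZ: "card (set ?Z) = length ?Z" by (rule distinct_card)
    have "cyc ?Z" unfolding cyc_def
    proof (intro conjI dZ)
      show "set ?Z \<subseteq> V" using P w(1) by (auto simp: opath_def)
      show "3 \<le> length ?Z" using N cZ True by linarith
      show "chain ?Z" using P w(1) by (auto simp: opath_def chain_append chain_Cons)
      show "adj (last ?Z) (hd ?Z)" using hdZ w(2) adj_sym by simp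
    qed
    moreover have "set ?Z \<inter> set C = {}" using P w(1) by (auto simp: opath_def)
    ultimately have "2 * length ?Z + 6 \<le> length C" by (rule cycle_outside[OF lon])
    moreover have "length ?Z \<le> length P" using w(1) by simp
    moreover have "card ?N + 1 \<le> length ?Z" using N unfolding cZ by simp
    ultimately show ?thesis using ord dg by linarith
  qed
qed

lemma ends_count:
  assumes m: "maxpath C P" and k: "2 \<le> length P"
    and AB: "A = cnbrs C (hd P)" "B = cnbrs C (last P)" "A \<noteq> {}" "B \<noteq> {}" "2 \<le> card (A \<union> B)"
  shows "2 * (card (A - B) + card (B - A) + card (A \<inter> B)) + (length P - 1) * (card (A \<inter> B) +
      (if card (A - B) = 0 then 0 else 1) + (if card (B - A) = 0 then 0 else 1)) + length P \<le> 3 * \<delta> + 2"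
    "card A = card (A - B) + card (A \<inter> B)" "card B = card (B - A) + card (A \<inter> B)"
    "card (A \<union> B) = card (A - B) + card (B - A) + card (A \<inter> B)"
proof -
  have fin: "finite A" "finite B" using AB by auto
  show A: "card A = card (A - B) + card (A \<inter> B)"
    by (rule card_Diff_Int_split[OF fin(1)])
  show B: "card B = card (B - A) + card (A \<inter> B)"
    using card_Diff_Int_split[OF fin(2), of A] by (simp add: Int_commute)
  have "A \<union> B = A \<union> (B - A)" by auto
  then have "card (A \<union> B) = card A + card (B - A)" using card_Un_disjoint[of A "B - A"] fin by auto
  then show U: "card (A \<union> B) = card (A - B) + card (B - A) + card (A \<inter> B)" using A by simp
  have lon: "longest C" and P: "opath C P" using m by (auto simp: maxpath_def)
  have z: "A - B = {} \<longleftrightarrow> card (A - B) = 0" "B - A = {} \<longleftrightarrow> card (B - A) = 0" using fin by auto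
  have "2 * card (A \<union> B) + (length P - 1) *
    (card (A \<inter> B) + (if A - B = {} then 0 else 1) + (if B - A = {} then 0 else 1)) \<le> length C"
    by (rule two_ends_count[OF lon P k _ _ AB(3,4,5)]) (simp_all add: AB(1,2) cnbrs_def)
  then show "2 * (card (A - B) + card (B - A) + card (A \<inter> B)) + (length P - 1) * (card (A \<inter> B) +
      (if card (A - B) = 0 then 0 else 1) + (if card (B - A) = 0 then 0 else 1)) + length P \<le> 3 * \<delta> + 2"
    using cycle_path_order[OF lon P] unfolding z U by linarith
qed

text \<open>Each end has at least \<delta> - length P + 1 neighbours on \<open>C\<close>. If the two
  sets were different, the count would exceed 3\<delta> + 2; if they are equal, it leaves room for
  no further neighbour.\<close>

lemma ends_long:
  assumes m: "maxpath C P" and k: "3 \<le> length P"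
  shows "cnbrs C (hd P) = cnbrs C (last P)" "card (cnbrs C (hd P)) + length P = \<delta> + 1"
    "3 \<le> card (cnbrs C (hd P))"
proof -
  define A where "A = cnbrs C (hd P)"
  define B where "B = cnbrs C (last P)"
  have ne: "P \<noteq> []" using k by auto
  have a: "3 \<le> card A" "\<delta> + 1 \<le> card A + length P"
    using end_three[OF m k] end_degree(3)[OF m] by (auto simp: A_def)
  have b: "3 \<le> card B" "\<delta> + 1 \<le> card B + length P"
    using end_three[OF maxpath_rev[OF m]] end_degree(3)[OF maxpath_rev[OF m]] k ne
    by (auto simp: B_def hd_rev)
  have "finite A" "finite B" by (auto simp: A_def B_def)
  then have "card A \<le> card (A \<union> B)" by (intro card_mono) auto
  then have c2: "2 \<le> card (A \<union> B)" using a by linarith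
  \<comment> \<open>The shift by 3 avoids truncated subtraction; below, the product
    \<open>k' * g\<close> is kept as one term \<open>h\<close> for linear arithmetic.\<close>
  obtain k' where k': "length P = k' + 3" using k by (metis le_add_diff_inverse2)
  define \<alpha> where "\<alpha> = card (A - B)"
  define \<beta> where "\<beta> = card (B - A)"
  define g where "g = card (A \<inter> B)"
  have "A \<noteq> {}" "B \<noteq> {}" using a b by auto
  note cnt = ends_count[OF m _ A_def B_def this c2]
  have main: "2 * (\<alpha> + \<beta> + g) + (k' + 2) * (g + (if \<alpha> = 0 then 0 else 1) + (if \<beta> = 0 then 0 else 1)) + (k' + 3)
      \<le> 3 * \<delta> + 2" "card A = \<alpha> + g" "card B = \<beta> + g"
    using cnt k by (simp_all add: \<alpha>_def \<beta>_def g_def k')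
  define h where "h = k' * g"
  have "\<alpha> = 0 \<and> \<beta> = 0"
  proof (rule ccontr)
    assume *: "\<not> (\<alpha> = 0 \<and> \<beta> = 0)"
    consider "0 < \<alpha>" "0 < \<beta>" | "0 < \<alpha>" "\<beta> = 0" | "\<alpha> = 0" "0 < \<beta>" using * by auto
    then show False
    proof cases
      case 1
      then show False using main a b k' by (simp add: algebra_simps)
    next
      case 2
      then have "2 * \<alpha> + 4 * g + h + 2 * k' + 5 \<le> 3 * \<delta> + 2"
        using main(1) by (simp add: h_def algebra_simps)
      moreover have "k' * 3 \<le> h" using 2 main b by (simp add: h_def)
      ultimately show False using 2 main(2,3) a b k' by linarith
    next
      case 3
      then have "2 * \<beta> + 4 * g + h + 2 * k' + 5 \<le> 3 * \<delta> + 2"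
        using main(1) by (simp add: h_def algebra_simps)
      moreover have "k' * 3 \<le> h" using 3 main a by (simp add: h_def)
      ultimately show False using 3 main(2,3) a b k' by linarith
    qed
  qed
  then have z: "\<alpha> = 0" "\<beta> = 0" by simp_all
  then have "A = B" using \<open>finite A\<close> \<open>finite B\<close> by (auto simp: \<alpha>_def \<beta>_def)
  then show "cnbrs C (hd P) = cnbrs C (last P)" by (simp add: A_def B_def)
  have "4 * g + h + k' + 3 \<le> 3 * \<delta> + 2"
    using main(1) z by (simp add: h_def algebra_simps)
  moreover have "k' * 3 \<le> h" using main(2) a z by (simp add: h_def)
  ultimately have "card A + length P = \<delta> + 1" using main(2) z a k' by linarith
  then show "card (cnbrs C (hd P)) + length P = \<delta> + 1" by (simp add: A_def)
  show "3 \<le> card (cnbrs C (hd P))" using a by (simp add: A_def)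
qed

text \<open>The degree count is tight, so \<open>hd P\<close> is adjacent to all of
  \<open>P\<close>. Reversing an initial part of \<open>P\<close> then makes any vertex but the last
  one the first vertex of another longest path with the same last vertex, and both ends of that path
  have equal neighbours on \<open>C\<close>.\<close>

lemma long_config:
  assumes m: "maxpath C P" and k: "3 \<le> length P"
  shows "config C P (cnbrs C (hd P))" "\<And>x. x \<in> set P \<Longrightarrow> cnbrs C x = cnbrs C (hd P)"
proof -
  let ?A = "cnbrs C (hd P)"
  have lon: "longest C" and P: "opath C P" using m by (auto simp: maxpath_def)
  have dP: "distinct P" "P \<noteq> []" "hd P \<in> V" using P hd_in_set by (auto simp: opath_def)
  have "\<delta> \<le> card ?A + card {w \<in> set P. adj (hd P) w}" using deg[OF dP(3)] end_degree(1)[OF m] by linarith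
  then have "length P - 1 \<le> card {w \<in> set P. adj (hd P) w}" using ends_long(2)[OF m k] by linarith
  moreover have "card (set P - {hd P}) = length P - 1" using dP by (simp add: distinct_card)
  ultimately have "{w \<in> set P. adj (hd P) w} = set P - {hd P}"
    using adj_irrefl by (intro card_seteq) auto
  then have all: "adj (hd P) w" if "w \<in> set P" "w \<noteq> hd P" for w using that by blast
  have x: "cnbrs C x = ?A \<and> (\<forall>w. adj x w \<longrightarrow> w \<in> set P \<union> set C)" if "x \<in> set P" for x
  proof (cases "x = last P")
    case True
    then show ?thesis
      using ends_long(1)[OF m k] maxpath_hd_nbr[OF maxpath_rev[OF m]] dP by (simp add: hd_rev)
  next
    case False
    from that obtain p1 p2 where p1: "P = p1 @ x # p2" by (meson split_list)
    moreover from this have "p2 \<noteq> []" using False by auto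
    ultimately have p: "P = p1 @ x # p2" "p2 \<noteq> []" .
    let ?Q = "rev (p1 @ [x]) @ p2"
    have "adj (hd P) (hd p2)"
    proof (rule all)
      show "hd p2 \<in> set P" using p by simp
      have "hd P \<in> set (p1 @ [x])" using p by (cases p1) auto
      then show "hd p2 \<noteq> hd P" using dP(1) hd_in_set[OF p(2)] unfolding p(1) by auto
    qed
    moreover have "chain ((p1 @ [x]) @ p2)" using P p by (simp add: opath_def)
    then have "chain (p1 @ [x])" "chain p2" by (simp_all only: chain_append)
    moreover have "last (rev (p1 @ [x])) = hd P" using p by (cases p1) (auto simp: last_rev)
    ultimately have "chain ?Q"
      unfolding chain_append[of "rev (p1 @ [x])"] chain_rev by simp
    then have "opath C ?Q" using P p by (auto simp: opath_def)
    moreover have len: "length ?Q = length P" using p by simp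
    ultimately have mQ: "maxpath C ?Q" using m by (simp add: maxpath_def)
    moreover have hl: "hd ?Q = x" "last ?Q = last P" using p by auto
    ultimately have "cnbrs C x = cnbrs C (last P)" using ends_long(1)[OF mQ] len k by simp
    moreover have "set ?Q = set P" using p by auto
    ultimately show ?thesis using ends_long(1)[OF m k] maxpath_hd_nbr[OF mQ] hl by simp
  qed
  then show "\<And>x. x \<in> set P \<Longrightarrow> cnbrs C x = ?A" by blast
  have "w \<in> set P \<union> ?A" if "x \<in> set P" "adj x w" for x w
    using x[OF that(1)] that(2) by (auto simp: cnbrs_def)
  moreover have "joins P p q" if "p \<in> ?A" "q \<in> ?A" for p q
    using that ends_long(1)[OF m k] adj_sym by (auto simp: joins_def cnbrs_def)
  ultimately show "config C P ?A"
    unfolding config_def using lon P ends_long(3)[OF m k] by (auto simp: cnbrs_def)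
qed

lemma config_order:
  assumes "config C P X" shows "length P + card X * (length P + 1) + 2 \<le> 3 * \<delta> + 2"
proof -
  obtain ss where ss: "config (flat ss) P X" "segs X ss" using config_segs[OF assms] by blast
  obtain t t' u v L where "t \<in> set ss" "t' \<in> set ss" "t \<noteq> t'" "u \<in> set (snd t)" "v \<in> set (snd t')"
    "link (flat ss) P u L v" using link_exists[OF ss] by blast
  from link_excess(2)[OF ss this] show ?thesis using order by linarith
qed

text \<open>The count leaves at most one vertex in each of \<open>A - B\<close> and
  \<open>B - A\<close>, so any two vertices of \<open>A \<union> B\<close> are joined through the
  edge. This suffices for \<open>config\<close> and the bound from toughness, which in turn gives
  \<open>A = B\<close>. Fewer than three neighbours would separate \<open>P\<close> from the
  rest.\<close>

lemma edge_config:
  assumes m: "maxpath C P" and k: "length P = 2"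
  shows "cnbrs C (hd P) = cnbrs C (last P)" "card (cnbrs C (hd P)) + 1 = \<delta>"
    "config C P (cnbrs C (hd P))" "3 \<le> card (cnbrs C (hd P))"
proof -
  have lon: "longest C" and P: "opath C P" using m by (auto simp: maxpath_def)
  define A where "A = cnbrs C (hd P)"
  define B where "B = cnbrs C (last P)"
  obtain x y where xy: "P = [x, y]" using k by (auto simp: numeral_2_eq_2 length_Suc_conv)
  have "3 \<le> length C" using lon by (simp add: longest_def cyc_def)
  moreover have "distinct (C @ P)" "set (C @ P) \<subseteq> V"
    using lon P by (auto simp: longest_def cyc_def opath_def)
  then have "length C + length P \<le> card V" using card_mono[OF finV] by (metis distinct_card length_append)
  ultimately have "4 \<le> card V" using k by linarith
  then have "3 \<le> card {u. adj (hd P) u}" "3 \<le> card {u. adj (hd (rev P)) u}"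
    using three_neighbours P xy by (auto simp: opath_def)
  then have a: "2 \<le> card A" "\<delta> \<le> card A + 1" "2 \<le> card B" "\<delta> \<le> card B + 1"
    using end_degree[OF m] end_degree[OF maxpath_rev[OF m]] k xy by (auto simp: A_def B_def)
  have fin: "finite A" "finite B" by (auto simp: A_def B_def)
  then have "card A \<le> card (A \<union> B)" by (intro card_mono) auto
  then have c2: "2 \<le> card (A \<union> B)" using a by linarith
  define \<alpha> where "\<alpha> = card (A - B)"
  define \<beta> where "\<beta> = card (B - A)"
  define g where "g = card (A \<inter> B)"
  have "A \<noteq> {}" "B \<noteq> {}" using a by auto
  note cnt = ends_count[OF m _ A_def B_def this c2]
  have main: "2 * (\<alpha> + \<beta> + g) + (g + (if \<alpha> = 0 then 0 else 1) + (if \<beta> = 0 then 0 else 1)) \<le> 3 * \<delta>"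
    "card A = \<alpha> + g" "card B = \<beta> + g" "card (A \<union> B) = \<alpha> + \<beta> + g"
    using cnt k by (simp_all add: \<alpha>_def \<beta>_def g_def)
  have le1: "\<alpha> \<le> 1" "\<beta> \<le> 1" using main a by (auto split: if_splits)
  have nb: "w \<in> set P \<union> (A \<union> B)" if "z \<in> set P" "adj z w" for z w
    using that maxpath_hd_nbr[OF m] maxpath_hd_nbr[OF maxpath_rev[OF m]]
    by (auto simp: xy A_def B_def cnbrs_def)
  have one: "p = q" if "card (D - E) \<le> 1" "p \<in> D - E" "q \<in> D - E" "finite D" for D E :: "'a set" and p q
    using that card_le_Suc0_iff_eq[of "D - E"] by auto
  have jn: "joins P p q" if "p \<in> A \<union> B" "q \<in> A \<union> B" "p \<noteq> q" for p q
  proof -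
    have "\<not> (p \<in> A - B \<and> q \<in> A - B)" "\<not> (p \<in> B - A \<and> q \<in> B - A)"
      using le1 that(3) fin one[of A B p q] one[of B A p q] by (auto simp: \<alpha>_def \<beta>_def)
    then have "p \<in> A \<and> q \<in> B \<or> q \<in> A \<and> p \<in> B" using that by blast
    then show ?thesis using adj_sym by (auto simp: joins_def A_def B_def cnbrs_def)
  qed
  have c: "config C P (A \<union> B)"
    unfolding config_def using lon P c2 nb jn by (auto simp: A_def B_def cnbrs_def)
  have "card (A \<union> B) < \<delta>" using config_order[OF c] k by simp
  then have "\<alpha> = 0" "\<beta> = 0" using main a by (auto split: if_splits)
  then have AB: "A = B" using fin by (auto simp: \<alpha>_def \<beta>_def)
  then show "cnbrs C (hd P) = cnbrs C (last P)" by (simp add: A_def B_def)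
  show cA: "card (cnbrs C (hd P)) + 1 = \<delta>"
    using \<open>card (A \<union> B) < \<delta>\<close> a AB unfolding A_def[symmetric] by simp
  show c': "config C P (cnbrs C (hd P))" using c AB by (simp add: A_def)
  show "3 \<le> card (cnbrs C (hd P))"
  proof (rule ccontr)
    assume "\<not> 3 \<le> card (cnbrs C (hd P))"
    then have A3: "card A < 3" by (simp add: A_def)
    have AV: "A \<subseteq> V" "A \<subseteq> set C" "set C \<subseteq> V" using adj_V2 configD[OF c'] by (auto simp: A_def cnbrs_def)
    have "set P \<union> A = V"
    proof (rule conn3[OF AV(1) A3])
      show "set P \<subseteq> V - A" using P AV by (auto simp: opath_def)
      show "set P \<noteq> {}" using xy by simp
      show "v \<in> set P \<union> A" if "u \<in> set P" "adj u v" for u v using nb[OF that] AB by simp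
    qed
    then have "set C \<subseteq> A" using P AV by (auto simp: opath_def)
    then have "card (set C) \<le> card A" using fin by (intro card_mono)
    moreover have "card (set C) = length C" using lon by (simp add: longest_def cyc_def distinct_card)
    ultimately show False using A3 \<open>3 \<le> length C\<close> by linarith
  qed
qed

lemma outside_path:
  assumes m: "maxpath C P" and k: "2 \<le> length P" and X: "X = cnbrs C (hd P)"
  shows "config C P X" "card X + length P = \<delta> + 1" "3 \<le> card X"
    "length P = 2 \<or> length P = 3 \<and> card X = 3" "\<And>x. x \<in> set P \<Longrightarrow> cnbrs C x = X"
proof -
  have *: "config C P X \<and> card X + length P = \<delta> + 1 \<and> 3 \<le> card X \<and> (\<forall>x\<in>set P. cnbrs C x = X)"
  proof (cases "length P = 2")
    case True
    then obtain x y where "P = [x, y]" by (auto simp: numeral_2_eq_2 length_Suc_conv)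
    then show ?thesis using edge_config[OF m True] True X by auto
  next
    case False
    then have "3 \<le> length P" using k by linarith
    then show ?thesis using long_config[OF m] ends_long[OF m] X by metis
  qed
  then show "config C P X" "card X + length P = \<delta> + 1" "3 \<le> card X" "\<And>x. x \<in> set P \<Longrightarrow> cnbrs C x = X"
    by auto
  show "length P = 2 \<or> length P = 3 \<and> card X = 3"
  proof (rule ccontr)
    assume no: "\<not> ?thesis"
    then obtain k' where k': "length P = k' + 3" using k by (metis add.commute le_Suc_ex le_antisym not_less_eq_eq numeral_2_eq_2 numeral_3_eq_3)
    obtain s' where s': "card X = s' + 3" using * by (metis add.commute le_Suc_ex)
    have "s' + k' + 5 = \<delta>" using * k' s' by linarith
    moreover have "k' + 3 + (s' + 3) * (k' + 4) \<le> 3 * \<delta>" using config_order[of C P X] * k' s' by (simp add: algebra_simps)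
    \<comment> \<open>The inequality amounts to (s' + 1)(k' + 1) <= 1.\<close>
    ultimately have "s' = 0 \<and> k' = 0" by (simp add: algebra_simps)
    then show False using no k' s' by simp
  qed
qed

end

section \<open>Paths on three vertices\<close>

context sgraph begin

text \<open>The bound has to hold for all longest cycles at once, since exchanging \<open>P\<close>
  with a segment changes the cycle.\<close>

definition gmax :: "nat \<Rightarrow> bool" where
  "gmax k \<longleftrightarrow> (\<forall>C Q. longest C \<longrightarrow> opath C Q \<longrightarrow> length Q \<le> k)"

lemma gmax_maxpath: "gmax (length P) \<Longrightarrow> longest C \<Longrightarrow> opath C P \<Longrightarrow> maxpath C P"
  by (simp add: gmax_def maxpath_def)

text \<open>A segment as long as \<open>P\<close> can change places with it: the cycle keeps its
  length, and the segment becomes a path outside.\<close>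

lemma pair_replace:
  assumes p: "pair P X R1 b R2 a" and len: "length b = length P"
  shows "\<exists>P'. set P' = set P \<and> length P' = length P \<and> longest (R1 @ P' @ R2 @ a) \<and>
    opath (R1 @ P' @ R2 @ a) b"
proof -
  note ch = pair_chains[OF p]
  have c: "config (R1 @ b @ R2 @ a) P X" using p by (simp add: pair_def)
  have ne: "a \<noteq> []" "b \<noteq> []" using pair_gap[OF pair_swap[OF p]] len ch(10) by auto
  have "\<exists>Q. set Q = set P \<and> length Q = length P \<and> cyc (R1 @ Q @ R2 @ a)"
    by (rule pair_reroute[OF p ne(1) ch(3) _ _ ch(5,6)[OF ne(1)]]) (use pair_ends(1)[OF p] ch(9) in auto)
  then obtain P' where P': "set P' = set P" "length P' = length P" "cyc (R1 @ P' @ R2 @ a)" by blast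
  have "longest (R1 @ P' @ R2 @ a)"
    by (rule longest_same_length[OF configD(1)[OF c] P'(3)]) (use P'(2) len in simp)
  moreover have "opath (R1 @ P' @ R2 @ a) b"
    unfolding opath_def using pair_ends(1)[OF p] ch(4,9) ne(2) P'(1) by auto
  ultimately show ?thesis using P'(1,2) by blast
qed

end

context tough_graph begin

lemma gmax_path:
  assumes g: "gmax (length Q)" and lon: "longest C" and Q: "opath C Q" "2 \<le> length Q" and x: "x \<in> set Q"
  shows "config C Q (cnbrs C x)" "card (cnbrs C x) + length Q = \<delta> + 1" "y \<in> set Q \<Longrightarrow> cnbrs C y = cnbrs C x"
proof -
  have m: "maxpath C Q" by (rule gmax_maxpath[OF g lon Q(1)])
  note o = outside_path[OF m Q(2) refl]
  show "config C Q (cnbrs C x)" "card (cnbrs C x) + length Q = \<delta> + 1" using o(1,2) o(5)[OF x] by simp_all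
  show "y \<in> set Q \<Longrightarrow> cnbrs C y = cnbrs C x" using o(5)[OF x] o(5)[of y] by simp
qed

text \<open>\<open>joins\<close> yields adjacency to one of the ends of \<open>P\<close>, and all
  vertices of \<open>P\<close> have the same neighbours on the cycle.\<close>

lemma config_cnbrs:
  assumes g: "gmax (length P)" and k: "2 \<le> length P" and c: "config C P X" and x: "x \<in> set P"
  shows "cnbrs C x = X"
proof
  note gp = gmax_path[OF g configD(1,2)[OF c] k]
  have P: "P \<noteq> []" "set P \<inter> set C = {}" using configD(2)[OF c] by (auto simp: opath_def)
  show "cnbrs C x \<subseteq> X" using configD(8)[OF c x] P(2) by (auto simp: cnbrs_def)
  show "X \<subseteq> cnbrs C x"
  proof
    fix p assume p: "p \<in> X"
    have "\<not> X \<subseteq> {p}" using configD(4)[OF c] card_mono[of "{p}" X] by auto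
    then obtain q where "q \<in> X" "p \<noteq> q" by blast
    then have "joins P p q" using configD(9)[OF c] p by blast
    then have "adj (hd P) p \<or> adj (last P) p" using adj_sym by (auto simp: joins_def)
    moreover have "p \<in> set C" using configD(3)[OF c] p by blast
    ultimately have "p \<in> cnbrs C (hd P) \<or> p \<in> cnbrs C (last P)" by (simp add: cnbrs_def)
    moreover have "cnbrs C (hd P) = cnbrs C x" "cnbrs C (last P) = cnbrs C x"
      using gp(3)[OF x] P(1) by simp_all
    ultimately show "p \<in> cnbrs C x" by blast
  qed
qed

text \<open>After the exchange of \<open>b\<close> and \<open>P\<close> all vertices of
  \<open>b\<close> have the same neighbours on the cycle, so \<open>u\<close> is adjacent to both
  ends of \<open>b\<close>. For these two edges \<open>b\<close> contributes nothing to the bounds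
  of \<open>pair_link\<close>.\<close>

lemma short_seg:
  assumes g: "gmax (length P)" and k: "2 \<le> length P" and p: "pair P X R1 b R2 (a1 @ u # a2)"
    and len: "length b = length P" and v: "v \<in> set b" "adj u v"
  shows "\<forall>w\<in>set b. adj u w" "length P \<le> length a1" "length P \<le> length a2"
proof -
  let ?a = "a1 @ u # a2"
  obtain P' where P': "set P' = set P" "longest (R1 @ P' @ R2 @ ?a)" "opath (R1 @ P' @ R2 @ ?a) b"
    using pair_replace[OF p len] by blast
  let ?C' = "R1 @ P' @ R2 @ ?a"
  have "u \<in> cnbrs ?C' v" using v(2) adj_sym by (simp add: cnbrs_def)
  then have all: "\<forall>w\<in>set b. adj u w"
    using gmax_path(3)[OF _ P'(2,3) _ v(1)] g k len adj_sym by (auto simp: cnbrs_def)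
  then show "\<forall>w\<in>set b. adj u w" .
  have bne: "b \<noteq> []" using v(1) by auto
  have "pair P X R1 ([] @ hd b # tl b) R2 ?a" using p bne by simp
  moreover have "link (R1 @ ([] @ hd b # tl b) @ R2 @ ?a) P u [] (hd b)" using all bne by (simp add: link_Nil)
  ultimately show "length P \<le> length a1" using pair_link(1) by fastforce
  have "pair P X R1 (butlast b @ last b # []) R2 ?a" using p bne by simp
  moreover have "link (R1 @ (butlast b @ last b # []) @ R2 @ ?a) P u [] (last b)" using all bne by (simp add: link_Nil)
  ultimately show "length P \<le> length a2" using pair_link(2) by fastforce
qed

text \<open>After the exchange \<open>w\<close> has exactly \<open>card X\<close> neighbours on the
  new cycle. One inside another segment would need \<open>length P\<close> vertices on either side
  of it, too many for that segment, so all of them lie in \<open>X\<close>.\<close>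

lemma short_seg_complete:
  assumes g: "gmax (length P)" and k: "2 \<le> length P"
    and c: "config (flat ss) P X" and sg: "segs X ss"
    and t: "t \<in> set ss" "length (snd t) = length P"
    and short: "\<And>t'. t' \<in> set ss \<Longrightarrow> length (snd t') \<le> 2 * length P"
    and w: "w \<in> set (snd t)" and x: "x \<in> X"
  shows "adj w x"
proof -
  let ?C = "flat ss"
  have d: "distinct ?C" "X \<subseteq> set ?C" using configD[OF c] by auto
  have "2 \<le> card (set ss)" using card_segs[OF d(1) sg d(2)] configD(4)[OF c] by simp
  then have "\<not> set ss \<subseteq> {t}" using card_mono[of "{t}" "set ss"] by auto
  then obtain t' where t': "t' \<in> set ss" "t' \<noteq> t" by blast
  obtain R1 R2 where R: "pair P X R1 (snd t) R2 (snd t')" "set (R1 @ snd t @ R2 @ snd t') = set ?C"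
    using segs_pair[OF c sg t'(1) t(1) t'(2)] by blast
  obtain P' where P': "set P' = set P" "longest (R1 @ P' @ R2 @ snd t')" "opath (R1 @ P' @ R2 @ snd t') (snd t)"
    using pair_replace[OF R(1) t(2)] by blast
  let ?C' = "R1 @ P' @ R2 @ snd t'"
  have w': "w \<notin> set P" "w \<notin> X"
    using w P'(1,3) t(1) sg by (auto simp: opath_def segs_def)
  have sub: "cnbrs ?C' w \<subseteq> X"
  proof
    fix p assume "p \<in> cnbrs ?C' w"
    then have p: "adj w p" "p \<in> set ?C'" by (auto simp: cnbrs_def)
    have "p \<notin> set P" using configD(8)[OF c _ adj_sym[OF p(1)]] w' by blast
    then have pC: "p \<in> set ?C" using p(2) R(2) P'(1) by auto
    show "p \<in> X"
    proof (rule ccontr)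
      assume "p \<notin> X"
      then obtain r where r: "r \<in> set ss" "p \<in> set (snd r)" using in_seg[OF sg] pC by blast
      have "p \<notin> set (snd t)" using p(2) P'(3) by (auto simp: opath_def)
      then have "r \<noteq> t" using r by auto
      obtain S1 S2 where S: "pair P X S1 (snd t) S2 (snd r)"
        using segs_pair[OF c sg r(1) t(1) \<open>r \<noteq> t\<close>] by blast
      obtain a1 a2 where a: "snd r = a1 @ p # a2" using r(2) by (meson split_list)
      have "length P \<le> length a1" "length P \<le> length a2"
        using short_seg(2,3)[OF g k S[unfolded a] t(2) w adj_sym[OF p(1)]] by auto
      then show False using short[OF r(1)] by (simp add: a)
    qed
  qed
  have "card (cnbrs ?C' w) + length P = \<delta> + 1"
    using gmax_path(2)[OF _ P'(2,3) _ w] g k t(2) by simp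
  moreover have "card X + length P = \<delta> + 1"
  proof -
    have "hd P \<in> set P" using k by (cases P) auto
    then show ?thesis
      using config_cnbrs[OF g k c] gmax_path(2)[OF g configD(1,2)[OF c] k] by metis
  qed
  ultimately have "cnbrs ?C' w = X" using card_subset_eq[OF configD(7)[OF c] sub] by simp
  then show "adj w x" using x by (auto simp: cnbrs_def)
qed

text \<open>The extremal case: segments with 3, 4 and 4 inner vertices and a longest cycle on 14
  vertices. Each of the four edges between \<open>a\<close> and \<open>b\<close> that
  \<open>pair_link\<close> permits produces a cycle on 15 or 17 vertices.\<close>

lemma no_three_core:
  assumes g: "gmax 3" and P3: "length P = 3" and \<delta>: "\<delta> = 5"
    and p: "pair P X (p # d @ [q]) b [r] a" and len: "length a = 4" "length b = 4" "length d = 3"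
    and X: "X = {p, q, r}" and V: "V = set (p # d @ q # b @ r # a) \<union> set P"
    and uv: "u \<in> set a" "v \<in> set b" "adj u v"
  shows False
proof -
  let ?C = "(p # d @ [q]) @ b @ [r] @ a"
  have c: "config ?C P X" using p by (simp add: pair_def)
  have g': "gmax (length P)" "2 \<le> length P" using g P3 by simp_all
  have cC: "cyc ?C" and lonC: "\<And>D. cyc D \<Longrightarrow> length D \<le> 14"
    using configD(1)[OF c] len by (auto simp: longest_def)
  obtain x1 x2 x3 where P: "P = [x1, x2, x3]" using P3 by (auto simp: numeral_3_eq_3 length_Suc_conv)
  obtain a1 a2 a3 a4 where a: "a = [a1, a2, a3, a4]" using len by (auto simp: numeral_eq_Suc length_Suc_conv)
  obtain b1 b2 b3 b4 where b: "b = [b1, b2, b3, b4]" using len by (auto simp: numeral_eq_Suc length_Suc_conv)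
  obtain d1 d2 d3 where d: "d = [d1, d2, d3]" using len by (auto simp: numeral_3_eq_3 length_Suc_conv)
  have Px: "adj x w" if "x \<in> set P" "w \<in> X" for x w
    using config_cnbrs[OF g' c that(1)] that(2) by (auto simp: cnbrs_def)
  let ?ss = "[(p, d), (q, b), (r, a)]"
  have sg: "segs X ?ss" using p c X configD(5)[OF c] by (auto simp: pair_def)
  have css: "config (flat ?ss) P X" using c by simp
  \<comment> \<open>\<open>d\<close> is as long as \<open>P\<close>, hence also completely joined to
    \<open>X\<close>, and can be inserted like \<open>P\<close>.\<close>
  have dX: "adj w x" if "w \<in> set d" "x \<in> X" for w x
    by (rule short_seg_complete[OF g' css sg, of "(p, d)"]) (use that len P3 in auto)
  have dist: "distinct ?C" "set P \<inter> set ?C = {}" "distinct P" "set P \<subseteq> V" "chain P" "set ?C \<subseteq> V"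
    using configD(2,5,6)[OF c] by (auto simp: opath_def)
  have ch: "adj a1 a2" "adj a2 a3" "adj a3 a4" "adj b1 b2" "adj b2 b3" "adj b3 b4" "adj d1 d2" "adj d2 d3"
    "adj r a1" "adj a4 p" "adj q b1" "adj b4 r" "adj x1 x2" "adj x2 x3"
    using cC dist(5) by (auto simp: cyc_def chain_Cons a b d P)
  note sym = this[THEN adj_sym]
  let ?all = "[p, d1, d2, d3, q, b1, b2, b3, b4, r, a1, a2, a3, a4, x1, x2, x3]"
  have "distinct (?C @ P)" "set (?C @ P) \<subseteq> V" using dist by auto
  then have ne1: "distinct ?all" and inV: "set ?all \<subseteq> V" by (simp_all add: a b d P)
  moreover from ne1 have "distinct (rev ?all)" by (simp only: distinct_rev)
  ultimately have ne: "distinct ?all" "distinct (rev ?all)" by simp_all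
  have PX: "adj x1 w" "adj w x1" "adj x3 w" "adj w x3" "adj d1 w" "adj w d1" "adj d3 w" "adj w d3"
    if "w \<in> X" for w
    using that Px[of x1] Px[of x3] dX[of d1] dX[of d3] adj_sym by (simp_all add: P d)
  have pqr: "p \<in> X" "q \<in> X" "r \<in> X" using X by simp_all
  note PX' = PX[OF pqr(1)] PX[OF pqr(2)] PX[OF pqr(3)]
  have no_cyc: False if "distinct D" "set D \<subseteq> set ?all" "15 \<le> length D" "chain D" "adj (last D) (hd D)" for D
  proof -
    have "cyc D" unfolding cyc_def using that inV by auto
    then show False using lonC[of D] that(3) by simp
  qed
  have low: False if e: "adj a1 b4 \<or> adj a2 b3"
    using e
  proof
    assume e: "adj a1 b4"
    show False
      by (rule no_cyc[of "[p, x1, x2, x3, r, d1, d2, d3, q, b1, b2, b3, b4, a1, a2, a3, a4]"])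
        (use ne ch PX' e[THEN adj_sym] in \<open>simp_all add: chain_Cons\<close>)
  next
    assume e: "adj a2 b3"
    show False
      by (rule no_cyc[of "[p, x1, x2, x3, r, d1, d2, d3, q, b1, b2, b3, a2, a3, a4]"])
        (use ne ch PX' e[THEN adj_sym] in \<open>simp_all add: chain_Cons\<close>)
  qed
  \<comment> \<open>The two bounds of \<open>pair_link\<close> force the positions, counted from 0,
    to add up to 3.\<close>
  have pos: "adj a1 b4 \<or> adj a2 b3 \<or> adj a3 b2 \<or> adj a4 b1"
  proof -
    obtain a' a'' where a': "a = a' @ u # a''" using uv(1) by (meson split_list)
    obtain b' b'' where b': "b = b' @ v # b''" using uv(2) by (meson split_list)
    have "link ((p # d @ [q]) @ (b' @ v # b'') @ [r] @ a' @ u # a'') P u [] v" using uv(3) by (simp add: link_Nil)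
    then have "3 \<le> length a' + length b'" "3 \<le> length a'' + length b''"
      using pair_link[of P X "p # d @ [q]" b' v b'' "[r]" a' u a'' "[]"] p P3 by (simp_all add: a' b')
    moreover have "length a' + length a'' = 3" "length b' + length b'' = 3" using len a' b' by simp_all
    moreover have "u = a ! length a'" "v = b ! length b'" using a' b' by simp_all
    ultimately have "length a' + length b' = 3" "length a' \<le> 3" by linarith+
    then have "length a' = 0 \<and> length b' = 3 \<or> length a' = 1 \<and> length b' = 2 \<or>
        length a' = 2 \<and> length b' = 1 \<or> length a' = 3 \<and> length b' = 0" by linarith
    then show ?thesis
      using uv(3) \<open>u = a ! length a'\<close> \<open>v = b ! length b'\<close> by (auto simp: a b numeral_eq_Suc)
  qed
  \<comment> \<open>Otherwise only \<open>b1\<close>, \<open>b2\<close>, \<open>b3\<close>,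
    \<open>r\<close> could be neighbours of \<open>b4\<close>, but the minimum degree is 5.\<close>
  have "\<exists>t. t \<in> {p, q} \<and> adj b4 t"
  proof (rule ccontr)
    assume no: "\<not> ?thesis"
    have onlyab: "w = a1" if w: "w \<in> set a" "adj b4 w" for w
    proof -
      obtain a' a'' where a': "a = a' @ w # a''" using w(1) by (meson split_list)
      have "link ((p # d @ [q]) @ ([b1, b2, b3] @ b4 # []) @ [r] @ a' @ w # a'') P w [] b4"
        using w(2) adj_sym by (simp add: link_Nil)
      then have "3 \<le> length a''"
        using pair_link(2)[of P X "p # d @ [q]" "[b1, b2, b3]" b4 "[]" "[r]" a' w a'' "[]"] p P3
        by (simp add: a' b)
      then have "a' = []" using len a' by (cases a') auto
      then show ?thesis using a' a by simp
    qed
    have "w \<in> {b1, b2, b3, r}" if w: "adj b4 w" for w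
    proof -
      have "w \<in> V" by (rule adj_V2[OF w])
      moreover have "w \<notin> set P"
      proof
        assume "w \<in> set P"
        then have "b4 \<in> set P \<union> X" using configD(8)[OF c _ adj_sym[OF w]] by blast
        then show False using dist X by (auto simp: b)
      qed
      moreover have "w \<notin> set d"
      proof
        assume "w \<in> set d"
        then obtain S1 S2 where "pair P X S1 d S2 b"
          using segs_pair[OF css sg, of "(q, b)" "(p, d)"] dist(1) by auto
        then have "pair P X S1 d S2 ([b1, b2, b3] @ b4 # [])" by (simp add: b)
        from short_seg(3)[OF g' this _ \<open>w \<in> set d\<close> w] show False using P3 len by simp
      qed
      moreover have "w \<notin> set a" using onlyab w low adj_sym by blast
      ultimately show ?thesis using V no w adj_irrefl by (auto simp: b)
    qed
    then have "card {w. adj b4 w} \<le> card {b1, b2, b3, r}" by (intro card_mono) auto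
    also have "\<dots> \<le> 4" by (simp add: card_insert_if)
    finally show False using deg[of b4] \<delta> dist(6) by (simp add: b)
  qed
  \<comment> \<open>\<open>P\<close> and \<open>d\<close> are joined to both \<open>p\<close> and
    \<open>q\<close>, so these are interchangeable in the cycles below.\<close>
  then obtain t t' where t: "t = p \<and> t' = q \<or> t = q \<and> t' = p" "adj b4 t" by blast
  then have tX: "t \<in> X" "t' \<in> X" using pqr by auto
  note PXt = PX[OF tX(1)] PX[OF tX(2)]
  have "distinct [t, d1, d2, d3, t', b1, b2, b3, b4, r, a1, a2, a3, a4, x1, x2, x3]"
    using t(1) ne by auto
  moreover from this have "distinct (rev [t, d1, d2, d3, t', b1, b2, b3, b4, r, a1, a2, a3, a4, x1, x2, x3])"
    by (simp only: distinct_rev)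
  ultimately have net: "distinct [t, d1, d2, d3, t', b1, b2, b3, b4, r, a1, a2, a3, a4, x1, x2, x3]"
    "distinct (rev [t, d1, d2, d3, t', b1, b2, b3, b4, r, a1, a2, a3, a4, x1, x2, x3])" .
  have net3: "set [t, d1, d2, d3, t', b1, b2, b3, b4, r, a1, a2, a3, a4, x1, x2, x3] = set ?all"
    using t(1) by auto
  consider "adj a4 b1" | "adj a3 b2" using pos low by blast
  then show False
  proof cases
    case 1
    show False
      by (rule no_cyc[of "[r, a1, a2, a3, a4, b1, b2, b3, b4, t, x1, x2, x3, t', d1, d2, d3]"];
          (unfold net3[symmetric])?)
        (use net ch PX' PXt 1 t(2) in \<open>simp_all add: chain_Cons\<close>)
  next
    case 2
    show False
      by (rule no_cyc[of "[r, a1, a2, a3, b2, b3, b4, t, x1, x2, x3, t', d1, d2, d3]"];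
          (unfold net3[symmetric])?)
        (use net ch PX' PXt 2 t(2) in \<open>simp_all add: chain_Cons\<close>)
  qed
qed

text \<open>Only k = s = 3 is left, with \<delta> = 5, at most 17 vertices and two spare ones. A
  link uses up both, so it is an edge between segments with 3 + 5 or 4 + 4 inner vertices, and
  \<open>short_seg\<close> excludes the former.\<close>

lemma no_three:
  assumes lon: "longest C" and Q: "opath C Q"
  shows "length Q \<le> 2"
proof (rule ccontr)
  assume "\<not> length Q \<le> 2"
  then obtain P where P: "maxpath C P" "3 \<le> length P" using maxpath_exists[OF lon Q] by fastforce
  define X where "X = cnbrs C (hd P)"
  have "2 \<le> length P" using P(2) by simp
  note o = outside_path[OF P(1) this X_def]
  have k: "length P = 3" "card X = 3" "\<delta> = 5" using o(2,4) P(2) by auto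
  have "length R \<le> 3" if R: "longest D" "opath D R" for D R
  proof -
    obtain R' where R': "maxpath D R'" "length R \<le> length R'" using maxpath_exists[OF R] by blast
    then show ?thesis using outside_path(4)[OF R'(1) _ refl] by (cases "2 \<le> length R'") auto
  qed
  then have g: "gmax 3" by (simp add: gmax_def)
  then have g': "gmax (length P)" "2 \<le> length P" using k by simp_all
  have V17: "card V \<le> 17" using order k by simp
  have core: False if p: "pair P X R1 b [r] a" and R1: "R1 = p # d @ [q]" and X: "X = {p, q, r}" and pd: "set d \<inter> X = {}"
    and uv: "u \<in> set a" "v \<in> set b" "adj u v" and len: "length a = 4" "length b = 4" for p d q r R1 a b u v
  proof -
    let ?ss = "[(p, d), (q, b), (r, a)]"
    have c: "config (flat ?ss) P X" using p R1 by (simp add: pair_def)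
    have sg: "segs X ?ss" using p X pd by (auto simp: pair_def)
    have "distinct (flat ?ss)" by (rule configD(5)[OF c])
    then have "(\<Sum>t\<in>set ?ss. length (snd t) - length P) = (length d - 3) + 2"
      using len k by auto
    moreover have "length P + card X * (length P + 1) + (\<Sum>t\<in>set ?ss. length (snd t) - length P) +
      card (V - set (flat ?ss) - set P) \<le> card V" by (rule excess[OF c sg order_refl])
    ultimately have "length d \<le> 3" "card (V - set (flat ?ss) - set P) = 0" using k V17 by simp_all
    moreover have "length P \<le> length d" using segs_length[OF c sg, of "(p, d)"] by simp
    ultimately have d3: "length d = 3" "V \<subseteq> set (flat ?ss) \<union> set P" using k finV by auto
    have "V = set (p # d @ q # b @ r # a) \<union> set P"
      using d3(2) configD(2,6)[OF c] by (auto simp: opath_def)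
    then show False
      using no_three_core[OF g k(1,3) p[unfolded R1] len d3(1) X _ uv] by blast
  qed
  obtain ss where ss: "config (flat ss) P X" "segs X ss" using config_segs[OF o(1)] by blast
  obtain t t' u v L where t: "t \<in> set ss" "t' \<in> set ss" "t \<noteq> t'" "u \<in> set (snd t)" "v \<in> set (snd t')"
    "link (flat ss) P u L v" using link_exists[OF ss] by blast
  note le = link_excess[OF ss t]
  have "17 + 3 * length L \<le> card V" using le(2) k by simp
  then have "length L = 0" using V17 by linarith
  then have "L = []" by simp
  then have uv: "adj u v" using t(6) by (simp add: link_Nil)
  have "8 \<le> length (snd t) + length (snd t')" using le(1) k by simp
  moreover have "length P + card X * (length P + 1) + (\<Sum>r\<in>{t, t'}. length (snd r) - length P) +
      card (V - set (flat ss) - set P) \<le> card V" by (rule excess[OF ss]) (use t in auto)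
  then have "(length (snd t) - 3) + (length (snd t') - 3) \<le> 2" using t(3) k V17 by simp
  moreover have ge: "3 \<le> length (snd t)" "3 \<le> length (snd t')" using segs_length[OF ss] t k by auto
  ultimately have sum8: "length (snd t) + length (snd t') = 8" by linarith
  have not3: "length (snd r') \<noteq> 3"
    if r: "r \<in> set ss" "r' \<in> set ss" "r \<noteq> r'" "w \<in> set (snd r)" "w' \<in> set (snd r')" "adj w w'"
      "length (snd r) + length (snd r') = 8" for r r' w w'
  proof
    assume l3: "length (snd r') = 3"
    obtain R1 R2 where R: "pair P X R1 (snd r') R2 (snd r)" using segs_pair[OF ss r(1-3)] by blast
    obtain a1 a2 where a: "snd r = a1 @ w # a2" using r(4) by (meson split_list)
    have "length P \<le> length a1" "length P \<le> length a2"
      using short_seg(2,3)[OF g' R[unfolded a] _ r(5,6)] l3 k by auto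
    then show False using r(7) l3 k by (simp add: a)
  qed
  have len: "length (snd t) = 4" "length (snd t') = 4"
    using not3[OF t(1-5) uv sum8] not3[OF t(2,1) t(3)[symmetric] t(5,4) adj_sym[OF uv]] sum8 ge by linarith+
  obtain R1 R2 where R: "pair P X R1 (snd t') R2 (snd t)" using segs_pair[OF ss t(1-3)] by blast
  obtain s2 s3 where s: "R1 = flat s2 @ [last R1]" "R2 = flat s3 @ [last R2]"
    "segs X ((last R2, snd t) # s2 @ (last R1, snd t') # s3)"
    "config (flat ((last R2, snd t) # s2 @ (last R1, snd t') # s3)) P X"
    using pair_segs[OF R] by blast
  let ?ss = "(last R2, snd t) # s2 @ (last R1, snd t') # s3"
  have d: "distinct (flat ?ss)" "X \<subseteq> set (flat ?ss)" using configD[OF s(4)] by auto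
  have X: "X = fst ` set ?ss" using fst_segs[OF s(3) d(2)] by simp
  have "card (set ?ss) = length ?ss" using distinct_flatD[OF d(1)] by (metis distinct_card distinct_map)
  then have "length ?ss = 3" using card_segs[OF d(1) s(3) d(2)] k by simp
  then have "length s2 + length s3 = 1" by simp
  then consider p e where "s2 = [(p, e)]" "s3 = []" | p e where "s2 = []" "s3 = [(p, e)]"
    by (cases s2; cases s3) auto
  then show False
  proof cases
    case 1
    then obtain q r where qr: "R1 = p # e @ [q]" "R2 = [r]" using s(1,2) by (metis append_Cons append_Nil append_assoc flat_simps(1,2))
    then have "X = {p, q, r}" "set e \<inter> X = {}" using X s(3) 1 by auto
    then show False using core[OF R[unfolded qr(2)] qr(1)] t(4,5) uv len by blast
  next
    case 2
    then obtain q r where qr: "R2 = p # e @ [q]" "R1 = [r]" using s(1,2) by (metis append_Cons append_Nil append_assoc flat_simps(1,2))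
    then have "X = {p, q, r}" "set e \<inter> X = {}" using X s(3) 2 by auto
    then show False using core[OF pair_swap[OF R, unfolded qr(2)] qr(1)] t(4,5) adj_sym[OF uv] len by blast
  qed
qed

text \<open>Any edge off any longest cycle is a longest path there, so its ends are twins. A longest
  cycle rerouted to miss another edge thus yields adjacencies of that edge.\<close>

lemma edge_outside:
  assumes lon: "longest C" and e: "opath C [x, y]"
  shows "config C [x, y] (cnbrs C x)" "card (cnbrs C x) + 1 = \<delta>" "cnbrs C y = cnbrs C x"
    "\<And>w. w \<noteq> x \<Longrightarrow> w \<noteq> y \<Longrightarrow> adj x w \<longleftrightarrow> adj y w"
proof -
  have g: "gmax (length [x, y])" using no_three by (simp add: gmax_def numeral_2_eq_2)
  note gp = gmax_path[OF g lon e, simplified, of x]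
  have xy: "adj x y" using e by (simp add: opath_def chain_Cons)
  show c: "config C [x, y] (cnbrs C x)" using gp(1) by simp
  show "card (cnbrs C x) + 1 = \<delta>" using gp(2) by simp
  show eq: "cnbrs C y = cnbrs C x" using gp(3)[of y] by simp
  fix w assume w: "w \<noteq> x" "w \<noteq> y"
  have "adj z w \<longleftrightarrow> w \<in> cnbrs C x" if "z \<in> {x, y}" for z
    using configD(8)[OF c, of z w] that w eq by (auto simp: cnbrs_def)
  then show "adj x w \<longleftrightarrow> adj y w" by simp
qed

section \<open>Single edges outside a longest cycle\<close>

lemma edge_card:
  assumes c: "config C P X" and k: "length P = 2"
  shows "card X + 1 = \<delta>" "3 \<le> card X" "gmax (length P)" "card V \<le> 3 * card X + 5"
proof -
  show g: "gmax (length P)" using no_three k by (simp add: gmax_def)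
  have m: "maxpath C P" by (rule gmax_maxpath[OF g configD(1,2)[OF c]])
  have "hd P \<in> set P" using k by (cases P) auto
  then have X: "X = cnbrs C (hd P)" using config_cnbrs[OF g _ c] k by simp
  show *: "card X + 1 = \<delta>" "3 \<le> card X" using outside_path(2,3)[OF m _ X] k by simp_all
  show "card V \<le> 3 * card X + 5" using order * by simp
qed

text \<open>\<open>P\<close>, \<open>X\<close> and two inner vertices per segment make 3 * card X +
  2 of at most 3 * card X + 5 vertices.\<close>

lemma seg_excess:
  assumes c: "config (flat ss) P X" and k: "length P = 2" and sg: "segs X ss" and T: "T \<subseteq> set ss"
  shows "(\<Sum>t\<in>T. length (snd t) - 2) + card (V - set (flat ss) - set P) \<le> 3"
  using excess[OF c sg T] edge_card(4)[OF c k] k by simp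

text \<open>A link with an inner vertex would cost at least five spare vertices, and there are only
  three.\<close>

lemma link_direct:
  assumes c: "config (flat ss) P X" and k: "length P = 2" and sg: "segs X ss"
    and t: "t \<in> set ss" "t' \<in> set ss" "t \<noteq> t'" "u \<in> set (snd t)" "v \<in> set (snd t')"
    and L: "link (flat ss) P u L v"
  shows "L = []"
proof -
  have "2 + card X * 3 + 3 * length L + 2 \<le> card V" using link_excess(2)[OF c sg t L] k by simp
  then have "length L = 0" using edge_card(4)[OF c k] by linarith
  then show ?thesis by simp
qed

section \<open>Edges from the first vertex of one segment to the third vertex of another\<close>

lemma pair_small:
  assumes p: "pair P X R1 b R2 a" and k: "length P = 2"
  shows "2 \<le> length a" "2 \<le> length b" "length a + length b \<le> 7"
proof -
  show l: "2 \<le> length b" "2 \<le> length a" using pair_gap[OF p] pair_gap[OF pair_swap[OF p]] k by auto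
  obtain s2 s3 where s: "segs X ((last R2, a) # s2 @ (last R1, b) # s3)"
    "config (flat ((last R2, a) # s2 @ (last R1, b) # s3)) P X"
    using pair_segs[OF p] by blast
  have "last R2 \<noteq> last R1" using pair_ends[OF p] by simp
  then show "length a + length b \<le> 7"
    using seg_excess[OF s(2) k s(1), of "{(last R2, a), (last R1, b)}"] l by simp
qed

text \<open>The edge between \<open>a1\<close> and \<open>b3\<close> lets the cycle skip
  \<open>b1\<close>, \<open>b2\<close> and take in \<open>P\<close> instead, without a change of
  length.\<close>

lemma twin_cycle:
  assumes k: "length P = 2" and p: "pair P X R1 (b1 # b2 # b3 # bs) R2 (a1 # as)" and e: "adj a1 b3"
  shows "\<exists>P'. set P' = set P \<and> longest (R2 @ P' @ rev R1 @ rev as @ a1 # b3 # bs) \<and>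
    opath (R2 @ P' @ rev R1 @ rev as @ a1 # b3 # bs) [b1, b2]"
proof -
  let ?W = "rev (a1 # as) @ b3 # bs"
  note ch = pair_chains[OF p]
  have c: "config (R1 @ (b1 # b2 # b3 # bs) @ R2 @ (a1 # as)) P X" using p by (simp add: pair_def)
  have ab: "chain (a1 # as)" "chain (b3 # bs)" "adj (last (a1 # as)) (hd R1)" "adj (last (b3 # bs)) (hd R2)" "adj b1 b2"
    using ch(3,4,6,8) by (auto simp: chain_Cons)
  have W: "chain ?W" unfolding chain_append[of "rev (a1 # as)"] chain_rev using ab(1,2) e by simp
  have hdW: "hd ?W = last (a1 # as)" by (cases as rule: rev_cases) simp_all
  have dis: "distinct (R1 @ (b1 # b2 # b3 # bs) @ R2 @ (a1 # as))" by (rule pair_ends(1)[OF p])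
  have "\<exists>Q. set Q = set P \<and> length Q = length P \<and> cyc (R2 @ Q @ rev R1 @ ?W)"
  proof (rule pair_reroute_cross[OF p _ W])
    show "distinct ?W" "set ?W \<subseteq> V - set R1 - set R2 - set P" using dis ch(9) by auto
    show "adj (hd R1) (hd ?W)" unfolding hdW by (rule adj_sym[OF ab(3)])
    show "adj (last ?W) (hd R2)" using ab(4) by simp
  qed simp
  then obtain Q where Q: "set Q = set P" "length Q = length P" "cyc (R2 @ Q @ rev R1 @ rev as @ a1 # b3 # bs)"
    by auto
  have "longest (R2 @ Q @ rev R1 @ rev as @ a1 # b3 # bs)"
    by (rule longest_same_length[OF configD(1)[OF c] Q(3)]) (use Q(2) k in simp)
  moreover have "opath (R2 @ Q @ rev R1 @ rev as @ a1 # b3 # bs) [b1, b2]"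
    unfolding opath_def using dis ch(9) ab(5) Q(1) by (auto simp: chain_Cons)
  ultimately show ?thesis using Q(1) by blast
qed

lemma twins:
  assumes k: "length P = 2" and p: "pair P X R1 (b1 # b2 # b3 # bs) R2 (a1 # as)" and e: "adj a1 b3"
    and w: "w \<noteq> b1" "w \<noteq> b2"
  shows "adj b1 w \<longleftrightarrow> adj b2 w"
  using twin_cycle[OF k p e] edge_outside(4)[OF _ _ w] by blast

text \<open>The twins \<open>b1\<close>, \<open>b2\<close> have a set \<open>E\<close> of
  \<open>card X\<close> neighbours on the rerouted cycle, with gaps of at least two. Its elements
  are \<open>b3\<close>, vertices of \<open>X\<close> other than \<open>hd R2\<close>, and perhaps
  the third vertex of the segment of \<open>a1\<close>, which excludes \<open>hd R1\<close>. If
  \<open>last R2\<close> differs from \<open>hd R2\<close>, the number is reached only with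
  \<open>last R2\<close> in \<open>E\<close>. Then \<open>P\<close> can take the place between
  \<open>R1\<close> and \<open>R2\<close>, while \<open>b1\<close>, \<open>b2\<close>,
  \<open>b3\<close> are inserted between \<open>R2\<close> and \<open>a1\<close>; the result is
  longer.\<close>

lemma crossed_ends:
  assumes k: "length P = 2" and p: "pair P X R1 (b1 # b2 # b3 # bs) R2 (a1 # as)" and e: "adj a1 b3"
    and la: "3 \<le> length (a1 # as)"
  shows "hd R2 = last R2"
proof (rule ccontr)
  assume neq: "hd R2 \<noteq> last R2"
  let ?a = "a1 # as" and ?b = "b1 # b2 # b3 # bs"
  let ?C = "R1 @ ?b @ R2 @ ?a"
  have c: "config ?C P X" and ne: "R1 \<noteq> []" "R2 \<noteq> []" using p by (auto simp: pair_def)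
  have EX: "hd R1 \<in> X" "last R1 \<in> X" "hd R2 \<in> X" "last R2 \<in> X" "set ?a \<inter> X = {}" "set ?b \<inter> X = {}"
    using p by (auto simp: pair_def)
  obtain P' where P': "set P' = set P" "longest (R2 @ P' @ rev R1 @ rev as @ a1 # b3 # bs)"
    "opath (R2 @ P' @ rev R1 @ rev as @ a1 # b3 # bs) [b1, b2]"
    using twin_cycle[OF k p e] by blast
  let ?D = "R2 @ P' @ rev R1 @ rev as @ a1 # b3 # bs"
  define E where "E = cnbrs ?D b1"
  note eo = edge_outside[OF P'(2,3), folded E_def]
  have cE: "card E = card X" using eo(2) edge_card(1)[OF c k] by simp
  have bD: "b1 \<notin> set ?D" "b2 \<notin> set ?D" using P'(3) by (auto simp: opath_def)
  have cC: "cyc ?C" using configD(1)[OF c] by (simp add: longest_def)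
  have adjb: "adj b1 b2" "adj b2 b3" using cC by (auto simp: cyc_def chain_append chain_Cons)
  have b3E: "b3 \<in> E" using eo(3) adjb(2) by (auto simp: cnbrs_def)
  have sz: "length ?a + length ?b \<le> 7" using pair_small(3)[OF p k] .
  \<comment> \<open>The edge between \<open>b1\<close> and \<open>b2\<close> can itself be inserted
    between two vertices of \<open>E\<close>.\<close>
  have far: "2 \<le> length s" if "nxt ?D x s y" "x \<in> E" "y \<in> E" for x s y
  proof -
    have "joins [b1, b2] x y" using that(2,3) eo(3) adj_sym by (auto simp: joins_def cnbrs_def E_def)
    then show ?thesis using gap_nxt[OF that(1) P'(3)] by simp
  qed
  have rot: "nxt ?D x s y" if "?D = W @ x # s @ y # r" for x s y W r
    using P'(2) longest_rotate[of W "x # s @ y # r"] that unfolding nxt_def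
    by (intro exI[of _ "r @ W"]) auto
  have hdR2: "hd R2 \<notin> E"
  proof
    assume h: "hd R2 \<in> E"
    obtain y r2 where R2: "R2 = y # r2" using ne by (cases R2) auto
    have "longest (b3 # bs @ y # (r2 @ P' @ rev R1 @ rev as @ [a1]))"
      using P'(2) longest_rotate[of "R2 @ P' @ rev R1 @ rev as @ [a1]" "b3 # bs"] by (simp add: R2)
    then have "nxt ?D b3 bs y" unfolding nxt_def
      by (intro exI[of _ "r2 @ P' @ rev R1 @ rev as @ [a1]"]) (auto simp: R2)
    from far[OF this b3E] h have "2 \<le> length bs" by (simp add: R2)
    then show False using sz la by simp
  qed
  have bsE: "w \<notin> E" if w: "w \<in> set bs" for w
  proof
    assume "w \<in> E"
    have "length bs \<le> 1" using sz la by simp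
    then have "bs = [w]" using w by (cases bs) auto
    then have "nxt ?D b3 [] w" using rot[of "R2 @ P' @ rev R1 @ rev as @ [a1]" b3 "[]" w "[]"] by simp
    from far[OF this b3E \<open>w \<in> E\<close>] show False by simp
  qed
  have hdR1: "hd R1 \<notin> E" if "?a ! 2 \<in> E"
  proof
    assume h: "hd R1 \<in> E"
    obtain a2 a3 as' where as: "as = a2 # a3 # as'" using la by (auto simp: numeral_eq_Suc Suc_le_length_iff)
    obtain x r1 where R1: "R1 = x # r1" using ne by (cases R1) auto
    have "nxt ?D x (rev as') a3"
      using rot[of "R2 @ P' @ rev r1" x "rev as'" a3 "a2 # a1 # b3 # bs"] by (simp add: R1 as)
    from far[OF this] h that have "2 \<le> length as'" by (simp add: R1 as)
    then show False using sz by (simp add: as)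
  qed
  obtain s2 s3 where s: "segs X ((last R2, ?a) # s2 @ (last R1, ?b) # s3)"
    "config (flat ((last R2, ?a) # s2 @ (last R1, ?b) # s3)) P X"
    "R1 = flat s2 @ [last R1]" "R2 = flat s3 @ [last R2]"
    using pair_segs[OF p] by blast
  let ?ss = "(last R2, ?a) # s2 @ (last R1, ?b) # s3"
  have "set R1 = insert (last R1) (set (flat s2))" "set R2 = insert (last R2) (set (flat s3))"
    using arg_cong[OF s(3), of set] arg_cong[OF s(4), of set] by simp_all
  then have setC: "set (flat ?ss) = set ?C" by auto
  have inner: "w \<in> X \<or> w = b3 \<or> w \<in> set bs \<or> w = ?a ! 2" if w: "w \<in> E" for w
  proof (rule ccontr)
    assume no: "\<not> ?thesis"
    have aw: "adj b1 w" "adj b2 w" "w \<in> set ?D" using w eo(3) by (auto simp: E_def cnbrs_def)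
    have wb: "w \<noteq> b1" "w \<noteq> b2" using aw bD by auto
    have "w \<notin> set P"
    proof
      assume "w \<in> set P"
      then have "b1 \<in> set P \<union> X" using configD(8)[OF c _ adj_sym[OF aw(1)]] by blast
      then show False using EX(6) P'(1) bD by auto
    qed
    then have "w \<in> set ?C" using aw(3) P'(1) by auto
    then obtain t where t: "t \<in> set ?ss" "w \<in> set (snd t)" using in_seg[OF s(1), of w] no setC by blast
    \<comment> \<open>The bounds for the edges from \<open>w\<close> to \<open>b1\<close> and
      \<open>b2\<close>, together with at most 7 vertices in both segments, leave only the third
      position.\<close>
    have gen: "w = g ! 2 \<and> length g + length ?b = 7" if q: "pair P X S1 ?b S2 g" "w \<in> set g" for S1 S2 g
    proof -
      obtain g1 g2 where g: "g = g1 @ w # g2" using q(2) by (meson split_list)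
      have q1: "pair P X S1 ([] @ b1 # (b2 # b3 # bs)) S2 (g1 @ w # g2)" using q g by simp
      have q2: "pair P X S1 ([b1] @ b2 # (b3 # bs)) S2 (g1 @ w # g2)" using q g by simp
      have "2 \<le> length g1" using pair_link(1)[OF q1, of "[]"] aw(1) adj_sym k by (simp add: link_Nil)
      moreover have "2 \<le> length g2 + (1 + length bs)"
        using pair_link(2)[OF q2, of "[]"] aw(2) adj_sym k by (simp add: link_Nil)
      moreover have "length g + length ?b \<le> 7" using pair_small(3)[OF q(1) k] .
      moreover have "length g = length g1 + length g2 + 1" using g by simp
      ultimately have "length g1 = 2" "length g + length ?b = 7" by simp_all
      moreover have "w = g ! length g1" by (simp add: g)
      ultimately show ?thesis by simp
    qed
    have "t \<noteq> (last R2, ?a)" using gen[OF p] t(2) no by auto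
    moreover have "t \<noteq> (last R1, ?b)" using t(2) no wb by auto
    ultimately have t3: "t \<noteq> (last R2, ?a)" "t \<noteq> (last R1, ?b)" .
    obtain S1 S2 where S: "pair P X S1 ?b S2 (snd t)"
      using segs_pair[OF s(2,1) t(1) _ t3(2)] by auto
    \<comment> \<open>\<open>?b\<close> and this further segment already use all three spare
      vertices, but \<open>?a\<close> contains a spare vertex as well.\<close>
    have "length (snd t) + length ?b = 7" using gen[OF S t(2)] by simp
    moreover have "(\<Sum>t\<in>{t, (last R2, ?a), (last R1, ?b)}. length (snd t) - 2) \<le> 3"
      using seg_excess[OF s(2) k s(1), of "{t, (last R2, ?a), (last R1, ?b)}"] t(1) by simp
    moreover have "last R2 \<noteq> last R1" using pair_ends[OF p] by simp
    ultimately show False using t3 la by simp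
  qed
  have sub: "E \<subseteq> insert b3 (X - {hd R2}) \<union> {?a ! 2}" using inner bsE hdR2 by blast
  have lastR2: "last R2 \<in> E"
  proof (rule ccontr)
    assume l: "last R2 \<notin> E"
    have finX: "finite X" by (rule configD(7)[OF c])
    have h3: "hd R1 \<noteq> hd R2" "hd R1 \<noteq> last R2" using pair_ends[OF p] by auto
    have cX: "card (X - {hd R2, last R2}) = card X - 2"
      using EX(3,4) neq finX by (simp add: card_Diff_subset)
    have "3 \<le> card X" using edge_card(2)[OF c k] .
    show False
    proof (cases "?a ! 2 \<in> E")
      case False
      have "E \<subseteq> insert b3 (X - {hd R2, last R2})"
      proof
        fix w assume "w \<in> E"
        moreover from this have "w \<noteq> ?a ! 2" "w \<noteq> last R2" using False l by metis+
        ultimately show "w \<in> insert b3 (X - {hd R2, last R2})" using sub by blast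
      qed
      then have "card E \<le> card (insert b3 (X - {hd R2, last R2}))" using finX by (intro card_mono) auto
      also have "\<dots> \<le> Suc (card (X - {hd R2, last R2}))" using finX by (simp add: card_insert_if)
      finally show False using cX cE \<open>3 \<le> card X\<close> by linarith
    next
      case True
      have "E \<subseteq> insert (?a ! 2) (insert b3 (X - {hd R1, hd R2, last R2}))"
      proof
        fix w assume "w \<in> E"
        moreover from this have "w \<noteq> hd R1" "w \<noteq> last R2" using hdR1[OF True] l by metis+
        ultimately show "w \<in> insert (?a ! 2) (insert b3 (X - {hd R1, hd R2, last R2}))" using sub by blast
      qed
      then have "card E \<le> card (insert (?a ! 2) (insert b3 (X - {hd R1, hd R2, last R2})))"
        using finX by (intro card_mono) auto
      also have "\<dots> \<le> Suc (Suc (card (X - {hd R1, hd R2, last R2})))"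
        using finX by (simp add: card_insert_if)
      also have "card (X - {hd R1, hd R2, last R2}) = card X - 3"
        using EX(1,3,4) neq h3 finX by (simp add: card_Diff_subset)
      finally show False using cE \<open>3 \<le> card X\<close> by linarith
    qed
  qed
  have "\<exists>Q. set Q = set P \<and> length Q = length P \<and> cyc (R1 @ Q @ R2 @ [b1, b2, b3] @ ?a)"
  proof (rule pair_reroute[OF p])
    show "chain ([b1, b2, b3] @ ?a)"
      unfolding chain_append using adjb e pair_chains(3)[OF p] adj_sym by (simp add: chain_Cons)
    show "distinct ([b1, b2, b3] @ ?a)" "set ([b1, b2, b3] @ ?a) \<subseteq> V - set R1 - set R2 - set P"
      using pair_ends(1)[OF p] pair_chains(9)[OF p] by auto
    show "adj (last R2) (hd ([b1, b2, b3] @ ?a))" using lastR2 adj_sym by (auto simp: E_def cnbrs_def)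
    show "adj (last ([b1, b2, b3] @ ?a)) (hd R1)" using pair_chains(6)[OF p] by simp
  qed simp
  then obtain Q where Q: "length Q = length P" "cyc (R1 @ Q @ R2 @ [b1, b2, b3] @ ?a)" by blast
  have "length (R1 @ Q @ R2 @ [b1, b2, b3] @ ?a) \<le> length ?C" by (rule longestD(2)[OF configD(1)[OF c] Q(2)])
  then show False using Q(1) k sz la by simp
qed

text \<open>The contradiction is to 3-connectedness: \<open>{p, q}\<close> separates \<open>d1, d2, d3\<close> from the rest.\<close>

lemma three_blocks:
  assumes k: "length P = 2" and pr: "pair P X (p # [d1, d2, d3] @ [q]) [b1, b2, b3] [r] [a1, a2, a3]"
    and X: "X = {p, q, r}" and V: "V \<subseteq> set [r, a1, a2, a3, p, d1, d2, d3, q, b1, b2, b3] \<union> set P"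
    and e: "adj a1 b3"
  shows False
proof -
  let ?C = "(p # [d1, d2, d3] @ [q]) @ [b1, b2, b3] @ [r] @ [a1, a2, a3]"
  have c: "config ?C P X" using pr by (simp add: pair_def)
  have g: "gmax (length P)" "2 \<le> length P" using edge_card(3)[OF c k] k by simp_all
  obtain x1 x2 where P: "P = [x1, x2]" using k by (auto simp: numeral_2_eq_2 length_Suc_conv)
  have cC: "cyc ?C" and lonC: "\<And>D. cyc D \<Longrightarrow> length D \<le> 12"
    using configD(1)[OF c] by (auto simp: longest_def)
  have dist: "distinct (?C @ P)" "set (?C @ P) \<subseteq> V" "chain P"
    using configD(2,5,6)[OF c] by (auto simp: opath_def)
  let ?all = "[p, d1, d2, d3, q, b1, b2, b3, r, a1, a2, a3, x1, x2]"
  have ne1: "distinct ?all" and inV: "set ?all \<subseteq> V" using dist by (simp_all add: P)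
  moreover from ne1 have "distinct (rev ?all)" by (simp only: distinct_rev)
  ultimately have ne: "distinct ?all" "distinct (rev ?all)" by simp_all
  have ch: "adj a1 a2" "adj a2 a3" "adj b1 b2" "adj b2 b3" "adj d1 d2" "adj d2 d3"
    "adj p d1" "adj d3 q" "adj r a1" "adj a3 p" "adj q b1" "adj b3 r" "adj x1 x2"
    using cC dist(3) by (auto simp: cyc_def chain_Cons P)
  note sym = this[THEN adj_sym]
  have Px: "adj x w" "adj w x" if "x \<in> set P" "w \<in> X" for x w
    using config_cnbrs[OF g c that(1)] that(2) adj_sym by (auto simp: cnbrs_def)
  have PX: "adj x1 p" "adj x1 q" "adj x1 r" "adj x2 p" "adj x2 q" "adj x2 r"
    "adj p x1" "adj q x1" "adj r x1" "adj p x2" "adj q x2" "adj r x2"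
    using Px by (simp_all add: P X)
  have no_cyc: False if "distinct D" "set D \<subseteq> set ?all" "13 \<le> length D" "chain D" "adj (last D) (hd D)" for D
  proof -
    have "cyc D" unfolding cyc_def using that inV by auto
    then show False using lonC[of D] that(3) by simp
  qed
  have r1: "\<not> adj r d1"
    by (rule notI, rule no_cyc[of "[p, x1, x2, r, d1, d2, d3, q, b1, b2, b3, a1, a2, a3]"])
      (use ne ch PX e[THEN adj_sym] in \<open>simp_all add: chain_Cons\<close>)
  have r2: "\<not> adj r d2"
    by (rule notI, rule no_cyc[of "[p, x1, x2, r, d2, d3, q, b1, b2, b3, a1, a2, a3]"])
      (use ne ch PX e[THEN adj_sym] in \<open>simp_all add: chain_Cons\<close>)
  have r3: "\<not> adj d3 r"
    by (rule notI, rule no_cyc[of "[p, d1, d2, d3, r, x1, x2, q, b1, b2, b3, a1, a2, a3]"])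
      (use ne ch PX e[THEN adj_sym] in \<open>simp_all add: chain_Cons\<close>)
  have tb: "adj b1 w \<longleftrightarrow> adj b2 w" if "w \<noteq> b1" "w \<noteq> b2" for w
    by (rule twins[OF k pr e that])
  have pr': "pair P X (rev (p # [d1, d2, d3] @ [q])) [a3, a2, a1] (rev [r]) [b3, b2, b1]"
    using pair_swap[OF pair_mirror[OF pr]] by simp
  have ta: "adj a3 w \<longleftrightarrow> adj a2 w" if "w \<noteq> a3" "w \<noteq> a2" for w
    by (rule twins[OF k pr' adj_sym[OF e] that])
  \<comment> \<open>The same cycle with other pairs of segments singled out. There the second
    connecting piece has different ends, so \<open>crossed_ends\<close> excludes edges from a first
    to a third vertex.\<close>
  have pd: "pair P X [p] [d1, d2, d3] (q # [b1, b2, b3] @ [r]) [a1, a2, a3]"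
    using pr ne by (simp add: pair_def X)
  have db: "pair P X [q] [b1, b2, b3] (r # [a1, a2, a3] @ [p]) [d1, d2, d3]"
  proof -
    have "longest ([p, d1, d2, d3] @ [q, b1, b2, b3, r, a1, a2, a3])" using configD(1)[OF c] by simp
    then have "longest ([q, b1, b2, b3, r, a1, a2, a3] @ [p, d1, d2, d3])" using longest_rotate by blast
    then have "longest ([q] @ [b1, b2, b3] @ (r # [a1, a2, a3] @ [p]) @ [d1, d2, d3])" by simp
    then have "config ([q] @ [b1, b2, b3] @ (r # [a1, a2, a3] @ [p]) @ [d1, d2, d3]) P X"
      by (rule config_cong[OF c]) auto
    then show ?thesis using ne by (simp add: pair_def X)
  qed
  have a1d3: "\<not> adj a1 d3" using crossed_ends[OF k pd] ne by auto
  have d1b3: "\<not> adj d1 b3" using crossed_ends[OF k db] ne by auto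
  have pos: "i + j = 2" if ij: "pair P X R1 b R2 a" "adj (a ! i) (b ! j)" "i < 3" "j < 3"
    "length a = 3" "length b = 3" for R1 R2 a b i j
  proof -
    have a: "a = take i a @ a ! i # drop (Suc i) a" and b: "b = take j b @ b ! j # drop (Suc j) b"
      using ij by (simp_all add: id_take_nth_drop)
    have "pair P X R1 (take j b @ b ! j # drop (Suc j) b) R2 (take i a @ a ! i # drop (Suc i) a)"
      using ij(1) a b by simp
    from pair_link[OF this, of "[]"] show ?thesis using ij by (simp add: link_Nil k)
  qed
  \<comment> \<open>Of the three edges whose positions add up to 2, one is excluded by
    \<open>crossed_ends\<close>; the twins \<open>a2\<close>, \<open>a3\<close> move the other two
    to positions with another sum.\<close>
  have ad: "\<not> adj ([a1, a2, a3] ! i) ([d1, d2, d3] ! j)" if "i < 3" "j < 3" for i j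
  proof
    assume ij: "adj ([a1, a2, a3] ! i) ([d1, d2, d3] ! j)"
    have s2: "i + j = 2" by (rule pos[OF pd ij that]) simp_all
    then consider "i = 0" "j = 2" | "i = 1" "j = 1" | "i = 2" "j = 0" by linarith
    then show False
    proof cases
      case 1 then show False using ij a1d3 by simp
    next
      case 2
      then have "adj ([a1, a2, a3] ! 2) ([d1, d2, d3] ! 1)" using ij ta[of d2] ne by simp
      from pos[OF pd this] show False by simp
    next
      case 3
      then have "adj ([a1, a2, a3] ! 1) ([d1, d2, d3] ! 0)" using ij ta[of d1] ne by simp
      from pos[OF pd this] show False by simp
    qed
  qed
  have db': "\<not> adj ([d1, d2, d3] ! i) ([b1, b2, b3] ! j)" if "i < 3" "j < 3" for i j
  proof
    assume ij: "adj ([d1, d2, d3] ! i) ([b1, b2, b3] ! j)"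
    have s2: "i + j = 2" by (rule pos[OF db ij that]) simp_all
    then consider "i = 0" "j = 2" | "i = 1" "j = 1" | "i = 2" "j = 0" by linarith
    then show False
    proof cases
      case 1 then show False using ij d1b3 by simp
    next
      case 2
      then have "adj ([d1, d2, d3] ! 1) ([b1, b2, b3] ! 0)" using ij tb[of d2] ne adj_commute by simp
      from pos[OF db this] show False by simp
    next
      case 3
      then have "adj ([d1, d2, d3] ! 2) ([b1, b2, b3] ! 1)" using ij tb[of d3] ne adj_commute by simp
      from pos[OF db this] show False by simp
    qed
  qed
  have idx: "\<exists>i<3. w = [x, y, z] ! i" if "w \<in> {x, y, z}" for w x y z :: 'a
  proof -
    have "w \<in> set [x, y, z]" using that by simp
    then obtain i where "i < length [x, y, z]" "w = [x, y, z] ! i" by (metis in_set_conv_nth)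
    then show ?thesis by (intro exI[of _ i]) simp
  qed
  have out: "w \<in> {d1, d2, d3} \<union> {p, q}" if u: "u \<in> {d1, d2, d3}" "adj u w" for u w
  proof (rule ccontr)
    assume no: "\<not> ?thesis"
    have "w \<notin> set P"
    proof
      assume "w \<in> set P"
      then have "u \<in> set P \<union> X" using configD(8)[OF c _ adj_sym[OF u(2)]] by blast
      then show False using u ne by (auto simp: X P)
    qed
    moreover have "w \<in> V" by (rule adj_V2[OF u(2)])
    ultimately have "w \<in> {r} \<union> {a1, a2, a3} \<union> {b1, b2, b3}" using no V by auto
    moreover have "w \<noteq> r" using u r1 r2 r3 adj_sym by blast
    moreover have "w \<notin> {a1, a2, a3}"
    proof
      assume "w \<in> {a1, a2, a3}"
      then obtain i where i: "i < 3" "w = [a1, a2, a3] ! i" using idx by blast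
      obtain j where j: "j < 3" "u = [d1, d2, d3] ! j" using idx[OF u(1)] by blast
      show False using ad[OF i(1) j(1)] u(2) i j adj_sym by blast
    qed
    moreover have "w \<notin> {b1, b2, b3}"
    proof
      assume "w \<in> {b1, b2, b3}"
      then obtain i where i: "i < 3" "w = [b1, b2, b3] ! i" using idx by blast
      obtain j where j: "j < 3" "u = [d1, d2, d3] ! j" using idx[OF u(1)] by blast
      show False using db'[OF j(1) i(1)] u(2) i j by blast
    qed
    ultimately show False by blast
  qed
  have "{d1, d2, d3} \<union> {p, q} = V"
  proof (rule conn3[of "{p, q}" "{d1, d2, d3}"])
    show "{p, q} \<subseteq> V" "{d1, d2, d3} \<subseteq> V - {p, q}" using inV ne by auto
    show "card {p, q} < 3" by (simp add: card_insert_if)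
  qed (use out in auto)
  then have "r \<in> {d1, d2, d3} \<union> {p, q}" using inV by auto
  then show False using ne by auto
qed

text \<open>If a further segment \<open>d\<close> has only two inner vertices, it is completely
  joined to \<open>X\<close>. Then \<open>P\<close> leads from the vertex \<open>y\<close> in front
  of \<open>d\<close> to \<open>r\<close>, from \<open>r\<close> the cycle enters \<open>d\<close>,
  and later \<open>b1\<close>, \<open>b2\<close>, \<open>b3\<close> lead on to \<open>a1\<close>;
  only \<open>bs\<close> is lost, at most one vertex. Otherwise every segment has a spare vertex, so
  there are just three segments, with three inner vertices each.\<close>

lemma single_end:
  assumes k: "length P = 2" and p: "pair P X R1 (b1 # b2 # b3 # bs) [r] (a1 # as)" and e: "adj a1 b3"
    and la: "3 \<le> length (a1 # as)"
  shows False
proof -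
  let ?a = "a1 # as" and ?b = "b1 # b2 # b3 # bs"
  let ?C = "R1 @ ?b @ [r] @ ?a"
  have c: "config ?C P X" and ne: "R1 \<noteq> []" using p by (auto simp: pair_def)
  have g: "gmax (length P)" "2 \<le> length P" "3 \<le> card X" using edge_card[OF c k] k by simp_all
  obtain s2 s3 where s: "R1 = flat s2 @ [last R1]" "[r] = flat s3 @ [last [r]]"
    "segs X ((last [r], ?a) # s2 @ (last R1, ?b) # s3)"
    "config (flat ((last [r], ?a) # s2 @ (last R1, ?b) # s3)) P X"
    using pair_segs[OF p] by blast
  define q where "q = last R1"
  have s3: "s3 = []" using s(2) by simp
  let ?ss = "(r, ?a) # s2 @ [(q, ?b)]"
  have R1: "R1 = flat s2 @ [q]" using s(1) by (simp only: q_def)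
  have sg: "segs X ?ss" and css: "config (flat ?ss) P X" using s(3,4) by (simp_all add: s3 q_def)
  have d: "distinct (flat ?ss)" "X \<subseteq> set (flat ?ss)" using configD[OF css] by auto
  have sz: "length ?a + length ?b \<le> 7" using pair_small(3)[OF p k] .
  have rq: "r \<noteq> q" using pair_ends(3)[OF p] by (simp add: q_def)
  have dfst: "distinct (map fst ?ss)" by (rule distinct_flatD[OF d(1)])
  have len4: "length (snd t) \<le> 4" if t: "t \<in> set ?ss" for t
  proof (cases "t = (r, ?a) \<or> t = (q, ?b)")
    case True
    then show ?thesis using sz la by auto
  next
    case False
    then have "(\<Sum>t\<in>{t, (r, ?a), (q, ?b)}. length (snd t) - 2) \<le> 3"
      using seg_excess[OF css k sg, of "{t, (r, ?a), (q, ?b)}"] t by simp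
    then show ?thesis using False rq la by simp
  qed
  have ge2: "2 \<le> length (snd t)" if "t \<in> set ?ss" for t using segs_length[OF css sg that] k by simp
  show False
  proof (cases "\<exists>t\<in>set s2. length (snd t) = 2")
    case True
    then obtain y d u1 u2 where t: "s2 = u1 @ (y, d) # u2" "length d = 2" by (metis snd_conv split_list surj_pair)
    have dX: "adj w x" if "w \<in> set d" "x \<in> X" for w x
      by (rule short_seg_complete[OF g(1,2) css sg, of "(y, d)"])
        (use that t len4 k in auto)
    have inX: "y \<in> X" "r \<in> X" using sg t by auto
    have dne: "d \<noteq> []" using t(2) by auto
    have R1': "R1 = flat u1 @ y # d @ flat u2 @ [q]" using R1 t(1) by simp
    have "y \<noteq> r" using configD(5)[OF c] R1' by auto
    then have "joins P y r" using configD(9)[OF c] inX by blast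
    let ?A = "flat u1 @ [y]" and ?B = "d @ flat u2 @ [q]" and ?W = "[b1, b2, b3] @ ?a"
    note ch = pair_chains[OF p, unfolded R1']
    have A: "chain ?A" "chain ?B" "hd ?A = hd (flat u1 @ y # d @ flat u2 @ [q])"
      using ch(1) by (auto simp: chain_append chain_Cons hd_append split: if_splits)
    have "chain ?W" unfolding chain_append using ch(3,4) e adj_sym by (simp add: chain_Cons)
    then have BW: "chain (?B @ ?W)" unfolding chain_append[of ?B] using A(2) ch(7) by simp
    have "\<exists>Q. set Q = set P \<and> length Q = length P \<and> cyc (?A @ Q @ [r] @ ?B @ ?W)"
    proof (rule cyc_concat[OF configD(2)[OF c] _ _ _ A(1) _ _ BW])
      show "joins P (last ?A) (hd [r])" using \<open>joins P y r\<close> by simp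
      show "adj (last [r]) (hd (?B @ ?W))" using dX[of "hd d" r] dne inX adj_sym by simp
      show "adj (last (?B @ ?W)) (hd ?A)" unfolding A(3) using ch(6) by simp
      show "distinct (?A @ [r] @ ?B @ ?W)" "set (?A @ [r] @ ?B @ ?W) \<subseteq> V - set P"
        using pair_ends(1)[OF p] ch(9) unfolding R1' by auto
    qed (simp_all add: chain_Cons)
    then obtain Q where Q: "length Q = length P" "cyc (?A @ Q @ [r] @ ?B @ ?W)" by blast
    from longestD(2)[OF configD(1)[OF c] Q(2)] show False using Q(1) k sz la by (simp add: R1')
  next
    case False
    have ge3: "1 \<le> length (snd t) - 2" if "t \<in> set ?ss" for t
    proof -
      have "t = (r, ?a) \<or> t = (q, ?b) \<or> length (snd t) \<noteq> 2" using that False by auto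
      then show ?thesis using ge2[OF that] la by auto
    qed
    have cs: "card (set ?ss) = card X" using card_segs[OF d(1) sg d(2)] .
    have "card (set ?ss) \<le> (\<Sum>t\<in>set ?ss. length (snd t) - 2)"
      using sum_mono[of "set ?ss" "\<lambda>_. 1" "\<lambda>t. length (snd t) - 2"] ge3 by simp
    moreover have ex: "(\<Sum>t\<in>set ?ss. length (snd t) - 2) + card (V - set (flat ?ss) - set P) \<le> 3"
      by (rule seg_excess[OF css k sg order_refl])
    ultimately have "card (set ?ss) = 3" using cs g(3) by linarith
    moreover have "card (set ?ss) = length ?ss" using dfst by (metis distinct_card distinct_map)
    ultimately have "length s2 = 1" by simp
    then obtain y e' where s2: "s2 = [(y, e')]" by (auto simp: length_Suc_conv)
    have dn: "(r, ?a) \<noteq> (y, e')" "(r, ?a) \<noteq> (q, ?b)" "(y, e') \<noteq> (q, ?b)" using dfst s2 by auto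
    define A where "A = length ?a - 2"
    define B where "B = length ?b - 2"
    define D where "D = length e' - 2"
    define N where "N = card (V - set (flat ?ss) - set P)"
    have "(\<Sum>t\<in>set ?ss. length (snd t) - 2) = A + D + B"
      using dn s2 unfolding A_def B_def D_def by simp
    then have "A + D + B + N \<le> 3" using ex unfolding N_def by linarith
    moreover have "1 \<le> A" "1 \<le> B" "1 \<le> D"
      using ge3[of "(r, ?a)"] ge3[of "(q, ?b)"] ge3[of "(y, e')"] s2 by (simp_all add: A_def B_def D_def)
    ultimately have "A = 1" "B = 1" "D = 1" "N = 0" by linarith+
    then have l3: "length ?a = 3" "length e' = 3" "length ?b = 3" "card (V - set (flat ?ss) - set P) = 0"
      unfolding A_def B_def D_def N_def by simp_all
    obtain a2 a3 where a: "as = [a2, a3]" using l3(1) by (auto simp: numeral_3_eq_3 length_Suc_conv)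
    obtain d1 d2 d3 where d': "e' = [d1, d2, d3]" using l3(2) by (auto simp: numeral_3_eq_3 length_Suc_conv)
    have bs: "bs = []" using l3(3) by simp
    have "X = fst ` set ?ss" using fst_segs[OF sg d(2)] by simp
    then have X: "X = {y, q, r}" using s2 by auto
    have "V \<subseteq> set (flat ?ss) \<union> set P" using l3(4) finV by auto
    then have V: "V \<subseteq> set [r, a1, a2, a3, y, d1, d2, d3, q, b1, b2, b3] \<union> set P"
      by (simp add: s2 a d' bs)
    have "pair P X (y # [d1, d2, d3] @ [q]) [b1, b2, b3] [r] [a1, a2, a3]"
      using p R1 by (simp add: s2 a d' bs)
    then show False by (rule three_blocks[OF k _ X V e])
  qed
qed

lemma no_first_third:
  assumes k: "length P = 2" and p: "pair P X R1 b R2 a" and l: "3 \<le> length a" "3 \<le> length b"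
  shows "\<not> adj (hd a) (b ! 2)"
proof
  assume e: "adj (hd a) (b ! 2)"
  obtain a1 as where a: "a = a1 # as" using l by (cases a) auto
  obtain b1 b2 b3 bs where b: "b = b1 # b2 # b3 # bs" using l by (auto simp: numeral_3_eq_3 Suc_le_length_iff)
  have e': "adj a1 b3" using e by (simp add: a b)
  have h: "hd R2 = last R2" using crossed_ends[OF k p[unfolded a b] e'] l by (simp add: a)
  moreover have "R2 \<noteq> []" "distinct R2" using p pair_ends(1)[OF p] by (auto simp: pair_def)
  ultimately obtain r where r: "R2 = [r]" by (cases R2) (auto split: if_splits)
  show False using single_end[OF k p[unfolded a b r] e'] l by (simp add: a)
qed

section \<open>Classification of the edges between segments\<close>

lemma link_type_43:
  assumes k: "length P = 2" and p: "pair P X R1 b R2 a" and l: "length a = 4" "length b = 3"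
    and uv: "u \<in> set a" "v \<in> set b" "adj u v"
  shows "v = b ! 1"
proof -
  obtain a' a'' where a': "a = a' @ u # a''" using uv(1) by (meson split_list)
  obtain b' b'' where b': "b = b' @ v # b''" using uv(2) by (meson split_list)
  have pl: "2 \<le> length a' + length b'" "2 \<le> length a'' + length b''"
    using pair_link[OF p[unfolded a' b'], of "[]"] uv(3) k by (simp_all add: link_Nil)
  obtain a0 a1 a2 a3 where a: "a = [a0, a1, a2, a3]" using l(1) by (auto simp: numeral_eq_Suc length_Suc_conv)
  obtain b0 b1 b2 where b: "b = [b0, b1, b2]" using l(2) by (auto simp: numeral_eq_Suc length_Suc_conv)
  have ij: "u = a ! length a'" "v = b ! length b'" by (simp_all add: a' b')
  have la: "length a' + length a'' = 3" "length b' + length b'' = 2" using l a' b' by simp_all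
  \<comment> \<open>\<open>no_first_third\<close> in both orders of the segments and both directions
    of the cycle. With the position bounds \<open>pl\<close> this leaves only the middle vertex of
    \<open>b\<close>.\<close>
  have n: "\<not> adj a0 b2" "\<not> adj b0 a2" "\<not> adj a3 b0" "\<not> adj b2 a1"
    using no_first_third[OF k p] no_first_third[OF k pair_swap[OF p]]
      no_first_third[OF k pair_mirror[OF p]] no_first_third[OF k pair_swap[OF pair_mirror[OF p]]] l
    by (simp_all add: a b)
  have "length b' \<noteq> 0"
  proof
    assume z: "length b' = 0"
    then have "length a' = 2 \<or> length a' = 3" using pl la by linarith
    then show False using uv(3) n adj_sym z unfolding ij by (auto simp: a b)
  qed
  moreover have "length b' \<noteq> 2"
  proof
    assume z: "length b' = 2"
    then have "length a' = 0 \<or> length a' = 1" using pl la by linarith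
    then show False using uv(3) n adj_sym z unfolding ij by (auto simp: a b)
  qed
  ultimately have "length b' = 1" using la by linarith
  then show ?thesis using ij by simp
qed

lemma link_type_33:
  assumes k: "length P = 2" and p: "pair P X R1 b R2 a" and l: "length a = 3" "length b = 3"
    and uv: "u \<in> set a" "v \<in> set b" "adj u v"
  shows "u = a ! 1" "v = b ! 1"
proof -
  obtain a' a'' where a': "a = a' @ u # a''" using uv(1) by (meson split_list)
  obtain b' b'' where b': "b = b' @ v # b''" using uv(2) by (meson split_list)
  have pl: "2 \<le> length a' + length b'" "2 \<le> length a'' + length b''"
    using pair_link[OF p[unfolded a' b'], of "[]"] uv(3) k by (simp_all add: link_Nil)
  obtain a0 a1 a2 where a: "a = [a0, a1, a2]" using l(1) by (auto simp: numeral_eq_Suc length_Suc_conv)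
  obtain b0 b1 b2 where b: "b = [b0, b1, b2]" using l(2) by (auto simp: numeral_eq_Suc length_Suc_conv)
  have ij: "u = a ! length a'" "v = b ! length b'" by (simp_all add: a' b')
  have la: "length a' + length a'' = 2" "length b' + length b'' = 2" using l a' b' by simp_all
  have n: "\<not> adj a0 b2" "\<not> adj b0 a2"
    using no_first_third[OF k p] no_first_third[OF k pair_swap[OF p]] l by (simp_all add: a b)
  have "length a' + length b' = 2" using pl la by linarith
  then consider "length a' = 0" "length b' = 2" | "length a' = 1" "length b' = 1" | "length a' = 2" "length b' = 0"
    by linarith
  then have "length a' = 1 \<and> length b' = 1"
    using uv(3) n adj_sym unfolding ij by cases (auto simp: a b)
  then show "u = a ! 1" "v = b ! 1" using ij by simp_all
qed

text \<open>By \<open>short_seg\<close> two vertices lie on either side of \<open>u\<close>, and the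
  bound 7 for both segments leaves no room for more.\<close>

lemma link_type_2:
  assumes k: "length P = 2" and p: "pair P X R1 b R2 a" and l: "length b = 2"
    and uv: "u \<in> set a" "v \<in> set b" "adj u v"
  shows "length a = 5" "u = a ! 2" "\<forall>w\<in>set b. adj u w"
proof -
  have c: "config (R1 @ b @ R2 @ a) P X" using p by (simp add: pair_def)
  have g: "gmax (length P)" "2 \<le> length P" using edge_card(3)[OF c k] k by simp_all
  obtain a' a'' where a': "a = a' @ u # a''" using uv(1) by (meson split_list)
  note ss = short_seg[OF g p[unfolded a'] _ uv(2,3)]
  show "\<forall>w\<in>set b. adj u w" using ss(1) l k by simp
  have "2 \<le> length a'" "2 \<le> length a''" using ss(2,3) l k by simp_all
  moreover have "length a' + length a'' + 1 + 2 \<le> 7" using pair_small(3)[OF p k] l by (simp add: a')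
  ultimately have "length a' = 2" "length a'' = 2" by linarith+
  then show "length a = 5" "u = a ! 2" by (simp_all add: a' nth_append)
qed

lemma link_type:
  assumes k: "length P = 2" and p: "pair P X R1 b R2 a"
    and uv: "u \<in> set a" "v \<in> set b" "adj u v"
  shows "length a = 5 \<and> length b = 2 \<and> u = a ! 2 \<or> length a = 2 \<and> length b = 5 \<and> v = b ! 2 \<or>
    length a = 3 \<and> length b = 3 \<and> u = a ! 1 \<and> v = b ! 1 \<or>
    length a = 4 \<and> length b = 3 \<and> v = b ! 1 \<or> length a = 3 \<and> length b = 4 \<and> u = a ! 1"
proof -
  note sm = pair_small[OF p k]
  note sw = pair_swap[OF p] and vu = uv(2,1) adj_sym[OF uv(3)]
  consider "length b = 2" | "length a = 2" | "length a = 3" "length b = 3" | "length a = 4" "length b = 3"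
    | "length a = 3" "length b = 4" using sm by linarith
  then show ?thesis
  proof cases
    case 1 then show ?thesis using link_type_2[OF k p _ uv] by simp
  next
    case 2 then show ?thesis using link_type_2[OF k sw _ vu] by simp
  next
    case 3 then show ?thesis using link_type_33[OF k p _ _ uv] by simp
  next
    case 4 then show ?thesis using link_type_43[OF k p _ _ uv] by simp
  next
    case 5 then show ?thesis using link_type_43[OF k sw _ _ vu] by simp
  qed
qed

text \<open>With \<open>P\<close> in place of \<open>b\<close> and \<open>u1\<close>,
  \<open>u2\<close>, \<open>u3\<close>, \<open>b1\<close>, \<open>b2\<close> in place of the long
  segment the cycle keeps its length and misses \<open>u4\<close>, \<open>u5\<close>, which are
  therefore twins. So \<open>x\<close> is adjacent to \<open>u5\<close>, and the way from
  \<open>x\<close> through \<open>u5\<close>, \<open>u4\<close>, \<open>u3\<close>,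
  \<open>b1\<close>, \<open>b2\<close> gives a longer cycle.\<close>

lemma no_edge_across_half:
  assumes k: "length P = 2" and p: "pair P X R1 [b1, b2] R2 [u1, u2, u3, u4, u5]"
    and a: "adj u3 b1" "adj u3 b2" "adj b2 (hd R1)"
    and e: "adj x y" "x \<in> {u1, u2}" "y \<in> {u4, u5}"
  shows False
proof -
  let ?a = "[u1, u2, u3, u4, u5]" and ?b = "[b1, b2]"
  note ch = pair_chains[OF p]
  have c: "config (R1 @ ?b @ R2 @ ?a) P X" using p by (simp add: pair_def)
  have "distinct ((R1 @ R2) @ ?b @ ?a)" using pair_ends(1)[OF p] by auto
  then have dis: "set (R1 @ R2) \<inter> set (?b @ ?a) = {}" "distinct (?b @ ?a)" unfolding distinct_append[of "R1 @ R2"] by blast+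
  have e': "adj b1 b2" "adj u1 u2" "adj u2 u3" "adj u3 u4" "adj u4 u5" "adj (last R2) u1"
    using ch(3,4,5) by (simp_all add: chain_Cons)
  have build: "\<exists>Q. set Q = set P \<and> length Q = length P \<and> cyc (R1 @ Q @ R2 @ W)"
    if "W \<noteq> []" "chain W" "distinct W" "set W \<subseteq> set (?b @ ?a)" "hd W = u1" "last W = b2" for W
  proof (rule pair_reroute[OF p that(1-3)])
    have "set (?b @ ?a) \<subseteq> V - set P" using ch(9) by auto
    then show "set W \<subseteq> V - set R1 - set R2 - set P" using that(4) dis(1) by auto
    show "adj (last R2) (hd W)" "adj (last W) (hd R1)" using e'(6) a(3) that(5,6) by simp_all
  qed
  have "\<exists>Q. set Q = set P \<and> length Q = length P \<and> cyc (R1 @ Q @ R2 @ [u1, u2, u3, b1, b2])"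
    by (rule build) (use dis(2) e' a in \<open>auto simp: chain_Cons\<close>)
  then obtain Q where Q: "set Q = set P" "length Q = length P" "cyc (R1 @ Q @ R2 @ [u1, u2, u3, b1, b2])" by blast
  have "longest (R1 @ Q @ R2 @ [u1, u2, u3, b1, b2])"
    by (rule longest_same_length[OF configD(1)[OF c] Q(3)]) (use Q(2) k in simp)
  moreover have "{u4, u5} \<subseteq> V - set P - set (R1 @ R2)" using ch(9) dis(1) by auto
  then have "opath (R1 @ Q @ R2 @ [u1, u2, u3, b1, b2]) [u4, u5]"
    using dis(2) e'(5) Q(1) by (auto simp: opath_def chain_Cons)
  ultimately have tw: "adj u4 w \<longleftrightarrow> adj u5 w" if "w \<noteq> u4" "w \<noteq> u5" for w using edge_outside(4) that by blast
  have "x \<noteq> u4" "x \<noteq> u5" using e(2) dis(2) by auto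
  then have x5: "adj x u5" using tw[of x] e(1,3) adj_commute by blast
  let ?W = "(if x = u1 then [u1] else [u1, u2]) @ [u5, u4, u3, b1, b2]"
  have "\<exists>Q. set Q = set P \<and> length Q = length P \<and> cyc (R1 @ Q @ R2 @ ?W)"
    by (rule build) (use dis(2) e' e'[THEN adj_sym] a x5 e(2) in \<open>auto simp: chain_Cons split: if_splits\<close>)
  then obtain Q' where Q': "length Q' = length P" "cyc (R1 @ Q' @ R2 @ ?W)" by blast
  from longestD(2)[OF configD(1)[OF c] Q'(2)] show False using Q'(1) k by (simp split: if_splits)
qed

text \<open>After the exchange of \<open>b1\<close>, \<open>b2\<close> with \<open>P\<close> the
  neighbours of \<open>b1\<close> on the cycle are \<open>card X\<close> elements of
  \<open>insert u3 X\<close>. They cannot miss both \<open>hd R1\<close> and \<open>last R2\<close>,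
  and the two cases are mirror images.\<close>

lemma no_edge_across:
  assumes k: "length P = 2" and p: "pair P X R1 [b1, b2] R2 [u1, u2, u3, u4, u5]"
    and v: "v \<in> {b1, b2}" "adj u3 v" and e: "adj x y" "x \<in> {u1, u2}" "y \<in> {u4, u5}"
  shows False
proof -
  let ?a = "[u1, u2, u3, u4, u5]" and ?b = "[b1, b2]"
  have b3: "\<forall>w\<in>set ?b. adj u3 w" by (rule link_type_2(3)[OF k p]) (use v in auto)
  have c: "config (R1 @ ?b @ R2 @ ?a) P X" using p by (simp add: pair_def)
  obtain P' where P': "set P' = set P" "longest (R1 @ P' @ R2 @ ?a)" "opath (R1 @ P' @ R2 @ ?a) ?b"
    using pair_replace[OF p] k by auto
  let ?C' = "R1 @ P' @ R2 @ ?a"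
  define E where "E = cnbrs ?C' b1"
  note eo = edge_outside[OF P'(2,3), folded E_def]
  have cE: "card E = card X" using eo(2) edge_card(1)[OF c k] by simp
  obtain s2 s3 where s: "segs X ((last R2, ?a) # s2 @ (last R1, ?b) # s3)"
    "config (flat ((last R2, ?a) # s2 @ (last R1, ?b) # s3)) P X"
    "R1 = flat s2 @ [last R1]" "R2 = flat s3 @ [last R2]"
    using pair_segs[OF p] by blast
  let ?ss = "(last R2, ?a) # s2 @ (last R1, ?b) # s3"
  have "set R1 = insert (last R1) (set (flat s2))" "set R2 = insert (last R2) (set (flat s3))"
    using arg_cong[OF s(3), of set] arg_cong[OF s(4), of set] by simp_all
  then have setC: "set (flat ?ss) = set (R1 @ ?b @ R2 @ ?a)" by auto
  have sub: "E \<subseteq> insert u3 X"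
  proof
    fix w assume w: "w \<in> E"
    then have aw: "adj b1 w" "w \<in> set ?C'" by (auto simp: E_def cnbrs_def)
    show "w \<in> insert u3 X"
    proof (rule ccontr)
      assume no: "w \<notin> insert u3 X"
      have "w \<notin> set P"
      proof
        assume "w \<in> set P"
        then have "b1 \<in> set P \<union> X" using configD(8)[OF c _ adj_sym[OF aw(1)]] by blast
        then show False using p P'(1,3) by (auto simp: pair_def opath_def)
      qed
      then have "w \<in> set (flat ?ss) - X" using aw(2) P'(1) no unfolding setC by auto
      then obtain t where t: "t \<in> set ?ss" "w \<in> set (snd t)" using in_seg[OF s(1)] by blast
      have wb: "w \<notin> set ?b" using aw(2) P'(3) by (auto simp: opath_def)
      have gen: "w = g ! 2 \<and> length g = 5" if "pair P X S1 ?b S2 g" "w \<in> set g" for S1 S2 g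
        using link_type_2[OF k that(1) _ that(2), of b1] aw(1) adj_sym by simp
      have "t \<noteq> (last R2, ?a)" using gen[OF p] t(2) no by auto
      moreover have tb: "t \<noteq> (last R1, ?b)" using t(2) wb by auto
      ultimately have ta: "t \<noteq> (last R2, ?a)" by simp
      obtain S1 S2 where "pair P X S1 ?b S2 (snd t)"
        using segs_pair[OF s(2,1) t(1) _ tb] by auto
      then have "length (snd t) = 5" using gen t(2) by blast
      moreover have "(\<Sum>t\<in>{t, (last R2, ?a)}. length (snd t) - 2) \<le> 3"
        using seg_excess[OF s(2) k s(1), of "{t, (last R2, ?a)}"] t(1) by simp
      ultimately show False using ta by simp
    qed
  qed
  have EX: "hd R1 \<in> X" "last R2 \<in> X" "hd R1 \<noteq> last R2"
    using p pair_ends[OF p] by (auto simp: pair_def)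
  have finX: "finite X" by (rule configD(7)[OF c])
  have "hd R1 \<in> E \<or> last R2 \<in> E"
  proof (rule ccontr)
    assume no: "\<not> ?thesis"
    have "E \<subseteq> insert u3 (X - {hd R1, last R2})"
    proof
      fix w assume "w \<in> E"
      moreover from this have "w \<noteq> hd R1" "w \<noteq> last R2" using no by metis+
      ultimately show "w \<in> insert u3 (X - {hd R1, last R2})" using sub by blast
    qed
    then have "card E \<le> card (insert u3 (X - {hd R1, last R2}))" using finX by (intro card_mono) auto
    also have "\<dots> \<le> Suc (card (X - {hd R1, last R2}))" using finX by (simp add: card_insert_if)
    also have "card (X - {hd R1, last R2}) = card X - 2"
      using EX finX by (simp add: card_Diff_subset)
    finally show False using cE edge_card(2)[OF c k] by linarith
  qed
  then show False
  proof
    assume "hd R1 \<in> E"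
    then have "adj b2 (hd R1)" using eo(3) by (auto simp: cnbrs_def)
    then show False using no_edge_across_half[OF k p _ _ _ e] b3 by simp
  next
    assume "last R2 \<in> E"
    then have "adj b1 (hd (rev R2))" by (simp add: hd_rev E_def cnbrs_def)
    moreover have "pair P X (rev R2) [b2, b1] (rev R1) [u5, u4, u3, u2, u1]" using pair_mirror[OF p] by simp
    ultimately show False
      using no_edge_across_half[OF k _ _ _ _ adj_sym[OF e(1)], of X "rev R2" b2 b1 "rev R1" u5 u4 u3 u2 u1] b3 e
      by auto
  qed
qed

text \<open>A link from \<open>v1\<close> to \<open>v3\<close> lets the cycle pass from
  \<open>u\<close> through \<open>v2\<close>, \<open>v1\<close>, the link and \<open>v3\<close>. The
  short segment is kept entirely, and only \<open>a1\<close> is given up for \<open>P\<close> and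
  the link.\<close>

lemma middle_bypass:
  assumes k: "length P = 2" and p: "pair P X R1 [v1, v2, v3] R2 (a1 @ u # a2)" and e: "adj u v2"
    and L: "link (R1 @ [v1, v2, v3] @ R2 @ (a1 @ u # a2)) P v1 L v3"
  shows "2 \<le> length a1"
proof -
  let ?C = "R1 @ [v1, v2, v3] @ R2 @ (a1 @ u # a2)" and ?W = "rev (u # a2) @ [v2] @ v1 # L @ [v3]"
  note ch = pair_chains[OF p]
  have LL: "chain (v1 # L @ [v3])" "distinct L" "set L \<subseteq> V" "set L \<inter> (set ?C \<union> set P) = {}"
    using L by (auto simp: link_def)
  have ab: "chain (u # a2)" "adj (last (u # a2)) (hd R1)" "adj v1 v2" "adj v3 (hd R2)"
    using ch(3,4,6,8) by (auto simp: chain_append chain_Cons)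
  have "chain ([v2] @ v1 # L @ [v3])" unfolding chain_append[of "[v2]"] using LL(1) ab(3) adj_sym by (simp add: chain_Cons)
  then have W: "chain ?W" unfolding chain_append[of "rev (u # a2)"] chain_rev using ab(1) e by simp
  have hdW: "hd ?W = last (u # a2)" by (cases a2 rule: rev_cases) simp_all
  have "\<exists>Q. set Q = set P \<and> length Q = length P \<and> cyc (R2 @ Q @ rev R1 @ ?W)"
  proof (rule pair_reroute_cross[OF p _ W])
    show "distinct ?W" using pair_ends(1)[OF p] LL(2,4) by auto
    show "set ?W \<subseteq> V - set R1 - set R2 - set P" using pair_ends(1)[OF p] ch(9) LL(3,4) by auto
    show "adj (hd R1) (hd ?W)" unfolding hdW by (rule adj_sym[OF ab(2)])
    show "adj (last ?W) (hd R2)" using ab(4) by simp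
  qed simp
  then obtain Q where Q: "length Q = length P" "cyc (R2 @ Q @ rev R1 @ ?W)" by blast
  have "longest ?C" using p configD(1) unfolding pair_def by blast
  from longestD(2)[OF this Q(2)] show ?thesis using Q(1) k by simp
qed

text \<open>Two vertices are needed on either side of \<open>u\<close>. In the applications
  \<open>a\<close> has at most four, so the outer vertices of the short segment are not
  linked.\<close>

lemma middle_bypass':
  assumes k: "length P = 2" and p: "pair P X R1 [v1, v2, v3] R2 a" and u: "u \<in> set a" and e: "adj u v2"
    and L: "link (R1 @ [v1, v2, v3] @ R2 @ a) P v1 L v3"
  shows "5 \<le> length a"
proof -
  obtain a1 a2 where a: "a = a1 @ u # a2" using u by (meson split_list)
  have "2 \<le> length a1" by (rule middle_bypass[OF k p[unfolded a] e L[unfolded a]])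
  moreover have "2 \<le> length (rev a2)"
  proof (rule middle_bypass[OF k _ e])
    show "pair P X (rev R2) [v3, v2, v1] (rev R1) (rev a2 @ u # rev a1)"
      using pair_mirror[OF p] by (simp add: a)
    show "link (rev R2 @ [v3, v2, v1] @ rev R1 @ rev a2 @ u # rev a1) P v3 (rev L) v1"
      using link_rev[OF L] by (rule link_cong[THEN iffD1, rotated]) (auto simp: a)
  qed
  ultimately show ?thesis by (simp add: a)
qed

text \<open>Toughness, applied to \<open>X \<union> M\<close>: a segment is labelled by the vertex of \<open>X\<close> in front of it,
  except that the vertices of \<open>F\<close> label their own components.\<close>

lemma refined_toughness:
  assumes c: "config (flat ss) P X" and sg: "segs X ss"
    and M: "M \<subseteq> set (flat ss) - X" and F: "F \<subseteq> set (flat ss) - X - M" and rep: "\<And>v. v \<in> W \<Longrightarrow> h v \<in> F"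
      "\<And>v. v \<in> F \<Longrightarrow> v \<in> W \<and> h v = v"
    and rest: "\<And>t. t \<in> set ss \<Longrightarrow> \<exists>v\<in>set (snd t). v \<notin> M \<and> v \<notin> W"
    and nolink: "\<And>t t' u v L. \<lbrakk>t \<in> set ss; t' \<in> set ss; u \<in> set (snd t) - M; v \<in> set (snd t') - M;
      link (flat ss) P u L v\<rbrakk> \<Longrightarrow> t = t' \<and> (u \<in> W \<longleftrightarrow> v \<in> W) \<and> (u \<in> W \<longrightarrow> h u = h v)"
  shows "card F < card M"
proof -
  let ?C = "flat ss" and ?S = "X \<union> M"
  have d: "distinct ?C" "X \<subseteq> set ?C" using configD[OF c] by auto
  have f: "fst ` set ss = X" using fst_segs[OF sg d(2)] .
  \<comment> \<open>By \<open>rest\<close> every segment keeps a vertex labelled by its vertex in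
    \<open>X\<close>. So all of \<open>X\<close> and \<open>F\<close> occur as labels, and at least
    card X + card F + 1 components face at most card X + card M removed vertices.\<close>
  define l where "l v = (if v \<in> W then h v else lab ss v)" for v
  have "M \<subseteq> set ?C" "F \<subseteq> set ?C" using M F by auto
  then have fin: "finite M" "finite F" "finite X"
    using finite_subset[OF _ finite_set] configD(7)[OF c] by simp_all
  have sub: "X \<union> F \<subseteq> l ` (set ?C - ?S)"
  proof
    fix x assume "x \<in> X \<union> F"
    then consider "x \<in> X" | "x \<in> F" by blast
    then show "x \<in> l ` (set ?C - ?S)"
    proof cases
      case 1
      then have "x \<in> fst ` set ss" using f by simp
      then obtain t where t: "t \<in> set ss" "fst t = x" by blast
      obtain v where v: "v \<in> set (snd t)" "v \<notin> M" "v \<notin> W" using rest[OF t(1)] by blast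
      have "v \<notin> X" using sg t(1) v(1) by (auto simp: segs_def)
      moreover have "v \<in> set ?C" using t(1) v(1) by (auto simp: set_flat)
      moreover have "l v = x" using v(3) lab_eq[OF d(1) t(1) v(1)] t(2) by (simp add: l_def)
      ultimately show ?thesis using v(2) by (intro image_eqI[of _ _ v]) auto
    next
      case 2
      then show ?thesis using rep(2)[OF 2] F by (intro image_eqI[of _ _ x]) (auto simp: l_def)
    qed
  qed
  have "X \<noteq> {}" using configD(4)[OF c] by auto
  then have ne: "set ?C - ?S \<noteq> {}" using sub by blast
  have "card (l ` (set ?C - ?S)) + 1 \<le> card ?S"
  proof (rule toughness[OF c _ _ ne])
    show "X \<subseteq> ?S" "?S \<subseteq> set ?C" using d(2) M by auto
    fix u v L assume uv: "u \<in> set ?C - ?S" "v \<in> set ?C - ?S" "link ?C P u L v"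
    obtain t where t: "t \<in> set ss" "u \<in> set (snd t)" using in_seg[OF sg] uv(1) by blast
    obtain t' where t': "t' \<in> set ss" "v \<in> set (snd t')" using in_seg[OF sg] uv(2) by blast
    have "t = t' \<and> (u \<in> W \<longleftrightarrow> v \<in> W) \<and> (u \<in> W \<longrightarrow> h u = h v)"
      by (rule nolink[OF t(1) t'(1) _ _ uv(3)]) (use t t' uv in auto)
    then show "l u = l v" using lab_eq[OF d(1)] t t' by (metis l_def)
  qed
  moreover have "card (X \<union> F) \<le> card (l ` (set ?C - ?S))" by (rule card_mono[OF _ sub]) simp
  moreover have "card (X \<union> F) = card X + card F" by (rule card_Un_disjoint) (use fin F in auto)
  moreover have "card ?S \<le> card X + card M" by (rule card_Un_le)
  ultimately show ?thesis by linarith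
qed

section \<open>The types of linked segments against toughness\<close>

lemma five_two:
  assumes c: "config (flat ss) P X" and k: "length P = 2" and sg: "segs X ss"
    and t: "t \<in> set ss" "t' \<in> set ss" "t \<noteq> t'" and uv: "u \<in> set (snd t)" "v \<in> set (snd t')" "adj u v"
    and len: "length (snd t) = 5" "length (snd t') = 2"
  shows False
proof -
  have d: "distinct (flat ss)" by (rule configD(5)[OF c])
  obtain R1 R2 where R: "pair P X R1 (snd t') R2 (snd t)" using segs_pair[OF c sg t] by blast
  obtain u1 u2 u3 u4 u5 where a: "snd t = [u1, u2, u3, u4, u5]"
    using len(1) by (auto simp: numeral_eq_Suc length_Suc_conv)
  obtain b1 b2 where b: "snd t' = [b1, b2]" using len(2) by (auto simp: numeral_eq_Suc length_Suc_conv)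
  have u3: "u = u3" using link_type_2(2)[OF k R len(2) uv] by (simp add: a)
  have "distinct (snd t)" using pair_ends(1)[OF R] by simp
  then have da: "distinct [u1, u2, u3, u4, u5]" by (simp add: a)
  have inC: "set (snd t) \<subseteq> set (flat ss) - X" using t(1) sg by (auto simp: set_flat segs_def)
  have others: "length (snd g) = 2" if g: "g \<in> set ss" "g \<noteq> t" for g
  proof -
    have "(\<Sum>r\<in>{t, g}. length (snd r) - 2) \<le> 3" using seg_excess[OF c k sg, of "{t, g}"] t g by simp
    then have "length (snd g) \<le> 2" using g len by simp
    then show ?thesis using segs_length[OF c sg g(1)] k by simp
  qed
  have out: "card (V - set (flat ss) - set P) = 0"
    using seg_excess[OF c k sg, of "{t}"] t len by simp
  have sep: "w \<notin> set (snd t)" if "g \<in> set ss" "g \<noteq> t" "w \<in> set (snd g)" for g w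
    using seg_unique[OF d that(1) t(1) that(3)] that(2) by blast
  have across: "\<not> adj x y" if "x \<in> {u1, u2}" "y \<in> {u4, u5}" for x y
    using no_edge_across[OF k R[unfolded a b], of v x y] uv u3 b that by auto
  \<comment> \<open>The long segment uses up all spare vertices, so every edge between segments ends
    in its middle vertex \<open>u3\<close>. Without \<open>u3\<close> its halves \<open>u1\<close>,
    \<open>u2\<close> and \<open>u4\<close>, \<open>u5\<close> fall apart.\<close>
  have "card {u1} < card {u3}"
  proof (rule refined_toughness[OF c sg, of "{u3}" "{u1}" "{u1, u2}" "\<lambda>_. u1"])
    show "{u3} \<subseteq> set (flat ss) - X" "{u1} \<subseteq> set (flat ss) - X - {u3}" using inC da by (auto simp: a)
    show "\<exists>w\<in>set (snd g). w \<notin> {u3} \<and> w \<notin> {u1, u2}" if g: "g \<in> set ss" for g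
    proof (cases "g = t")
      case True
      then show ?thesis using da by (intro bexI[of _ u4]) (auto simp: a)
    next
      case False
      then have "snd g \<noteq> []" using others[OF g] by auto
      then have "hd (snd g) \<in> set (snd g)" by simp
      then show ?thesis using sep[OF g False] by (auto simp: a)
    qed
    fix g h x y L
    assume gh: "g \<in> set ss" "h \<in> set ss" "x \<in> set (snd g) - {u3}" "y \<in> set (snd h) - {u3}"
      "link (flat ss) P x L y"
    show "g = h \<and> (x \<in> {u1, u2} \<longleftrightarrow> y \<in> {u1, u2}) \<and> (x \<in> {u1, u2} \<longrightarrow> u1 = u1)"
    proof (cases "g = h")
      case False
      have xy: "x \<in> set (snd g)" "y \<in> set (snd h)" using gh by auto
      have "L = []" by (rule link_direct[OF c k sg gh(1,2) False xy gh(5)])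
      then have e: "adj x y" using gh(5) by (simp add: link_Nil)
      obtain S1 S2 where S: "pair P X S1 (snd h) S2 (snd g)" using segs_pair[OF c sg gh(1,2) False] by blast
      show ?thesis
      proof (cases "h = t")
        case True
        then have "length (snd g) = 2" using others gh(1) False by blast
        then have "y = snd t ! 2" using link_type_2(2)[OF k pair_swap[OF S] _ xy(2,1) adj_sym[OF e]] True by simp
        then show ?thesis using gh(4) by (simp add: a)
      next
        case hF: False
        then have h2: "length (snd h) = 2" using others gh(2) by blast
        then have "length (snd g) = 5" "x = snd g ! 2" using link_type_2[OF k S _ xy e] by auto
        moreover from this have "g = t" using others[OF gh(1)] by (metis numeral_eq_iff semiring_norm(85,88,89))
        ultimately show ?thesis using gh(3) by (simp add: a)
      qed
    next
      case gh_eq: True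
      show ?thesis
      proof (cases "g = t")
        case False
        then show ?thesis using sep[OF gh(1) False] gh gh_eq by (auto simp: a)
      next
        case True
        have "length L = 0" using card_link_le[OF gh(5)] out by simp
        then have "adj x y" using gh(5) by (simp add: link_Nil)
        then have "\<not> (x \<in> {u1, u2} \<and> y \<in> {u4, u5})" "\<not> (y \<in> {u1, u2} \<and> x \<in> {u4, u5})"
          using across adj_sym by blast+
        moreover have "x \<in> set (snd t) - {u3}" "y \<in> set (snd t) - {u3}" using gh(3,4) gh_eq True by simp_all
        ultimately show ?thesis using gh_eq by (auto simp: a)
      qed
    qed
  qed (use da in auto)
  then show False by simp
qed

text \<open>Every edge between segments ends in \<open>v2\<close>, and no link joins
  \<open>v1\<close> and \<open>v3\<close>. Removing \<open>v2\<close> thus makes \<open>v1\<close> a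
  component of its own.\<close>

lemma four_three:
  assumes c: "config (flat ss) P X" and k: "length P = 2" and sg: "segs X ss"
    and t: "t \<in> set ss" "t' \<in> set ss" "t \<noteq> t'" and uv: "u \<in> set (snd t)" "v \<in> set (snd t')" "adj u v"
    and len: "length (snd t) = 4" "length (snd t') = 3"
  shows False
proof -
  have d: "distinct (flat ss)" by (rule configD(5)[OF c])
  obtain R1 R2 where R: "pair P X R1 (snd t') R2 (snd t)" "set (R1 @ snd t' @ R2 @ snd t) = set (flat ss)"
    using segs_pair[OF c sg t] by blast
  obtain v1 v2 v3 where b: "snd t' = [v1, v2, v3]" using len(2) by (auto simp: numeral_eq_Suc length_Suc_conv)
  have v2: "v = v2" using link_type_43[OF k R(1) len uv] by (simp add: b)
  have "distinct (snd t')" using pair_ends(1)[OF R(1)] by simp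
  then have db: "distinct [v1, v2, v3]" by (simp add: b)
  have inC: "set (snd t') \<subseteq> set (flat ss) - X" using t(2) sg by (auto simp: set_flat segs_def)
  have others: "length (snd g) = 2" if g: "g \<in> set ss" "g \<noteq> t" "g \<noteq> t'" for g
  proof -
    have "(\<Sum>r\<in>{t, t', g}. length (snd r) - 2) \<le> 3" using seg_excess[OF c k sg, of "{t, t', g}"] t g by simp
    then have "length (snd g) \<le> 2" using g len t(3) by simp
    then show ?thesis using segs_length[OF c sg g(1)] k by simp
  qed
  have sep: "w \<notin> set (snd t')" if "g \<in> set ss" "g \<noteq> t'" "w \<in> set (snd g)" for g w
    using seg_unique[OF d that(1) t(2) that(3)] that(2) by blast
  have no13: "\<not> link (flat ss) P v1 L v3" for L
    using middle_bypass'[OF k R(1)[unfolded b] uv(1) uv(3)[unfolded v2], of L] link_cong[OF R(2)] len(1)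
    by (auto simp: b)
  have "card {v1} < card {v2}"
  proof (rule refined_toughness[OF c sg, of "{v2}" "{v1}" "{v1}" "\<lambda>x. x"])
    show "{v2} \<subseteq> set (flat ss) - X" "{v1} \<subseteq> set (flat ss) - X - {v2}" using inC db by (auto simp: b)
    show "\<exists>w\<in>set (snd g). w \<notin> {v2} \<and> w \<notin> {v1}" if g: "g \<in> set ss" for g
    proof (cases "g = t'")
      case True
      then show ?thesis using db by (intro bexI[of _ v3]) (auto simp: b)
    next
      case False
      have "snd g \<noteq> []" using segs_length[OF c sg g] k by auto
      then have "hd (snd g) \<in> set (snd g)" by simp
      then show ?thesis using sep[OF g False] by (auto simp: b)
    qed
    fix g h x y L
    assume gh: "g \<in> set ss" "h \<in> set ss" "x \<in> set (snd g) - {v2}" "y \<in> set (snd h) - {v2}"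
      "link (flat ss) P x L y"
    show "g = h \<and> (x \<in> {v1} \<longleftrightarrow> y \<in> {v1}) \<and> (x \<in> {v1} \<longrightarrow> x = y)"
    proof (cases "g = h")
      case False
      have xy: "x \<in> set (snd g)" "y \<in> set (snd h)" using gh by auto
      have "L = []" by (rule link_direct[OF c k sg gh(1,2) False xy gh(5)])
      then have e: "adj x y" using gh(5) by (simp add: link_Nil)
      obtain S1 S2 where S: "pair P X S1 (snd h) S2 (snd g)" using segs_pair[OF c sg gh(1,2) False] by blast
      have lg: "length (snd r) = (if r = t then 4 else if r = t' then 3 else 2)" if "r \<in> set ss" for r
        using others[OF that] len by auto
      have "g = t \<and> h = t' \<and> y = snd t' ! 1 \<or> g = t' \<and> h = t \<and> x = snd t' ! 1"
        using link_type[OF k S xy e] lg[OF gh(1)] lg[OF gh(2)] False by (auto split: if_splits)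
      then show ?thesis using gh(3,4) by (auto simp: b)
    next
      case gh_eq: True
      show ?thesis
      proof (cases "g = t'")
        case False
        then show ?thesis using sep[OF gh(1) False] gh gh_eq by (auto simp: b)
      next
        case True
        have "\<not> (x = v1 \<and> y = v3)" "\<not> (x = v3 \<and> y = v1)" using no13 gh(5) link_rev by blast+
        moreover have "x \<in> set (snd t') - {v2}" "y \<in> set (snd t') - {v2}" using gh(3,4) gh_eq True by simp_all
        ultimately show ?thesis using gh_eq by (auto simp: b)
      qed
    qed
  qed (use db in auto)
  then show False by simp
qed

text \<open>At most one further segment has a third inner vertex, so every edge between segments
  ends in \<open>u2\<close> or \<open>v2\<close>. Removing both splits off \<open>u1\<close> and
  \<open>v1\<close>.\<close>

lemma three_three:
  assumes c: "config (flat ss) P X" and k: "length P = 2" and sg: "segs X ss"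
    and t: "t \<in> set ss" "t' \<in> set ss" "t \<noteq> t'" and uv: "u \<in> set (snd t)" "v \<in> set (snd t')" "adj u v"
    and len: "length (snd t) = 3" "length (snd t') = 3"
  shows False
proof -
  have d: "distinct (flat ss)" by (rule configD(5)[OF c])
  obtain R1 R2 where R: "pair P X R1 (snd t') R2 (snd t)" "set (R1 @ snd t' @ R2 @ snd t) = set (flat ss)"
    using segs_pair[OF c sg t] by blast
  have R': "pair P X R2 (snd t) R1 (snd t')" "set (R2 @ snd t @ R1 @ snd t') = set (flat ss)"
    using pair_swap[OF R(1)] R(2) by auto
  obtain u1 u2 u3 where a: "snd t = [u1, u2, u3]" using len(1) by (auto simp: numeral_eq_Suc length_Suc_conv)
  obtain v1 v2 v3 where b: "snd t' = [v1, v2, v3]" using len(2) by (auto simp: numeral_eq_Suc length_Suc_conv)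
  have m: "u = u2" "v = v2" using link_type_33[OF k R(1) len uv] by (simp_all add: a b)
  have "distinct (snd t' @ snd t)" using pair_ends(1)[OF R(1)] by auto
  then have dab: "distinct [v1, v2, v3, u1, u2, u3]" by (simp add: a b)
  have inC: "set (snd t) \<union> set (snd t') \<subseteq> set (flat ss) - X" using t sg by (auto simp: set_flat segs_def)
  have others: "length (snd g) + length (snd h) \<le> 5" "length (snd g) \<le> 3"
    if g: "g \<in> set ss" "g \<noteq> t" "g \<noteq> t'" "h \<in> set ss" "h \<noteq> t" "h \<noteq> t'" "g \<noteq> h" for g h
  proof -
    have "(\<Sum>r\<in>{t, t', g, h}. length (snd r) - 2) \<le> 3" using seg_excess[OF c k sg, of "{t, t', g, h}"] t g by simp
    then have "(length (snd g) - 2) + (length (snd h) - 2) \<le> 1" using g len t(3) by simp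
    then show "length (snd g) + length (snd h) \<le> 5" "length (snd g) \<le> 3" by linarith+
  qed
  have le3: "length (snd g) \<le> 3" if g: "g \<in> set ss" for g
  proof (cases "g = t \<or> g = t'")
    case True
    then show ?thesis using len by auto
  next
    case False
    then have ne: "g \<noteq> t" "g \<noteq> t'" by simp_all
    have "(\<Sum>r\<in>{t, t', g}. length (snd r) - 2) \<le> 3" using seg_excess[OF c k sg, of "{t, t', g}"] t g by simp
    then have "length (snd g) - 2 \<le> 1" using ne len t(3) by simp
    then show ?thesis by linarith
  qed
  have sep: "w \<notin> set (snd r)" if "g \<in> set ss" "g \<noteq> r" "r \<in> {t, t'}" "w \<in> set (snd g)" for g w r
    using seg_unique[OF d that(1) _ that(4), of r] that(2,3) t(1,2) by blast
  have no13: "\<not> link (flat ss) P v1 L v3" for L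
    using middle_bypass'[OF k R(1)[unfolded b] uv(1) uv(3)[unfolded m(2)], of L] link_cong[OF R(2)] len(1)
    by (auto simp: b)
  have no13': "\<not> link (flat ss) P u1 L u3" for L
    using middle_bypass'[OF k R'(1)[unfolded a] uv(2) adj_sym[OF uv(3), unfolded m(1)], of L]
      link_cong[OF R'(2)] len(2)
    by (auto simp: a)
  have "card {u1, v1} < card {u2, v2}"
  proof (rule refined_toughness[OF c sg, of "{u2, v2}" "{u1, v1}" "{u1, v1}" "\<lambda>x. x"])
    show "{u2, v2} \<subseteq> set (flat ss) - X" "{u1, v1} \<subseteq> set (flat ss) - X - {u2, v2}"
      using inC dab by (auto simp: a b)
    show "\<exists>w\<in>set (snd g). w \<notin> {u2, v2} \<and> w \<notin> {u1, v1}" if g: "g \<in> set ss" for g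
    proof -
      consider "g = t" | "g = t'" | "g \<noteq> t" "g \<noteq> t'" by blast
      then show ?thesis
      proof cases
        case 1
        then show ?thesis using dab by (intro bexI[of _ u3]) (auto simp: a)
      next
        case 2
        then show ?thesis using dab by (intro bexI[of _ v3]) (auto simp: b)
      next
        case 3
        have "snd g \<noteq> []" using segs_length[OF c sg g] k by auto
        then have "hd (snd g) \<in> set (snd g)" by simp
        moreover from this have "hd (snd g) \<notin> set (snd t)" "hd (snd g) \<notin> set (snd t')"
          using sep[OF g] 3 by blast+
        ultimately show ?thesis by (intro bexI[of _ "hd (snd g)"]) (auto simp: a b)
      qed
    qed
    fix g h x y L
    assume gh: "g \<in> set ss" "h \<in> set ss" "x \<in> set (snd g) - {u2, v2}" "y \<in> set (snd h) - {u2, v2}"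
      "link (flat ss) P x L y"
    show "g = h \<and> (x \<in> {u1, v1} \<longleftrightarrow> y \<in> {u1, v1}) \<and> (x \<in> {u1, v1} \<longrightarrow> x = y)"
    proof (cases "g = h")
      case False
      have xy: "x \<in> set (snd g)" "y \<in> set (snd h)" using gh by auto
      have "L = []" by (rule link_direct[OF c k sg gh(1,2) False xy gh(5)])
      then have e: "adj x y" using gh(5) by (simp add: link_Nil)
      obtain S1 S2 where S: "pair P X S1 (snd h) S2 (snd g)" using segs_pair[OF c sg gh(1,2) False] by blast
      have l33: "length (snd g) = 3 \<and> length (snd h) = 3 \<and> x = snd g ! 1 \<and> y = snd h ! 1"
        using link_type[OF k S xy e] le3[OF gh(1)] le3[OF gh(2)] by auto
      then have "g = t \<or> g = t' \<or> h = t \<or> h = t'"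
        using others(1)[OF gh(1) _ _ gh(2) _ _ False] by fastforce
      then have "x \<in> {u2, v2} \<or> y \<in> {u2, v2}"
      proof (elim disjE)
        assume "g = t" then show ?thesis using l33 by (simp add: a)
      next
        assume "g = t'" then show ?thesis using l33 by (simp add: b)
      next
        assume "h = t" then show ?thesis using l33 by (simp add: a)
      next
        assume "h = t'" then show ?thesis using l33 by (simp add: b)
      qed
      then show ?thesis using gh(3,4) by blast
    next
      case gh_eq: True
      consider "g = t" | "g = t'" | "g \<noteq> t" "g \<noteq> t'" by blast
      then show ?thesis
      proof cases
        case 1
        have "\<not> (x = u1 \<and> y = u3)" "\<not> (x = u3 \<and> y = u1)" using no13' gh(5) link_rev by blast+
        moreover have "x \<in> set (snd t) - {u2, v2}" "y \<in> set (snd t) - {u2, v2}" using gh(3,4) gh_eq 1 by simp_all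
        ultimately show ?thesis using gh_eq dab by (auto simp: a)
      next
        case 2
        have "\<not> (x = v1 \<and> y = v3)" "\<not> (x = v3 \<and> y = v1)" using no13 gh(5) link_rev by blast+
        moreover have "x \<in> set (snd t') - {u2, v2}" "y \<in> set (snd t') - {u2, v2}" using gh(3,4) gh_eq 2 by simp_all
        ultimately show ?thesis using gh_eq dab by (auto simp: b)
      next
        case 3
        have "x \<notin> set (snd t) \<and> x \<notin> set (snd t')" "y \<notin> set (snd t) \<and> y \<notin> set (snd t')"
          using sep[OF gh(1)] 3 gh(3,4) gh_eq by blast+
        then show ?thesis using gh_eq by (auto simp: a b)
      qed
    qed
  qed (use dab in auto)
  moreover have "card {u1, v1} = 2" "card {u2, v2} = 2" using dab by auto
  ultimately show False by simp
qed

lemma no_edge_config: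
  assumes "config C P X" "length P = 2"
  shows False
proof -
  obtain ss where c: "config (flat ss) P X" and sg: "segs X ss" using config_segs[OF assms(1)] by blast
  obtain t t' u v L where t: "t \<in> set ss" "t' \<in> set ss" "t \<noteq> t'" and uv: "u \<in> set (snd t)" "v \<in> set (snd t')"
    and L: "link (flat ss) P u L v" using link_exists[OF c sg] by blast
  have "L = []" by (rule link_direct[OF c assms(2) sg t uv L])
  then have e: "adj u v" using L by (simp add: link_Nil)
  obtain R1 R2 where "pair P X R1 (snd t') R2 (snd t)" using segs_pair[OF c sg t] by blast
  note lt = link_type[OF assms(2) this uv e]
  note c' = c assms(2) sg and t' = t(2,1) t(3)[symmetric] uv(2,1) adj_sym[OF e]
  show False
    using lt five_two[OF c' t uv e] five_two[OF c' t'] three_three[OF c' t uv e]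
      four_three[OF c' t uv e] four_three[OF c' t'] by blast
qed

theorem longest_dominating:
  assumes "longest C" "x \<in> V - set C" "y \<in> V - set C"
  shows "\<not> adj x y"
proof
  assume e: "adj x y"
  then have "opath C [x, y]" using assms adj_irrefl by (auto simp: opath_def chain_Cons)
  from edge_outside(1)[OF assms(1) this] show False by (rule no_edge_config) simp
qed

end

section \<open>Graphs as symmetric digraphs\<close>

context graph begin

lemma dominates_sgraph: "sgraph (verts G) (\<lambda>u v. u \<rightarrow>\<^bsub>G\<^esub> v)"
proof
  show "finite (verts G)" by simp
  show "v \<rightarrow>\<^bsub>G\<^esub> u" if "u \<rightarrow>\<^bsub>G\<^esub> v" for u v by (rule arcs_ends_symmetric[OF sym_arcs that])
  show "\<not> u \<rightarrow>\<^bsub>G\<^esub> u" for u using adj_not_same by (rule notI)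
  show "u \<in> verts G" if "u \<rightarrow>\<^bsub>G\<^esub> v" for u v using adj_in_verts(1)[OF that] .
qed

lemma dominates_remove_verts:
  "u \<rightarrow>\<^bsub>remove_verts G S\<^esub> v \<longleftrightarrow> u \<rightarrow>\<^bsub>G\<^esub> v \<and> u \<in> verts G - S \<and> v \<in> verts G - S"
  by (auto simp: remove_verts_def arcs_ends_conv)

lemma sym_digraph_remove_verts: "sym_digraph (remove_verts G S)"
  unfolding remove_verts_def by (rule induced_graph_imp_graph[OF induced_induce]) auto

lemma connected_remove_verts:
  assumes "Digraph_Component.connected (remove_verts G S)" "u \<in> verts G - S" "v \<in> verts G - S"
  shows "u \<rightarrow>\<^sup>*\<^bsub>remove_verts G S\<^esub> v"
proof -
  interpret H: sym_digraph "remove_verts G S" by (rule sym_digraph_remove_verts)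
  have "u \<rightarrow>\<^sup>*\<^bsub>mk_symmetric (remove_verts G S)\<^esub> v"
    using assms unfolding Digraph_Component.connected_def strongly_connected_def
    by (auto simp: remove_verts_def)
  then show ?thesis by (simp add: H.reachable_mk_symmetric_eq[OF H.sym_arcs])
qed

text \<open>Components are induced subgraphs, hence determined by their vertex sets.\<close>

lemma finite_sccs_remove_verts: "finite (pre_digraph.sccs (remove_verts G S))"
proof (rule inj_on_finite[of verts])
  let ?H = "remove_verts G S"
  show "inj_on verts (pre_digraph.sccs ?H)"
    unfolding pre_digraph.sccs_def by (rule inj_onI) (auto intro: induced_eq_verts_imp_eq)
  show "verts ` pre_digraph.sccs ?H \<subseteq> Pow (verts G)"
    unfolding pre_digraph.sccs_def
    by (auto simp: induced_subgraph_def subgraph_def remove_verts_def)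
qed simp

text \<open>\<open>f\<close> is constant on components, so one chosen vertex per component already
  attains every value.\<close>

lemma num_components_ge:
  assumes f: "\<And>u v. u \<in> verts G - S \<Longrightarrow> v \<in> verts G - S \<Longrightarrow> u \<rightarrow>\<^bsub>G\<^esub> v \<Longrightarrow> f u = f v"
  shows "card (f ` (verts G - S)) \<le> num_components (remove_verts G S)"
proof -
  let ?H = "remove_verts G S"
  interpret H: sym_digraph ?H by (rule sym_digraph_remove_verts)
  have const: "f u = f v" if "u \<rightarrow>\<^sup>*\<^bsub>?H\<^esub> v" for u v
    using that
  proof (induct rule: H.reachable_induct)
    case (step x y)
    then show ?case using f dominates_remove_verts by metis
  qed simp
  have "f ` (verts G - S) \<subseteq> (\<lambda>c. f (SOME u. u \<in> verts c)) ` H.sccs"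
  proof
    fix y assume "y \<in> f ` (verts G - S)"
    then obtain v where v: "v \<in> verts ?H" "y = f v" by (auto simp: remove_verts_def)
    then obtain c where c: "c \<in> H.sccs" "v \<in> verts c" using H.scc_for_vert_ex by blast
    let ?u = "SOME u. u \<in> verts c"
    have "?u \<in> verts c" using c(2) by (rule someI)
    moreover have "strongly_connected c" "induced_subgraph c ?H" using c(1) by (auto simp: H.sccs_def)
    ultimately have "?u \<rightarrow>\<^sup>*\<^bsub>c\<^esub> v" "subgraph c ?H" using c(2) by (auto simp: strongly_connected_def)
    then have "?u \<rightarrow>\<^sup>*\<^bsub>?H\<^esub> v" by (rule H.reachable_mono)
    then show "y \<in> (\<lambda>c. f (SOME u. u \<in> verts c)) ` H.sccs"
      using const v(2) c(1) by (metis image_eqI)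
  qed
  then show ?thesis
    unfolding num_components_def by (rule surj_card_le[OF finite_sccs_remove_verts])
qed

lemma card_neighbours: "card {u. v \<rightarrow>\<^bsub>G\<^esub> u} = out_degree G v"
proof -
  have "{u. v \<rightarrow>\<^bsub>G\<^esub> u} = head G ` out_arcs G v" by (auto simp: arcs_ends_conv)
  moreover have "inj_on (head G) (out_arcs G v)"
    using no_multi_arcs by (auto simp: inj_on_def arc_to_ends_def)
  ultimately show ?thesis by (simp add: card_image out_degree_def)
qed

lemma dominates_tough_graph:
  assumes "k_connected 3 G" "one_tough G" "card (verts G) \<le> 3 * min_degree G + 2"
  shows "tough_graph (verts G) (\<lambda>u v. u \<rightarrow>\<^bsub>G\<^esub> v) (min_degree G)"
proof -
  interpret A: sgraph "verts G" "\<lambda>u v. u \<rightarrow>\<^bsub>G\<^esub> v" by (rule dominates_sgraph)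
  show ?thesis
  proof
    show "min_degree G \<le> card {u. v \<rightarrow>\<^bsub>G\<^esub> u}" if "v \<in> verts G" for v
      unfolding min_degree_def card_neighbours using that by (intro Min_le) auto
  next
    fix S U assume S: "S \<subseteq> verts G" "card S < 3" and U: "U \<subseteq> verts G - S" "U \<noteq> {}"
      and closed: "\<And>u v. u \<in> U \<Longrightarrow> u \<rightarrow>\<^bsub>G\<^esub> v \<Longrightarrow> v \<in> U \<union> S"
    let ?H = "remove_verts G S"
    interpret H: sym_digraph ?H by (rule sym_digraph_remove_verts)
    have conn: "Digraph_Component.connected ?H" using assms(1) S by (auto simp: k_connected_def)
    obtain u where u: "u \<in> U" using U by blast
    have "v \<in> U" if "v \<in> verts G - S" for v
    proof -
      have "u \<rightarrow>\<^sup>*\<^bsub>?H\<^esub> v" using connected_remove_verts[OF conn] u U that by blast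
      then show ?thesis
      proof (induct rule: H.reachable_induct)
        case (step x y)
        then show ?case using closed[of x y] unfolding dominates_remove_verts by blast
      qed (rule u)
    qed
    then show "U \<union> S = verts G" using S U by blast
  next
    fix S and f :: "'a \<Rightarrow> 'a option"
    assume S: "S \<subseteq> verts G" and f: "\<And>u v. u \<in> verts G - S \<Longrightarrow> v \<in> verts G - S \<Longrightarrow> u \<rightarrow>\<^bsub>G\<^esub> v \<Longrightarrow> f u = f v"
      and gt: "1 < card (f ` (verts G - S))"
    have "card (f ` (verts G - S)) \<le> num_components (remove_verts G S)" by (rule num_components_ge[OF f])
    then show "card (f ` (verts G - S)) \<le> card S"
      using assms(2) S gt unfolding one_tough_def by (meson le_trans less_le_trans)
  qed (rule assms(3))
qed

text \<open>\<open>awalk_verts\<close> repeats the first vertex at the end; the tails of the arcs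
  list every vertex once.\<close>

lemma cyc_of_graph_cycle:
  assumes "graph_cycle G C"
  shows "sgraph.cyc (verts G) (\<lambda>u v. u \<rightarrow>\<^bsub>G\<^esub> v) (map (tail G) C)"
    and "cycle_verts G C = set (map (tail G) C)"
proof -
  interpret A: sgraph "verts G" "\<lambda>u v. u \<rightarrow>\<^bsub>G\<^esub> v" by (rule dominates_sgraph)
  obtain u where u: "awalk u C u" "distinct (tl (awalk_verts u C))" "C \<noteq> []" "3 \<le> length C"
    using assms by (auto simp: graph_cycle_def cycle_def)
  have ch: "A.chain (awalk_verts v p)" if "cas v p w" "set p \<subseteq> arcs G" for v p w
    using that
  proof (induction p arbitrary: v)
    case (Cons e p)
    then have "A.chain (awalk_verts (head G e) p)" by simp
    moreover have "hd (awalk_verts (head G e) p) = head G e" using Cons.prems by (intro awhd_if_cas[of _ _ w]) simp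
    moreover have "tail G e \<rightarrow>\<^bsub>G\<^esub> head G e" using Cons.prems(2) by (auto simp: arcs_ends_conv)
    ultimately show ?case by (simp add: A.chain_Cons)
  qed (simp add: A.chain_Cons)
  have cas: "cas u C u" "set C \<subseteq> arcs G" using u(1) by (auto simp: awalk_def)
  have av: "awalk_verts u C = map (tail G) C @ [u]"
    using awalk_verts_conv[of u C] awlast_if_cas[OF cas(1)] u(3) by simp
  have hdt: "hd (map (tail G) C) = u" using cas(1) u(3) by (cases C) auto
  obtain zs where zs: "map (tail G) C = u # zs" using hdt u(3) by (cases C) auto
  have "A.chain (map (tail G) C @ [u])" using ch[OF cas] av by simp
  then have "A.chain (map (tail G) C)" "last (map (tail G) C) \<rightarrow>\<^bsub>G\<^esub> u"
    using u(3) by (auto simp: A.chain_append)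
  moreover have "distinct (map (tail G) C)" using u(2) unfolding av zs by auto
  moreover have "set (map (tail G) C) \<subseteq> verts G" using cas(2) by auto
  ultimately show "A.cyc (map (tail G) C)" using u(4) hdt by (simp add: A.cyc_def)
  have "awalk_verts (tail G (hd C)) C = map (tail G) C @ [u]" using awalk_verts_ne_eq[OF u(3)] av by metis
  then show "cycle_verts G C = set (map (tail G) C)" unfolding cycle_verts_def using zs by simp
qed

lemma graph_cycle_of_cyc:
  assumes "sgraph.cyc (verts G) (\<lambda>u v. u \<rightarrow>\<^bsub>G\<^esub> v) xs"
  shows "\<exists>D. graph_cycle G D \<and> length D = length xs"
proof -
  interpret A: sgraph "verts G" "\<lambda>u v. u \<rightarrow>\<^bsub>G\<^esub> v" by (rule dominates_sgraph)
  have ex: "\<exists>p. awalk (hd ys) p (last ys) \<and> awalk_verts (hd ys) p = ys"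
    if "A.chain ys" "ys \<noteq> []" "set ys \<subseteq> verts G" for ys
    using that
  proof (induction ys)
    case (Cons y ys)
    show ?case
    proof (cases "ys = []")
      case True
      then show ?thesis using Cons.prems by (intro exI[of _ "[]"]) (auto simp: awalk_def)
    next
      case False
      then obtain p where p: "awalk (hd ys) p (last ys)" "awalk_verts (hd ys) p = ys"
        using Cons by (auto simp: A.chain_Cons)
      have "y \<rightarrow>\<^bsub>G\<^esub> hd ys" using Cons.prems(1) False by (simp add: A.chain_Cons)
      then obtain e where "e \<in> arcs G" "tail G e = y" "head G e = hd ys" by (auto elim: reachableE)
      then show ?thesis using p False Cons.prems(3) by (intro exI[of _ "e # p"]) (auto simp: awalk_def)
    qed
  qed simp
  have xs: "distinct xs" "set xs \<subseteq> verts G" "3 \<le> length xs" "A.chain xs" "last xs \<rightarrow>\<^bsub>G\<^esub> hd xs"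
    using assms by (auto simp: A.cyc_def)
  then obtain x zs where x: "xs = x # zs" by (cases xs) auto
  have "hd xs = x" by (simp add: x)
  then have "A.chain (xs @ [x])" unfolding A.chain_append using xs(4,5) by (simp add: A.chain_Cons)
  then obtain p where p: "awalk x p x" "awalk_verts x p = xs @ [x]"
    using ex[of "xs @ [x]"] xs x by auto
  have len: "length p = length xs" using length_awalk_verts[of x p] p(2) by simp
  moreover have "distinct (tl (awalk_verts x p))" using xs(1) by (simp add: p(2) x)
  ultimately have "graph_cycle G p" unfolding graph_cycle_def cycle_def using p(1) xs(3) by auto
  then show ?thesis using len by blast
qed

end

theorem theorem2:
  fixes G :: "('a, 'b) pre_digraph" and n \<delta> :: nat
  assumes "graph G"
    and "k_connected 3 G"
    and "one_tough G"
    and "n = card (verts G)"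
    and "\<delta> = min_degree G"
    and "real \<delta> \<ge> 1 / 3 * (real n - 2)"
  shows "\<forall>C. longest_cycle G C \<longrightarrow> dominating_cycle G C"
proof (intro allI impI)
  fix C assume C: "longest_cycle G C"
  interpret graph G by (rule assms(1))
  have "real n \<le> real (3 * \<delta> + 2)" using assms(6) by (simp add: field_simps)
  then have "card (verts G) \<le> 3 * min_degree G + 2" unfolding of_nat_le_iff assms(4,5) .
  then interpret T: tough_graph "verts G" "\<lambda>u v. u \<rightarrow>\<^bsub>G\<^esub> v" "min_degree G"
    using dominates_tough_graph assms(2,3) by blast
  let ?xs = "map (tail G) C"
  have gc: "graph_cycle G C" using C by (simp add: longest_cycle_def)
  note cyc = cyc_of_graph_cycle[OF gc]
  have "T.longest ?xs"
    unfolding T.longest_def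
  proof (intro conjI allI impI cyc(1))
    fix ys assume "T.cyc ys"
    then obtain D where "graph_cycle G D" "length D = length ys" using graph_cycle_of_cyc by blast
    then show "length ys \<le> length ?xs" using C by (auto simp: longest_cycle_def)
  qed
  then have "\<not> u \<rightarrow>\<^bsub>G\<^esub> v" if "u \<in> verts G - set ?xs" "v \<in> verts G - set ?xs" for u v
    using T.longest_dominating that by blast
  then have "arcs (remove_verts G (cycle_verts G C)) = {}"
    unfolding cyc(2) remove_verts_def by (auto simp: arcs_ends_conv)
  then show "dominating_cycle G C" using gc by (simp add: dominating_cycle_def)
qed

end
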